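(* Let $n\le m$, let $\Omega\subset\mathbb{R}^n$ be a domain, let $\omega$ be a bounded $n$-volume form in $\mathbb{R}^m$, and let $f=(f_1,\dots,f_m):\Omega\to\mathbb{R}^m$ be a finite distortion $\omega$-curve with distortion function $K_f$ such that the coordinate functions $f_i$, $i=1,\dots,m$, are weakly monotone. Suppose that there exists $\lambda>0$ such that $e^{\lambda K_f}\in L^1_{loc}(\Omega)$. Then $f$ has a continuous representative in $\Omega$.
   Context: An $n$-volume form on $\mathbb{R}^m$ is a smooth, non-vanishing, closed differential $n$-form $\omega=\sum_I\phi_I\,dx_I$, the sum being over multi-indices $I=(i_1,\dots,i_n)$, $1\le i_1<\dots<i_n\le m$, with $dx_I=dx_{i_1}\wedge\dots\wedge dx_{i_n}$. It is called bounded if all the (not identically zero) functions $\phi_I$ are bounded on $\mathbb{R}^m$ and there is a constant $c>0$ such that for every $x\in\mathbb{R}^m$ there is a multi-index $I_x$ with $|\phi_{I_x}(x)|>c$. The pointwise comass norm is $\|\omega\|(p)=\sup\{|\omega_p(v_1,\dots,v_n)|: v_1,\dots,v_n\in\mathbb{R}^m,\ |v_i|\le 1\}$. For a Sobolev map $f$, $\star f^*\omega$ denotes the real-valued function with $(\star f^*\omega)\,dx_1\wedge\dots\wedge dx_n=f^*\omega$ (pullback computed with weak derivatives). $|Df(x)|$ is the operator norm of the weak differential. Finite distortion $\omega$-curve: a map $f\in W^{1,1}_{loc}(\Omega,\mathbb{R}^m)$ such that $\star f^*\omega\in L^1_{loc}(\Omega)$ and there is a measurable function $K_f\ge 1$,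 finite almost everywhere (the distortion function), with $(\|\omega\|\circ f)(x)\,|Df(x)|^n\le K_f(x)\,(\star f^*\omega)(x)$ for almost every $x\in\Omega$. Weakly monotone: a real-valued $u\in W^{1,1}_{loc}(\Omega)$ is weakly monotone if for all balls $B$ compactly contained in $\Omega$ and all constants $m\le M$ in $\mathbb{R}$ such that $|M-u|-|u-m|+2u-m-M\in W^{1,1}_0(B)$, one has $m\le u(x)\le M$ for almost every $x\in B$. Here $W^{1,1}_0(B)$ is the closure of $C_0^\infty(B)$ in the Sobolev norm. *)

theory Defs
  imports "HOL-Analysis.Analysis"
begin

section \<open>Smooth functions and test functions\<close>

definition partial :: "'n \<Rightarrow> (real^'n \<Rightarrow> real) \<Rightarrow> real^'n \<Rightarrow> real" where
  "partial i f x = frechet_derivative f (at x) (axis i 1)"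

definition gradient :: "(real^'n \<Rightarrow> real) \<Rightarrow> real^'n \<Rightarrow> real^'n" where
  "gradient f x = (\<chi> i. partial i f x)"

text \<open>\<open>C_k k f\<close>: \<open>f\<close> is of class \<open>C^k\<close> on the whole space.\<close>

primrec C_k :: "nat \<Rightarrow> (real^'n \<Rightarrow> real) \<Rightarrow> bool" where
  "C_k 0 f = continuous_on UNIV f"
| "C_k (Suc k) f = ((\<forall>x. f differentiable (at x)) \<and> (\<forall>i. C_k k (partial i f)))"

definition smooth :: "(real^'n \<Rightarrow> real) \<Rightarrow> bool" where
  "smooth f \<longleftrightarrow> (\<forall>k. C_k k f)"

definition test_functions :: "(real^'n) set \<Rightarrow> (real^'n \<Rightarrow> real) set" where
  "test_functions U =
     {\<phi>. smooth \<phi> \<and> compact (closure {x. \<phi> x \<noteq> 0}) \<and> closure {x. \<phi> x \<noteq> 0} \<subseteq> U}"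


section \<open>Differential forms of degree n on m-dimensional space\<close>

text \<open>
  The index types \<open>'n\<close> and \<open>'m\<close> are finite and linearly ordered, so they stand for
  \<open>{1..n}\<close> and \<open>{1..m}\<close>. A form \<open>\<Sum>\<^sub>I \<phi>\<^sub>I dx\<^sub>I\<close> is given by its coefficient family; only the
  coefficients at strictly increasing multi-indices are ever used.
\<close>

type_synonym ('n, 'm) form = "('n \<Rightarrow> 'm) \<Rightarrow> real^'m \<Rightarrow> real"

definition multi_indices :: "('n::{finite,wellorder} \<Rightarrow> 'm::{finite,wellorder}) set" where
  "multi_indices = {I. strict_mono I}"

text \<open>
  The value of \<open>dx\<^sub>I = dx\<^sub>I\<^sub>(\<^sub>1\<^sub>) \<and> \<dots> \<and> dx\<^sub>I\<^sub>(\<^sub>n\<^sub>)\<close> on the vectors \<open>v\<close>, with the normalisation in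
  which \<open>dx\<^sub>1 \<and> \<dots> \<and> dx\<^sub>n\<close> is the determinant. The index type \<open>'k\<close> need not be ordered here:
  permuting the covectors and the vectors simultaneously does not change the determinant.
\<close>

definition dx :: "('k::finite \<Rightarrow> 'm::finite) \<Rightarrow> ('k \<Rightarrow> real^'m) \<Rightarrow> real" where
  "dx I v = det (\<chi> a b. v b $ I a)"

definition form_at ::
    "('n::{finite,wellorder}, 'm::{finite,wellorder}) form \<Rightarrow> real^'m::_ \<Rightarrow> ('n \<Rightarrow> real^'m::_) \<Rightarrow> real" where
  "form_at \<omega> p v = (\<Sum>I\<in>multi_indices. \<omega> I p * dx I v)"

text \<open>
  \<open>d\<omega> = \<Sum>\<^sub>I \<Sum>\<^sub>j (\<partial>\<^sub>j \<phi>\<^sub>I) dx\<^sub>j \<and> dx\<^sub>I\<close>. The \<open>n + 1\<close> slots are indexed by \<open>'n option\<close>, where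
  \<open>None\<close> is the slot placed in front of those of \<open>'n\<close>.
\<close>

definition exterior_derivative_at ::
    "('n::{finite,wellorder}, 'm::{finite,wellorder}) form \<Rightarrow>
      real^'m::_ \<Rightarrow> ('n option \<Rightarrow> real^'m::_) \<Rightarrow> real" where
  "exterior_derivative_at \<omega> p v =
     (\<Sum>I\<in>multi_indices. \<Sum>j\<in>UNIV. partial j (\<omega> I) p * dx (case_option j I) v)"

definition volume_form :: "('n::{finite,wellorder}, 'm::{finite,wellorder}) form \<Rightarrow> bool" where
  "volume_form \<omega> \<longleftrightarrow>
     (\<forall>I\<in>multi_indices. smooth (\<omega> I)) \<and>
     (\<forall>p. \<exists>v. form_at \<omega> p v \<noteq> 0) \<and>
     (\<forall>p v. exterior_derivative_at \<omega> p v = 0)"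

definition bounded_form :: "('n::{finite,wellorder}, 'm::{finite,wellorder}) form \<Rightarrow> bool" where
  "bounded_form \<omega> \<longleftrightarrow>
     (\<forall>I\<in>multi_indices. bounded (range (\<omega> I))) \<and>
     (\<exists>c>0. \<forall>x. \<exists>I\<in>multi_indices. \<bar>\<omega> I x\<bar> > c)"

definition comass :: "('n::{finite,wellorder}, 'm::{finite,wellorder}) form \<Rightarrow> real^'m::_ \<Rightarrow> real" where
  "comass \<omega> p = Sup {\<bar>form_at \<omega> p v\<bar> | v. \<forall>i. norm (v i) \<le> 1}"


section \<open>Sobolev functions\<close>

definition loc_integrable :: "(real^'n) set \<Rightarrow> (real^'n \<Rightarrow> 'b::euclidean_space) \<Rightarrow> bool" where
  "loc_integrable U f \<longleftrightarrow> (\<forall>C. compact C \<and> C \<subseteq> U \<longrightarrow> f absolutely_integrable_on C)"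

definition weak_gradient :: "(real^'n) set \<Rightarrow> (real^'n \<Rightarrow> real) \<Rightarrow> (real^'n \<Rightarrow> real^'n) \<Rightarrow> bool" where
  "weak_gradient U u g \<longleftrightarrow>
     loc_integrable U u \<and> loc_integrable U g \<and>
     (\<forall>\<phi>\<in>test_functions U. \<forall>i.
        (LINT x:U|lebesgue. u x * partial i \<phi> x) = - (LINT x:U|lebesgue. g x $ i * \<phi> x))"

definition W11_loc :: "(real^'n) set \<Rightarrow> (real^'n \<Rightarrow> real) set" where
  "W11_loc U = {u. \<exists>g. weak_gradient U u g}"

text \<open>Row \<open>i\<close> of the matrix \<open>Df x\<close> is the weak gradient of the coordinate function \<open>f\<^sub>i\<close>;
  the existence of such a \<open>Df\<close> means that \<open>f\<close> is in \<open>W\<^sup>1\<^sup>,\<^sup>1\<^sub>l\<^sub>o\<^sub>c(U, R\<^sup>m)\<close>.\<close>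

definition weak_differential ::
    "(real^'n) set \<Rightarrow> (real^'n \<Rightarrow> real^'m) \<Rightarrow> (real^'n \<Rightarrow> real^'n^'m) \<Rightarrow> bool" where
  "weak_differential U f Df \<longleftrightarrow> (\<forall>i. weak_gradient U (\<lambda>x. f x $ i) (\<lambda>x. Df x $ i))"

text \<open>Membership in the closure of the test functions on \<open>B\<close> within \<open>W\<^sup>1\<^sup>,\<^sup>1(B)\<close>.\<close>

definition W11_0 :: "(real^'n) set \<Rightarrow> (real^'n \<Rightarrow> real) set" where
  "W11_0 B = {u. \<exists>g. weak_gradient B u g \<and>
     u absolutely_integrable_on B \<and> g absolutely_integrable_on B \<and>
     (\<forall>\<epsilon>>0. \<exists>\<phi>\<in>test_functions B.
        (LINT x:B|lebesgue. \<bar>u x - \<phi> x\<bar>) + (LINT x:B|lebesgue. norm (g x - gradient \<phi> x)) < \<epsilon>)}"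

definition weakly_monotone :: "(real^'n) set \<Rightarrow> (real^'n \<Rightarrow> real) \<Rightarrow> bool" where
  "weakly_monotone U u \<longleftrightarrow>
     u \<in> W11_loc U \<and>
     (\<forall>a r m M. r > 0 \<and> cball a r \<subseteq> U \<and> m \<le> M \<and>
        (\<lambda>x. \<bar>M - u x\<bar> - \<bar>u x - m\<bar> + 2 * u x - m - M) \<in> W11_0 (ball a r)
        \<longrightarrow> (AE x in lebesgue_on (ball a r). m \<le> u x \<and> u x \<le> M))"


section \<open>Curves of finite distortion\<close>

definition pullback_at ::
    "(real^'n::_ \<Rightarrow> real^'m::_) \<Rightarrow> (real^'n::_ \<Rightarrow> (real^'n::_)^'m::_) \<Rightarrow>
      ('n::{finite,wellorder}, 'm::{finite,wellorder}) form \<Rightarrow> real^'n::_ \<Rightarrow> ('n \<Rightarrow> real^'n::_) \<Rightarrow> real" where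
  "pullback_at f Df \<omega> x v = form_at \<omega> (f x) (\<lambda>i. Df x *v v i)"

definition star_pullback ::
    "(real^'n::_ \<Rightarrow> real^'m::_) \<Rightarrow> (real^'n::_ \<Rightarrow> (real^'n::_)^'m::_) \<Rightarrow>
      ('n::{finite,wellorder}, 'm::{finite,wellorder}) form \<Rightarrow> real^'n::_ \<Rightarrow> real" where
  "star_pullback f Df \<omega> x = (THE h. \<forall>v. h * dx id v = pullback_at f Df \<omega> x v)"

text \<open>
  \<open>K\<close> is extended real valued, since a distortion function is only finite almost everywhere.
  The weak differential is unique up to null sets, so the choice of \<open>Df\<close> is immaterial.
\<close>

definition finite_distortion_curve ::
    "(real^'n::_) set \<Rightarrow> ('n::{finite,wellorder}, 'm::{finite,wellorder}) form \<Rightarrow>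
      (real^'n::_ \<Rightarrow> real^'m::_) \<Rightarrow> (real^'n::_ \<Rightarrow> ereal) \<Rightarrow> bool" where
  "finite_distortion_curve U \<omega> f K \<longleftrightarrow>
     (\<exists>Df. weak_differential U f Df \<and>
        loc_integrable U (star_pullback f Df \<omega>) \<and>
        K \<in> borel_measurable (lebesgue_on U) \<and>
        (\<forall>x\<in>U. K x \<ge> 1) \<and>
        (AE x in lebesgue_on U. K x < \<infinity>) \<and>
        (AE x in lebesgue_on U.
           ereal (comass \<omega> (f x) * onorm ((*v) (Df x)) ^ CARD('n))
             \<le> K x * ereal (star_pullback f Df \<omega> x)))"

end

theory Submission
  imports Defs
begin

text \<open>
  Mollify a coordinate function \<open>u\<close> with weak gradient \<open>V\<close>. For a point \<open>x\<close> of the sphere of radius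
  \<open>t\<close> about \<open>a\<close>, the difference of \<open>u x\<close> and the mean of \<open>u\<close> over the ball of radius \<open>R\<close> is an average of
  \<open>V\<close> over the homotheties of the ball with centre \<open>x\<close> and ratio \<open>s\<close>. The part of \<open>V\<close> below a
  threshold \<open>T s powr (- \<beta>)\<close> contributes little; the part above it is bounded uniformly in \<open>x\<close> by an
  integral over a shell of width proportional to \<open>R s\<close>, which is small after averaging over \<open>t\<close>. So on some
  sphere the mollified functions have small oscillation, their truncations are test functions, and
  weak monotonicity bounds the oscillation of \<open>u\<close> in the ball. If the oscillation stayed above
  \<open>\<epsilon>\<close> at all scales \<open>R = 2 ^ (- j)\<close>, taking \<open>T\<close> of order \<open>\<epsilon> / R\<close> would give
  \<open>1 \<le> C * 2 ^ (j / 2) * (integral of |V| ^ (n - 1/2) over |V| > \<kappa> * 2 ^ j)\<close> for all large \<open>j\<close>. Summing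
  with the weights \<open>1 / j\<close>, the right hand side becomes an integral of about \<open>|V| ^ n / log |V|\<close>, which the
  distortion inequality bounds by \<open>\<star>f\<^sup>*\<omega> + exp (lam * K)\<close>, whereas the harmonic series diverges.
\<close>

section \<open>Smooth functions\<close>

text \<open>Weak monotonicity asks for membership in \<open>W11_0\<close>, a closure of test
  functions. The oscillation on a sphere therefore has to be estimated for smooth approximants, and
  one sphere has to serve infinitely many of them; Fatou's lemma selects it. The exponent n - 1/2
  lies strictly between n - 1, above which a sphere estimate of Sobolev type is available, and n,
  where the energy is controlled only up to a logarithm. The threshold T s^(-\<beta>) has \<beta> <
  1, so that it is integrable in s, but \<beta> so close to 1 that the part of |V| above it has a
  finite integral against s^(1-n). The threshold also makes the scales summable. It is at least T,
  of order 2^j, so the shrinking ball may be enlarged to a fixed one: a point z counts only at those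
  scales where |V z| > \<kappa> 2^j, and there the sum of 2^(j/2) / j is about |V z|^(1/2) / log |V
  z|. In dimension 1 the weight s^(1-n) is constant; a constant threshold is used, and the integral
  of |V| over shrinking balls tends to 0.\<close>

lemma partial_eqI: "(f has_derivative f') (at x) \<Longrightarrow> partial i f x = f' (axis i 1)"
  unfolding partial_def by (metis frechet_derivative_at)

lemma has_derivative_partial:
  fixes f :: "real^'n::finite \<Rightarrow> real"
  assumes "f differentiable (at x)"
  shows "(f has_derivative (\<lambda>h. gradient f x \<bullet> h)) (at x)"
proof -
  let ?D = "frechet_derivative f (at x)"
  have D: "(f has_derivative ?D) (at x)" using assms frechet_derivative_works by blast
  then have lin: "linear ?D" by (rule has_derivative_linear)
  have "?D h = gradient f x \<bullet> h" for h
  proof -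
    have "?D h = ?D (\<Sum>i\<in>UNIV. h $ i *\<^sub>R axis i 1)"
      by (simp add: basis_expansion flip: scalar_mult_eq_scaleR)
    also have "\<dots> = (\<Sum>i\<in>UNIV. h $ i *\<^sub>R partial i f x)"
      by (simp add: linear_sum[OF lin] linear_cmul[OF lin] partial_def)
    finally show ?thesis
      by (simp add: gradient_def inner_vec_def mult.commute)
  qed
  then have "?D = (\<lambda>h. gradient f x \<bullet> h)" by auto
  with D show ?thesis by simp
qed

lemma C_k_Suc_imp: "C_k (Suc k) f \<Longrightarrow> C_k k f"
proof (induction k arbitrary: f)
  case 0
  then show ?case
    by (auto intro!: continuous_at_imp_continuous_on differentiable_imp_continuous_within)
qed auto

lemma C_k_differentiable: "C_k (Suc k) f \<Longrightarrow> f differentiable (at x)"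
  by simp

lemma smooth_differentiable: "smooth f \<Longrightarrow> f differentiable (at x)"
  unfolding smooth_def by (metis C_k_differentiable)

lemma smooth_partial: "smooth f \<Longrightarrow> smooth (partial i f)"
  unfolding smooth_def using C_k.simps(2) by blast

lemma smooth_continuous: "smooth f \<Longrightarrow> continuous_on UNIV f"
  unfolding smooth_def using C_k.simps(1) by blast

lemma smooth_has_derivative: "smooth f \<Longrightarrow> (f has_derivative (\<lambda>h. gradient f x \<bullet> h)) (at x)"
  by (simp add: has_derivative_partial smooth_differentiable)

lemma continuous_gradient: "smooth f \<Longrightarrow> continuous_on UNIV (gradient f)"
  unfolding gradient_def by (intro continuous_on_vec_lambda smooth_continuous smooth_partial)

lemma partial_const [simp]: "partial i (\<lambda>x. c) = (\<lambda>x. 0)"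
  by (rule ext) (rule partial_eqI[where f' = "\<lambda>h. 0", simplified], auto)

lemma C_k_const: "C_k k (\<lambda>x. c)"
  by (induction k arbitrary: c) auto

lemma partial_add:
  assumes "f differentiable (at x)" "g differentiable (at x)"
  shows "partial i (\<lambda>x. f x + g x) x = partial i f x + partial i g x"
  by (subst partial_eqI[OF has_derivative_add[OF has_derivative_partial[OF assms(1)] has_derivative_partial[OF assms(2)]]])
    (simp add: gradient_def inner_axis)

lemma partial_mult:
  assumes "f differentiable (at x)" "g differentiable (at x)"
  shows "partial i (\<lambda>x. f x * g x) x = f x * partial i g x + partial i f x * g x"
  by (subst partial_eqI[OF has_derivative_mult[OF has_derivative_partial[OF assms(1)] has_derivative_partial[OF assms(2)]]])
    (simp add: gradient_def inner_axis)

lemma C_k_add: "C_k k f \<Longrightarrow> C_k k g \<Longrightarrow> C_k k (\<lambda>x. f x + g x)"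
proof (induction k arbitrary: f g)
  case (Suc k)
  have "partial i (\<lambda>x. f x + g x) = (\<lambda>x. partial i f x + partial i g x)" for i
    using Suc.prems by (intro ext partial_add) auto
  then show ?case using Suc by auto
qed (auto intro: continuous_on_add)

lemma C_k_mult: "C_k k f \<Longrightarrow> C_k k g \<Longrightarrow> C_k k (\<lambda>x. f x * g x)"
proof (induction k arbitrary: f g)
  case (Suc k)
  have "partial i (\<lambda>x. f x * g x) = (\<lambda>x. f x * partial i g x + partial i f x * g x)" for i
    using Suc.prems by (intro ext partial_mult) auto
  moreover have "C_k k (\<lambda>x. f x * partial i g x + partial i f x * g x)" for i
    using Suc C_k_Suc_imp by (intro C_k_add Suc.IH) auto
  ultimately show ?case using Suc.prems by auto
qed (auto intro: continuous_on_mult)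

lemma smooth_const: "smooth (\<lambda>x. c)"
  by (simp add: smooth_def C_k_const)

lemma smooth_add: "smooth f \<Longrightarrow> smooth g \<Longrightarrow> smooth (\<lambda>x. f x + g x)"
  by (simp add: smooth_def C_k_add)

lemma smooth_mult: "smooth f \<Longrightarrow> smooth g \<Longrightarrow> smooth (\<lambda>x. f x * g x)"
  by (simp add: smooth_def C_k_mult)

lemma smooth_uminus: "smooth f \<Longrightarrow> smooth (\<lambda>x. - f x)"
  using smooth_mult[OF smooth_const[of "-1"]] by simp

lemma smooth_diff: "smooth f \<Longrightarrow> smooth g \<Longrightarrow> smooth (\<lambda>x. f x - g x)"
  using smooth_add[OF _ smooth_uminus] by fastforce

lemma smooth_sum: "(\<And>i. i \<in> S \<Longrightarrow> smooth (f i)) \<Longrightarrow> smooth (\<lambda>x. \<Sum>i\<in>S. f i x)"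
  by (induction S rule: infinite_finite_induct) (auto simp: smooth_const intro: smooth_add)

lemma partial_nth: "partial i (\<lambda>x. x $ j) = (\<lambda>x. if i = j then 1 else 0)"
proof
  fix x :: "real^'a"
  have "((\<lambda>x. x $ j) has_derivative (\<lambda>h. h $ j)) (at x)"
    by (rule bounded_linear_imp_has_derivative[OF bounded_linear_vec_nth])
  from partial_eqI[OF this, of i]
  show "partial i (\<lambda>x. x $ j) x = (if i = j then 1 else 0)"
    by (auto simp: axis_def)
qed

lemma smooth_nth: "smooth (\<lambda>x::real^'n::finite. x $ j)"
proof -
  have "C_k k (\<lambda>x::real^'n. x $ j)" for k
  proof (cases k)
    case 0 then show ?thesis by (simp add: continuous_on_component)
  next
    case (Suc k')
    then show ?thesis
      by (auto simp: partial_nth C_k_const bounded_linear_vec_nth bounded_linear_imp_differentiable)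
  qed
  then show ?thesis by (simp add: smooth_def)
qed

text \<open>
  For \<open>j = 0\<close> this is a smooth, 1-Lipschitz regularisation of the positive part; the whole family
  is closed under differentiation up to linear combinations, which gives smoothness at 0.
\<close>

definition flat :: "real \<Rightarrow> nat \<Rightarrow> real \<Rightarrow> real" where
  "flat \<delta> j s = (if s \<le> 0 then 0 else s * (1 / s) ^ j * exp (- \<delta> / s))"

text \<open>For s > 0 the function is s^(1-j) exp (-\<delta>/s), whose derivative involves the
  members j + 1 and j + 2. At 0 the difference quotient is (1/h)^j exp (-\<delta>/h) for h > 0, and
  the exponential beats every power of 1/h.\<close>

lemma flat_has_derivative:
  assumes "\<delta> > 0"
  shows "(flat \<delta> j has_real_derivative (1 - real j) * flat \<delta> (Suc j) s + \<delta> * flat \<delta> (Suc (Suc j)) s) (at s)"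
proof -
  consider "s < 0" | "s > 0" | "s = 0" by linarith
  then show ?thesis
  proof cases
    case 1
    have "eventually (\<lambda>x. x < 0) (nhds s)" using 1 eventually_nhds_in_open[of "{..<0}" s] by auto
    then have "eventually (\<lambda>x. flat \<delta> j x = 0) (nhds s)"
      by eventually_elim (simp add: flat_def)
    then have "(flat \<delta> j has_real_derivative 0) (at s) \<longleftrightarrow> ((\<lambda>x. 0) has_real_derivative 0) (at s)"
      by (intro DERIV_cong_ev) auto
    then show ?thesis using 1 by (simp add: flat_def)
  next
    case 2
    have "eventually (\<lambda>x. x > 0) (nhds s)" using 2 eventually_nhds_in_open[of "{0<..}" s] by auto
    then have ev: "eventually (\<lambda>x. flat \<delta> j x = x * (1 / x) ^ j * exp (- \<delta> / x)) (nhds s)"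
      by eventually_elim (simp add: flat_def)
    have "((\<lambda>x. x * (1 / x) ^ j * exp (- \<delta> / x)) has_real_derivative
       ((1 / s) ^ j + s * (real j * (1 / s) ^ (j - 1) * (- (1 / (s * s))))) * exp (- \<delta> / s) +
       s * (1 / s) ^ j * (exp (- \<delta> / s) * (\<delta> / (s * s)))) (at s)"
      by (rule derivative_eq_intros refl | use 2 in \<open>simp add: field_simps\<close>)+
    also have "((1 / s) ^ j + s * (real j * (1 / s) ^ (j - 1) * (- (1 / (s * s))))) * exp (- \<delta> / s) +
       s * (1 / s) ^ j * (exp (- \<delta> / s) * (\<delta> / (s * s))) =
       (1 - real j) * flat \<delta> (Suc j) s + \<delta> * flat \<delta> (Suc (Suc j)) s"
      using 2 by (cases j) (auto simp: flat_def field_simps)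
    finally have "((\<lambda>x. x * (1 / x) ^ j * exp (- \<delta> / x)) has_real_derivative
       (1 - real j) * flat \<delta> (Suc j) s + \<delta> * flat \<delta> (Suc (Suc j)) s) (at s)" .
    then show ?thesis using DERIV_cong_ev[OF refl ev refl] by blast
  next
    case 3
    have "((\<lambda>h. (flat \<delta> j (0 + h) - flat \<delta> j 0) / h) \<longlongrightarrow> 0) (at 0)"
    proof -
      have L: "((\<lambda>h. (flat \<delta> j h) / h) \<longlongrightarrow> 0) (at_left 0)"
        by (rule tendsto_eventually)
          (auto simp: flat_def eventually_at_filter)
      have "((\<lambda>x. x ^ j * exp (- \<delta> * x)) \<longlongrightarrow> 0) at_top"
      proof -
        have "((\<lambda>x. (\<delta> * x) ^ j / exp (\<delta> * x)) \<longlongrightarrow> 0) at_top"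
          by (rule filterlim_compose[OF tendsto_power_div_exp_0])
            (use assms in \<open>auto intro!: filterlim_tendsto_pos_mult_at_top tendsto_const filterlim_ident\<close>)
        then have "((\<lambda>x. (1 / \<delta>) ^ j * ((\<delta> * x) ^ j / exp (\<delta> * x))) \<longlongrightarrow> (1 / \<delta>) ^ j * 0) at_top"
          by (intro tendsto_mult tendsto_const)
        also have "(\<lambda>x. (1 / \<delta>) ^ j * ((\<delta> * x) ^ j / exp (\<delta> * x))) = (\<lambda>x. x ^ j * exp (- \<delta> * x))"
          using assms by (auto simp: fun_eq_iff power_mult_distrib exp_minus field_simps power_one_over)
        finally show ?thesis by simp
      qed
      then have "((\<lambda>h. (inverse h) ^ j * exp (- \<delta> * inverse h)) \<longlongrightarrow> 0) (at_right 0)"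
        by (rule filterlim_compose) (rule filterlim_inverse_at_top_right)
      moreover have "\<forall>\<^sub>F h in at_right 0. (inverse h) ^ j * exp (- \<delta> * inverse h) = flat \<delta> j h / h"
        by (auto simp: eventually_at_filter flat_def field_simps)
      ultimately have R: "((\<lambda>h. (flat \<delta> j h) / h) \<longlongrightarrow> 0) (at_right 0)"
        by (rule Lim_transform_eventually)
      from L R show ?thesis by (simp add: filterlim_at_split flat_def)
    qed
    then show ?thesis using 3 by (simp add: DERIV_def flat_def)
  qed
qed

lemma partial_comp:
  assumes "(h has_real_derivative D) (at (v x))" "v differentiable (at x)"
  shows "partial i (\<lambda>x. h (v x)) x = D * partial i v x"
    and "(\<lambda>x. h (v x)) differentiable (at x)"
proof -
  have D: "((\<lambda>x. h (v x)) has_derivative (\<lambda>y. D * (gradient v x \<bullet> y))) (at x)"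
    using has_derivative_compose[OF has_derivative_partial[OF assms(2)]]
      assms(1)[unfolded has_field_derivative_def] by blast
  show "partial i (\<lambda>x. h (v x)) x = D * partial i v x"
    by (subst partial_eqI[OF D]) (simp add: gradient_def inner_axis)
  show "(\<lambda>x. h (v x)) differentiable (at x)" using D differentiable_def by blast
qed

lemma C_k_flat:
  assumes "\<delta> > 0" "C_k k v"
  shows "C_k k (\<lambda>x. flat \<delta> j (v x))"
  using assms(2)
proof (induction k arbitrary: j)
  case 0
  have "continuous_on UNIV (flat \<delta> j)"
    using flat_has_derivative[OF assms(1)] DERIV_isCont continuous_at_imp_continuous_on by blast
  with 0 show ?case by (auto intro: continuous_on_compose2)
next
  case (Suc k)
  have v: "v differentiable (at x)" for x using Suc by auto
  have "partial i (\<lambda>x. flat \<delta> j (v x)) =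
     (\<lambda>x. ((1 - real j) * flat \<delta> (Suc j) (v x) + \<delta> * flat \<delta> (Suc (Suc j)) (v x)) * partial i v x)" for i
    by (rule ext, rule partial_comp(1)[OF flat_has_derivative[OF assms(1)] v])
  moreover have "C_k k (\<lambda>x. ((1 - real j) * flat \<delta> (Suc j) (v x) + \<delta> * flat \<delta> (Suc (Suc j)) (v x)) * partial i v x)" for i
    using Suc C_k_Suc_imp by (intro C_k_mult C_k_add C_k_const Suc.IH) auto
  moreover have "(\<lambda>x. flat \<delta> j (v x)) differentiable (at x)" for x
    by (rule partial_comp(2)[OF flat_has_derivative[OF assms(1)] v])
  ultimately show ?case by auto
qed

lemma smooth_flat: "\<delta> > 0 \<Longrightarrow> smooth v \<Longrightarrow> smooth (\<lambda>x. flat \<delta> j (v x))"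
  by (simp add: smooth_def C_k_flat)

text \<open>No differentiability is assumed: \<open>frechet_derivative\<close> is a choice among the
  derivatives at the point, and functions that agree near the point have the same ones.\<close>

lemma partial_cong_open:
  assumes "open S" "x \<in> S" "\<And>y. y \<in> S \<Longrightarrow> f y = g y"
  shows "partial i f x = partial i g x"
proof -
  have "(f has_derivative D) (at x) \<longleftrightarrow> (g has_derivative D) (at x)" for D
    by (metis has_derivative_transform_within_open[OF _ assms(1,2)] assms(3))
  then show ?thesis by (simp add: partial_def frechet_derivative_def)
qed

lemma partial_zero_open:
  assumes "open S" "x \<in> S" "\<And>y. y \<in> S \<Longrightarrow> f y = 0"
  shows "partial i f x = 0"
  using partial_cong_open[of S x f "\<lambda>x. 0" i] assms by simp

text \<open>The cut function is \<open>f\<close> on the open set \<open>B\<close> and 0 on the open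
  set consisting of \<open>N\<close> and the exterior of \<open>B\<close>; together they cover the
  space. The partial derivatives of \<open>f\<close> vanish on \<open>N\<close> as well, which keeps
  the induction on \<open>k\<close> going.\<close>

lemma C_k_cut:
  assumes "open B" "open N" "closure B \<subseteq> B \<union> N"
  shows "C_k k f \<Longrightarrow> (\<And>x. x \<in> N \<Longrightarrow> f x = 0) \<Longrightarrow> C_k k (\<lambda>x. if x \<in> B then f x else 0)"
proof (induction k arbitrary: f)
  case 0
  have "continuous_on (B \<union> (N \<union> - closure B)) (\<lambda>x. if x \<in> B then f x else 0)"
  proof (rule continuous_on_open_Un)
    show "continuous_on B (\<lambda>x. if x \<in> B then f x else 0)"
      by (rule continuous_on_eq[of _ f]) (use 0 in \<open>auto intro: continuous_on_subset\<close>)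
    show "continuous_on (N \<union> - closure B) (\<lambda>x. if x \<in> B then f x else 0)"
      by (rule continuous_on_eq[of _ "\<lambda>x. 0"]) (use 0 closure_subset in auto)
  qed (use assms in auto)
  moreover have "B \<union> (N \<union> - closure B) = UNIV" using assms(3) by auto
  ultimately show ?case by simp
next
  case (Suc k)
  let ?g = "\<lambda>x. if x \<in> B then f x else 0"
  have cover: "x \<in> B \<or> x \<in> N \<union> - closure B" for x using assms(3) by auto
  have oN: "open (N \<union> - closure B)" using assms by auto
  have zero: "?g y = 0" if "y \<in> N \<union> - closure B" for y using that Suc.prems closure_subset by auto
  have "?g differentiable (at x)" for x
  proof (cases "x \<in> B")
    case True
    have "f differentiable (at x)" using Suc by auto
    then obtain D where "(f has_derivative D) (at x)" unfolding differentiable_def by blast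
    then have "(?g has_derivative D) (at x)"
      by (rule has_derivative_transform_within_open[OF _ assms(1) True]) auto
    then show ?thesis unfolding differentiable_def by blast
  next
    case False
    then have x: "x \<in> N \<union> - closure B" using cover by auto
    have "(?g has_derivative (\<lambda>h. 0)) (at x)"
      by (rule has_derivative_transform_within_open[OF has_derivative_const[of 0] oN x]) (use zero in auto)
    then show ?thesis unfolding differentiable_def by blast
  qed
  moreover have "partial i ?g = (\<lambda>x. if x \<in> B then partial i f x else 0)" for i
  proof
    fix x show "partial i ?g x = (if x \<in> B then partial i f x else 0)"
    proof (cases "x \<in> B")
      case True
      then show ?thesis using partial_cong_open[OF assms(1) True, of f ?g i] by auto
    next
      case False
      with cover have x: "x \<in> N \<union> - closure B" by auto
      have "partial i ?g x = 0" by (rule partial_zero_open[OF oN x]) (rule zero)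
      with False show ?thesis by simp
    qed
  qed
  moreover have "partial i f x = 0" if "x \<in> N" for i x
    using partial_zero_open[OF assms(2) that] Suc by auto
  ultimately show ?case using Suc by auto
qed

lemma smooth_cut:
  assumes "open B" "open N" "closure B \<subseteq> B \<union> N" "smooth f" "\<And>x. x \<in> N \<Longrightarrow> f x = 0"
  shows "smooth (\<lambda>x. if x \<in> B then f x else 0)"
  using C_k_cut[OF assms(1-3)] assms(4,5) by (auto simp: smooth_def)

text \<open>The scalar \<open>c\<close> is carried along because each differentiation produces a
  factor -1.\<close>

lemma C_k_reflect: "C_k k f \<Longrightarrow> C_k k (\<lambda>y. c * f (x - y))"
  and partial_reflect: "f differentiable (at (x - y)) \<Longrightarrow> partial i (\<lambda>y. c * f (x - y)) y = - c * partial i f (x - y)"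
proof -
  have D: "((\<lambda>y. c * f (x - y)) has_derivative (\<lambda>h. c * (gradient f (x - y) \<bullet> (- h)))) (at y)"
    if "f differentiable (at (x - y))" for f c y
  proof -
    have "((\<lambda>y. x - y) has_derivative (\<lambda>h. - h)) (at y)"
      by (auto intro!: derivative_eq_intros)
    from has_derivative_compose[OF this has_derivative_partial[OF that]]
    show ?thesis by (intro has_derivative_mult_right)
  qed
  have P: "partial i (\<lambda>y. c * f (x - y)) y = - c * partial i f (x - y)"
    if "f differentiable (at (x - y))" for f c y i
    by (subst partial_eqI[OF D[OF that]]) (simp add: gradient_def inner_axis)
  then show "f differentiable (at (x - y)) \<Longrightarrow> partial i (\<lambda>y. c * f (x - y)) y = - c * partial i f (x - y)" .
  show "C_k k f \<Longrightarrow> C_k k (\<lambda>y. c * f (x - y))"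
  proof (induction k arbitrary: f c)
    case 0
    then show ?case by (auto intro!: continuous_intros elim: continuous_on_compose2)
  next
    case (Suc k)
    have "partial i (\<lambda>y. c * f (x - y)) = (\<lambda>y. (- c) * partial i f (x - y))" for i
      using Suc.prems by (intro ext P) auto
    moreover have "(\<lambda>y. c * f (x - y)) differentiable (at y)" for y
    proof -
      have "f differentiable (at (x - y))" using Suc.prems by auto
      from D[OF this] show ?thesis unfolding differentiable_def by blast
    qed
    moreover have "C_k k (\<lambda>y. (- c) * partial i f (x - y))" for i
      by (rule Suc.IH) (use Suc.prems in auto)
    ultimately show ?case by simp
  qed
qed

lemma smooth_reflect: "smooth f \<Longrightarrow> smooth (\<lambda>y. f (x - y))"
  using C_k_reflect[of _ f 1 x] by (simp add: smooth_def)

section \<open>Mollification\<close>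

lemma uniformly_continuous_compact_support:
  fixes f :: "'a::euclidean_space \<Rightarrow> 'b::real_normed_vector"
  assumes cont: "continuous_on UNIV f" and zero: "\<And>x. norm x > r \<Longrightarrow> f x = 0"
  shows "uniformly_continuous_on UNIV f"
proof -
  \<comment> \<open>Two points at distance below 1 lie either both in this ball or both where
    \<open>f\<close> vanishes; hence the radius r + 1.\<close>
  have uc: "uniformly_continuous_on (cball 0 (r + 1)) f"
    by (intro compact_uniformly_continuous compact_cball continuous_on_subset[OF cont]) auto
  show ?thesis unfolding uniformly_continuous_on_def
  proof (intro allI impI)
    fix e :: real assume "e > 0"
    then obtain d where d: "d > 0" "\<And>x x'. x \<in> cball 0 (r + 1) \<Longrightarrow> x' \<in> cball 0 (r + 1) \<Longrightarrow> dist x' x < d \<Longrightarrow> dist (f x') (f x) < e"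
      using uc unfolding uniformly_continuous_on_def by blast
    show "\<exists>d>0. \<forall>x\<in>UNIV. \<forall>x'\<in>UNIV. dist x' x < d \<longrightarrow> dist (f x') (f x) < e"
    proof (intro exI[of _ "min d 1"] conjI ballI impI)
      fix x x' :: 'a assume xx: "dist x' x < min d 1"
      have tri: "norm x \<le> norm x' + dist x' x" "norm x' \<le> norm x + dist x' x"
        by (metis dist_norm norm_triangle_sub norm_minus_commute)+
      show "dist (f x') (f x) < e"
      proof (cases "x \<in> cball 0 (r + 1) \<and> x' \<in> cball 0 (r + 1)")
        case False
        then have "norm x > r" "norm x' > r" using tri xx by auto
        then show ?thesis using zero \<open>e > 0\<close> by simp
      qed (use d xx in auto)
    qed (use d in auto)
  qed
qed

lemma test_function_support:
  assumes "\<phi> \<in> test_functions U"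
  obtains r where "r > 0" "\<And>x. norm x > r \<Longrightarrow> \<phi> x = 0"
proof -
  have "bounded (closure {x. \<phi> x \<noteq> 0})"
    using assms compact_imp_bounded unfolding test_functions_def by auto
  then obtain r where r: "r > 0" "\<And>x. x \<in> closure {x. \<phi> x \<noteq> 0} \<Longrightarrow> norm x \<le> r"
    by (meson bounded_pos)
  show thesis
  proof (rule that[OF r(1)])
    fix x :: "real^'a" assume "norm x > r"
    then have "x \<notin> closure {x. \<phi> x \<noteq> 0}" using r(2)[of x] by linarith
    then show "\<phi> x = 0" using closure_subset[of "{x. \<phi> x \<noteq> 0}"] by blast
  qed
qed

lemma test_function_smooth: "\<phi> \<in> test_functions U \<Longrightarrow> smooth \<phi>"
  by (simp add: test_functions_def)

lemma partial_outside_support: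
  assumes "x \<notin> closure {x. \<phi> x \<noteq> 0}" shows "partial i \<phi> x = 0"
  by (rule partial_zero_open[of "- closure {x. \<phi> x \<noteq> 0}"])
    (use assms closure_subset[of "{x. \<phi> x \<noteq> 0}"] in auto)

lemma test_function_partial:
  assumes "\<phi> \<in> test_functions U" shows "partial i \<phi> \<in> test_functions U"
proof -
  have "{x. partial i \<phi> x \<noteq> 0} \<subseteq> closure {x. \<phi> x \<noteq> 0}"
    using partial_outside_support by blast
  then have "closure {x. partial i \<phi> x \<noteq> 0} \<subseteq> closure {x. \<phi> x \<noteq> 0}"
    by (simp add: closure_minimal)
  moreover from this have "compact (closure {x. partial i \<phi> x \<noteq> 0})"
    using assms unfolding test_functions_def
    by (metis (no_types, lifting) closed_Int_compact closed_closure inf.absorb_iff1 mem_Collect_eq)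
  ultimately show ?thesis
    using assms smooth_partial unfolding test_functions_def by blast
qed

lemma test_function_mono: "\<phi> \<in> test_functions U \<Longrightarrow> U \<subseteq> W \<Longrightarrow> \<phi> \<in> test_functions W"
  by (auto simp: test_functions_def)

lemma test_function_bounded:
  assumes "\<phi> \<in> test_functions U"
  obtains C where "C > 0" "\<And>x. \<bar>\<phi> x\<bar> \<le> C"
proof -
  obtain r where r: "r > 0" "\<And>x. norm x > r \<Longrightarrow> \<phi> x = 0"
    using test_function_support[OF assms] by blast
  have "compact (\<phi> ` cball 0 r)"
    using smooth_continuous[OF test_function_smooth[OF assms]]
    by (intro compact_continuous_image) (auto intro: continuous_on_subset)
  then obtain C where C: "C > 0" "\<And>x. x \<in> cball 0 r \<Longrightarrow> norm (\<phi> x) \<le> C"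
    using compact_imp_bounded bounded_pos by (metis imageI)
  show thesis
  proof (rule that[OF C(1)])
    show "\<bar>\<phi> x\<bar> \<le> C" for x
      using C r(2)[of x] by (cases "norm x > r") auto
  qed
qed

lemma smooth_measurable: "smooth f \<Longrightarrow> f \<in> borel_measurable borel"
  by (simp add: borel_measurable_continuous_onI smooth_continuous)

lemma test_function_measurable: "\<phi> \<in> test_functions U \<Longrightarrow> \<phi> \<in> borel_measurable borel"
  by (simp add: smooth_measurable test_function_smooth)

lemma gradient_measurable: "smooth f \<Longrightarrow> gradient f \<in> borel_measurable borel"
  by (simp add: borel_measurable_continuous_onI continuous_gradient)

lemma test_function_integrable:
  assumes "\<phi> \<in> test_functions U"
  shows "integrable lborel \<phi>"
proof -
  obtain r where r: "r > 0" "\<And>x. norm x > r \<Longrightarrow> \<phi> x = 0"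
    using test_function_support[OF assms] by blast
  have "integrable lborel (\<lambda>x. indicator (cball 0 r) x *\<^sub>R \<phi> x)"
    using smooth_continuous[OF test_function_smooth[OF assms]]
    by (intro borel_integrable_compact) (auto intro: continuous_on_subset)
  also have "(\<lambda>x. indicator (cball 0 r) x *\<^sub>R \<phi> x) = \<phi>"
    using r(2) by (auto simp: fun_eq_iff indicator_def not_le)
  finally show ?thesis .
qed

section \<open>Convolution of an integrable function with a test function\<close>

definition conv :: "(real^'n \<Rightarrow> real) \<Rightarrow> (real^'n \<Rightarrow> 'b::euclidean_space) \<Rightarrow> real^'n \<Rightarrow> 'b" where
  "conv \<eta> U x = (\<integral>y. \<eta> (x - y) *\<^sub>R U y \<partial>lborel)"

lemma integrable_bounded_mult:
  fixes U :: "real^'n \<Rightarrow> 'b::euclidean_space"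
  assumes "integrable M U" "f \<in> borel_measurable M" "\<And>x. \<bar>f x\<bar> \<le> C"
  shows "integrable M (\<lambda>x. f x *\<^sub>R U x)"
proof (rule Bochner_Integration.integrable_bound)
  show "integrable M (\<lambda>x. C *\<^sub>R U x)" using assms by simp
  have "\<bar>f x\<bar> \<le> \<bar>C\<bar>" for x using assms(3)[of x] by linarith
  then show "AE x in M. norm (f x *\<^sub>R U x) \<le> norm (C *\<^sub>R U x)"
    unfolding norm_scaleR by (intro AE_I2 mult_right_mono) auto
qed (use assms in measurable)

lemma integrable_conv:
  fixes U :: "real^'n \<Rightarrow> 'b::euclidean_space"
  assumes "\<eta> \<in> test_functions S" "integrable lborel U"
  shows "integrable lborel (\<lambda>y. \<eta> (x - y) *\<^sub>R U y)"
proof -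
  obtain C where "\<And>x. \<bar>\<eta> x\<bar> \<le> C" using test_function_bounded[OF assms(1)] by blast
  moreover have [measurable]: "\<eta> \<in> borel_measurable borel"
    using assms(1) smooth_measurable test_function_smooth by blast
  ultimately show ?thesis by (intro integrable_bounded_mult[OF assms(2)]) auto
qed

text \<open>Differentiation under the integral sign for a merely integrable \<open>U\<close>. The
  gradient of \<open>\<eta>\<close> is uniformly continuous, so the remainder of its first-order
  expansion is at most e' |k| uniformly in the base point and can be integrated against |U|.\<close>

lemma conv_has_derivative:
  fixes U :: "real^'n \<Rightarrow> real"
  assumes \<eta>: "\<eta> \<in> test_functions S" and U: "integrable lborel U"
  shows "(conv \<eta> U has_derivative (\<lambda>h. \<Sum>i\<in>UNIV. h $ i * conv (partial i \<eta>) U x)) (at x)"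
  unfolding has_derivative_at_alt
proof (intro conjI allI impI)
  show "bounded_linear (\<lambda>h::real^'n. \<Sum>i\<in>UNIV. h $ i * conv (partial i \<eta>) U x)"
    by (intro bounded_linear_sum bounded_linear_mult_const bounded_linear_vec_nth)
  fix e :: real assume "e > 0"
  \<comment> \<open>The summand 1 keeps \<open>C\<close> positive when \<open>U\<close> vanishes
    almost everywhere; \<open>e\<close> is divided by it.\<close>
  define C where "C = (\<integral>y. \<bar>U y\<bar> \<partial>lborel) + 1"
  have C: "C > 0" unfolding C_def by (intro add_nonneg_pos Bochner_Integration.integral_nonneg) auto
  define e' where "e' = e / C"
  have "e' > 0" using C \<open>e > 0\<close> by (simp add: e'_def)
  obtain r where r: "r > 0" "\<And>x. norm x > r \<Longrightarrow> \<eta> x = 0"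
    using test_function_support[OF \<eta>] by blast
  have sm: "smooth \<eta>" by (rule test_function_smooth[OF \<eta>])
  have "gradient \<eta> x = 0" if "norm x > r" for x
  proof -
    have "partial i \<eta> x = 0" for i
    proof (rule partial_zero_open[of "- cball 0 r"])
      show "\<eta> y = 0" if "y \<in> - cball 0 r" for y using r(2)[of y] that by simp
    qed (use that in auto)
    then show ?thesis by (simp add: gradient_def vec_eq_iff)
  qed
  then have "uniformly_continuous_on UNIV (gradient \<eta>)"
    using uniformly_continuous_compact_support[OF continuous_gradient[OF sm]] by blast
  then obtain d where d0: "d > 0" "\<And>y z. y \<in> UNIV \<Longrightarrow> z \<in> UNIV \<Longrightarrow> dist z y < d \<Longrightarrow> dist (gradient \<eta> z) (gradient \<eta> y) < e'"
    using uniformly_continuous_onE[OF _ \<open>e' > 0\<close>] by metis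
  have d: "d > 0" "\<And>y z. norm (z - y) < d \<Longrightarrow> norm (gradient \<eta> z - gradient \<eta> y) < e'"
    using d0(1) d0(2)[OF UNIV_I UNIV_I, unfolded dist_norm] by auto
  have main: "\<bar>\<eta> (z + k) - \<eta> z - gradient \<eta> z \<bullet> k\<bar> \<le> norm k * e'" if k: "norm k < d" for z k
  proof -
    have "norm (\<eta> (z + k) - \<eta> z - (\<lambda>x h. gradient \<eta> x \<bullet> h) z ((z + k) - z)) \<le> norm ((z + k) - z) * e'"
    proof (rule differentiable_bound_linearization[where S = "cball z (norm k)" and f = \<eta> and
          f' = "\<lambda>x h. gradient \<eta> x \<bullet> h" and ?x0.0 = z and a = z and b = "z + k" and B = e'])
      show "z + t *\<^sub>R (z + k - z) \<in> cball z (norm k)" if "t \<in> {0..1}" for t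
        using that by (auto simp: dist_norm mult_left_le_one_le)
      show "(\<eta> has_derivative (\<lambda>h. gradient \<eta> x \<bullet> h)) (at x within cball z (norm k))" for x
        using smooth_has_derivative[OF sm] has_derivative_at_withinI by blast
      show "onorm ((\<lambda>h. gradient \<eta> x \<bullet> h) - (\<lambda>h. gradient \<eta> z \<bullet> h)) \<le> e'" if "x \<in> cball z (norm k)" for x
      proof (rule onorm_le)
        fix h
        have "norm (gradient \<eta> x - gradient \<eta> z) \<le> e'"
          using d(2)[of x z] that k by (auto simp: dist_norm norm_minus_commute)
        then show "norm (((\<lambda>h. gradient \<eta> x \<bullet> h) - (\<lambda>h. gradient \<eta> z \<bullet> h)) h) \<le> e' * norm h"
          using Cauchy_Schwarz_ineq2[of "gradient \<eta> x - gradient \<eta> z" h]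
            mult_right_mono[of "norm (gradient \<eta> x - gradient \<eta> z)" e' "norm h"]
          by (auto simp: inner_diff_left)
      qed
    qed auto
    then show ?thesis by simp
  qed
  have [measurable]: "\<eta> \<in> borel_measurable borel" "gradient \<eta> \<in> borel_measurable borel"
    using sm smooth_measurable gradient_measurable by auto
  show "\<exists>d>0. \<forall>y. norm (y - x) < d \<longrightarrow>
      norm (conv \<eta> U y - conv \<eta> U x - (\<Sum>i\<in>UNIV. (y - x) $ i * conv (partial i \<eta>) U x)) \<le> e * norm (y - x)"
  proof (intro exI[of _ d] conjI allI impI)
    fix y assume y: "norm (y - x) < d"
    define k where "k = y - x"
    have int1: "integrable lborel (\<lambda>w. k $ i *\<^sub>R (partial i \<eta> (x - w) *\<^sub>R U w))" for i
      by (intro integrable_scaleR_right integrable_conv[OF test_function_partial[OF \<eta>] U])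
    have "(\<Sum>i\<in>UNIV. k $ i * conv (partial i \<eta>) U x) =
        (\<integral>w. (\<Sum>i\<in>UNIV. k $ i *\<^sub>R (partial i \<eta> (x - w) *\<^sub>R U w)) \<partial>lborel)"
      using int1 unfolding conv_def by (subst Bochner_Integration.integral_sum) auto
    also have "(\<lambda>w. (\<Sum>i\<in>UNIV. k $ i *\<^sub>R (partial i \<eta> (x - w) *\<^sub>R U w))) = (\<lambda>w. (gradient \<eta> (x - w) \<bullet> k) * U w)"
      by (simp add: fun_eq_iff gradient_def inner_vec_def sum_distrib_left mult_ac)
    finally have eq: "(\<Sum>i\<in>UNIV. k $ i * conv (partial i \<eta>) U x) = (\<integral>w. (gradient \<eta> (x - w) \<bullet> k) * U w \<partial>lborel)" .
    have int2: "integrable lborel (\<lambda>w. (gradient \<eta> (x - w) \<bullet> k) * U w)"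
    proof -
      have "integrable lborel (\<lambda>w. (\<Sum>i\<in>UNIV. k $ i *\<^sub>R (partial i \<eta> (x - w) *\<^sub>R U w)))"
        using int1 by (intro Bochner_Integration.integrable_sum) auto
      then show ?thesis
        by (simp add: gradient_def inner_vec_def sum_distrib_left mult_ac)
    qed
    have int3: "integrable lborel (\<lambda>w. \<eta> (y - w) * U w)" "integrable lborel (\<lambda>w. \<eta> (x - w) * U w)"
      using integrable_conv[OF \<eta> U] by simp_all
    have "conv \<eta> U y - conv \<eta> U x - (\<Sum>i\<in>UNIV. k $ i * conv (partial i \<eta>) U x) =
        (\<integral>w. \<eta> (y - w) * U w - \<eta> (x - w) * U w - (gradient \<eta> (x - w) \<bullet> k) * U w \<partial>lborel)"
      unfolding eq unfolding conv_def using int2 int3 by simp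
    also have "norm \<dots> \<le> (\<integral>w. (norm k * e') * \<bar>U w\<bar> \<partial>lborel)"
    proof (rule Bochner_Integration.integral_norm_bound_integral)
      show "integrable lborel (\<lambda>w. \<eta> (y - w) * U w - \<eta> (x - w) * U w - (gradient \<eta> (x - w) \<bullet> k) * U w)"
        using int2 int3 by auto
      show "integrable lborel (\<lambda>w. (norm k * e') * \<bar>U w\<bar>)" using U by auto
      fix w
      have "norm (\<eta> (y - w) * U w - \<eta> (x - w) * U w - (gradient \<eta> (x - w) \<bullet> k) * U w) =
         \<bar>\<eta> ((x - w) + k) - \<eta> (x - w) - gradient \<eta> (x - w) \<bullet> k\<bar> * \<bar>U w\<bar>"
        by (simp add: k_def algebra_simps flip: abs_mult)
      also have "\<dots> \<le> (norm k * e') * \<bar>U w\<bar>"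
        using main[of k "x - w"] y by (intro mult_right_mono) (auto simp: k_def)
      finally show "norm (\<eta> (y - w) * U w - \<eta> (x - w) * U w - (gradient \<eta> (x - w) \<bullet> k) * U w) \<le> (norm k * e') * \<bar>U w\<bar>" .
    qed
    also have "\<dots> \<le> (norm k * e') * C"
      using \<open>e' > 0\<close> by (auto simp: C_def intro!: mult_left_mono)
    also have "\<dots> = e * norm (y - x)" using C by (simp add: e'_def k_def)
    finally show "norm (conv \<eta> U y - conv \<eta> U x - (\<Sum>i\<in>UNIV. (y - x) $ i * conv (partial i \<eta>) U x)) \<le> e * norm (y - x)"
      unfolding k_def .
  qed (use d in auto)
qed

lemma partial_conv:
  fixes U :: "real^'n \<Rightarrow> real"
  assumes "\<eta> \<in> test_functions S" "integrable lborel U"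
  shows "partial i (conv \<eta> U) = conv (partial i \<eta>) U"
proof
  fix x
  have "partial i (conv \<eta> U) x = (\<Sum>j\<in>UNIV. axis i 1 $ j * conv (partial j \<eta>) U x)"
    by (rule partial_eqI[OF conv_has_derivative[OF assms]])
  also have "\<dots> = (\<Sum>j\<in>UNIV. if j = i then conv (partial i \<eta>) U x else 0)"
    by (intro sum.cong) (auto simp: axis_def)
  finally show "partial i (conv \<eta> U) x = conv (partial i \<eta>) U x" by simp
qed

lemma smooth_conv:
  fixes U :: "real^'n \<Rightarrow> real"
  assumes "\<eta> \<in> test_functions S" "integrable lborel U"
  shows "smooth (conv \<eta> U)"
proof -
  have d: "conv \<eta> U differentiable (at x)" if "\<eta> \<in> test_functions S" for \<eta> x
    using conv_has_derivative[OF that assms(2)] differentiable_def by blast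
  have "C_k k (conv \<eta> U)" if "\<eta> \<in> test_functions S" for k
    using that
  proof (induction k arbitrary: \<eta>)
    case 0
    then show ?case using d by (auto intro!: continuous_at_imp_continuous_on differentiable_imp_continuous_within)
  next
    case (Suc k)
    then show ?case using d[OF Suc.prems] partial_conv[OF Suc.prems assms(2)]
        Suc.IH[OF test_function_partial[OF Suc.prems]] by simp
  qed
  then show ?thesis using assms(1) by (simp add: smooth_def)
qed

section \<open>Affine changes of variables and continuity of translations in L1\<close>

lemma nn_integral_affine:
  fixes f :: "'a::euclidean_space \<Rightarrow> ennreal"
  assumes "c \<noteq> 0" and [measurable]: "f \<in> borel_measurable borel"
  shows "(\<integral>\<^sup>+x. f x \<partial>lborel) = ennreal (\<bar>c\<bar> ^ DIM('a)) * (\<integral>\<^sup>+x. f (t + c *\<^sub>R x) \<partial>lborel)"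
  by (subst lborel_affine[OF assms(1), of t])
    (simp add: nn_integral_density nn_integral_distr nn_integral_cmult)

lemma nn_integral_reflect:
  fixes f :: "'a::euclidean_space \<Rightarrow> ennreal"
  assumes [measurable]: "f \<in> borel_measurable borel"
  shows "(\<integral>\<^sup>+y. f (x - y) \<partial>lborel) = (\<integral>\<^sup>+y. f y \<partial>lborel)"
  using nn_integral_affine[of "-1" f x] by simp

lemma nn_integral_shift:
  fixes f :: "'a::euclidean_space \<Rightarrow> ennreal"
  assumes [measurable]: "f \<in> borel_measurable borel"
  shows "(\<integral>\<^sup>+y. f (y - x) \<partial>lborel) = (\<integral>\<^sup>+y. f y \<partial>lborel)"
  using nn_integral_affine[of 1 f "-x"] by (simp add: algebra_simps)

text \<open>Inner regularity of Lebesgue sets yields a closed set \<open>T\<close>. Since the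
  measure is finite, the part of \<open>T\<close> outside a large ball is small, and cutting it off
  makes the set compact.\<close>

lemma finite_measure_compact_open:
  fixes A :: "'a::euclidean_space set"
  assumes A: "A \<in> sets borel" "emeasure lborel A < \<infinity>" and "e > 0"
  obtains K W where "compact K" "open W" "K \<subseteq> A" "A \<subseteq> W" "emeasure lborel (W - K) \<le> ennreal e"
proof -
  have Al: "A \<in> sets lebesgue" using A(1) by auto
  have e3: "e / 3 > 0" using \<open>e > 0\<close> by simp
  obtain W where W: "open W" "A \<subseteq> W" "emeasure lebesgue (W - A) < ennreal (e / 3)"
    using sets_lebesgue_outer_open[OF Al e3] by metis
  obtain T where T: "closed T" "T \<subseteq> A" "emeasure lebesgue (A - T) < ennreal (e / 3)"
    using sets_lebesgue_inner_closed[OF Al e3] by metis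
  define D where "D k = T - cball 0 (real k)" for k
  have TD: "T \<in> sets borel" "\<And>k. D k \<in> sets lborel" using T(1) by (auto simp: D_def)
  have "(\<lambda>k. emeasure lborel (D k)) \<longlonglongrightarrow> emeasure lborel (\<Inter>k. D k)"
  proof (rule Lim_emeasure_decseq)
    show "decseq D" by (auto simp: D_def decseq_def)
    show "emeasure lborel (D k) \<noteq> \<infinity>" for k
    proof -
      have "emeasure lborel (D k) \<le> emeasure lborel A"
        using T(2) A(1) by (intro emeasure_mono) (auto simp: D_def)
      then show ?thesis using A(2) by (simp add: top.not_eq_extremum order_le_less_trans)
    qed
  qed (use TD in auto)
  moreover have "(\<Inter>k. D k) = {}"
    by (auto simp: D_def) (metis real_arch_simple)
  ultimately have "(\<lambda>k. emeasure lborel (D k)) \<longlonglongrightarrow> 0" by simp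
  then have "eventually (\<lambda>k. emeasure lborel (D k) < ennreal (e / 3)) sequentially"
    by (rule order_tendstoD(2)) (use e3 in simp)
  then obtain k where k: "emeasure lborel (D k) < ennreal (e / 3)"
    using eventually_happens trivial_limit_sequentially by blast
  define K where "K = T \<inter> cball 0 (real k)"
  show thesis
  proof
    show "compact K" unfolding K_def using T(1) by (simp add: closed_Int_compact)
    show "K \<subseteq> A" "open W" "A \<subseteq> W" using T W by (auto simp: K_def)
    have "W - K = (W - A) \<union> ((A - T) \<union> D k)" using W T by (auto simp: K_def D_def)
    then have "emeasure lborel (W - K) \<le> emeasure lborel (W - A) + emeasure lborel ((A - T) \<union> D k)"
      using emeasure_subadditive[of "W - A" lborel "(A - T) \<union> D k"] W(1) A(1) TD by auto
    also have "\<dots> \<le> emeasure lborel (W - A) + (emeasure lborel (A - T) + emeasure lborel (D k))"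
      using emeasure_subadditive[of "A - T" lborel "D k"] A(1) TD by (intro add_left_mono) auto
    also have "\<dots> \<le> ennreal (e / 3) + (ennreal (e / 3) + ennreal (e / 3))"
      using W(1,3) T(1,3) A(1) k by (intro add_mono) (auto simp: emeasure_completion less_imp_le)
    also have "\<dots> = ennreal e" using \<open>e > 0\<close> by (simp flip: ennreal_plus)
    finally show "emeasure lborel (W - K) \<le> ennreal e" .
  qed
qed

text \<open>Induction over integrable functions. For an indicator, \<open>A\<close> is squeezed
  between a compact \<open>K\<close> and an open \<open>W\<close>. If \<open>h\<close> is shorter
  than the distance from \<open>K\<close> to the complement of \<open>W\<close>, then
  \<open>A\<close> separates x from x - h only if one of the two points lies in W - K.\<close>

lemma L1_translation:
  fixes f :: "'a::euclidean_space \<Rightarrow> 'b::{banach, second_countable_topology}"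
  assumes "integrable lborel f"
  shows "\<forall>e>0. \<exists>d>0. \<forall>h. norm h < d \<longrightarrow> (\<integral>\<^sup>+x. norm (f (x - h) - f x) \<partial>lborel) \<le> ennreal e"
proof -
  let ?I = "\<lambda>(f :: 'a \<Rightarrow> 'b) h. \<integral>\<^sup>+x. norm (f (x - h) - f x) \<partial>lborel"
  show ?thesis using assms
  proof (induction rule: integrable_induct)
    case (base A c)
    show ?case
    proof (intro allI impI)
      fix e :: real assume "e > 0"
      define e' where "e' = e / (2 * (norm c + 1))"
      have nc: "norm c + 1 > 0" by (simp add: add_nonneg_pos)
      then have "e' > 0" using \<open>e > 0\<close> by (simp add: e'_def)
      obtain K W where KW: "compact K" "open W" "K \<subseteq> A" "A \<subseteq> W" "emeasure lborel (W - K) \<le> ennreal e'"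
        using finite_measure_compact_open[of A e'] base \<open>e' > 0\<close> by auto
      have [measurable]: "W - K \<in> sets borel" "A \<in> sets borel"
        using KW base by (auto simp: compact_imp_closed)
      obtain d where d: "d > 0" "(\<Union>x\<in>K. ball x d) \<subseteq> W"
        using compact_subset_open_imp_ball_epsilon_subset[of K W] KW by auto
      show "\<exists>d>0. \<forall>h. norm h < d \<longrightarrow> ?I (\<lambda>x. indicator A x *\<^sub>R c) h \<le> ennreal e"
      proof (intro exI[of _ d] conjI allI impI)
        fix h :: 'a assume h: "norm h < d"
        have pt: "ennreal (norm (indicator A (x - h) *\<^sub>R c - indicator A x *\<^sub>R c)) \<le>
            ennreal (norm c) * (indicator (W - K) x + indicator (W - K) (x - h))" for x
        proof -
          have 1: "x - h \<in> W" if "x \<in> K"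
          proof -
            have "x - h \<in> ball x d" using h by (simp add: dist_norm)
            with d(2) that show ?thesis by blast
          qed
          have 2: "x \<in> W" if "x - h \<in> K"
          proof -
            have "x \<in> ball (x - h) d" using h by (simp add: dist_norm)
            with d(2) that show ?thesis by blast
          qed
          show ?thesis
          proof (cases "(x \<in> A) = (x - h \<in> A)")
            case True
            then show ?thesis by (simp add: indicator_def)
          next
            case False
            then have "x \<in> W - K \<or> x - h \<in> W - K" using 1 2 KW(3,4) by blast
            then have "(1::ennreal) \<le> indicator (W - K) x + indicator (W - K) (x - h)"
              by (auto simp: indicator_def)
            from mult_left_mono[OF this, of "ennreal (norm c)"] False
            show ?thesis by (auto simp: indicator_def)
          qed
        qed
        have "?I (\<lambda>x. indicator A x *\<^sub>R c) h \<le>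
          (\<integral>\<^sup>+x. ennreal (norm c) * (indicator (W - K) x + indicator (W - K) (x - h)) \<partial>lborel)"
          using pt by (intro nn_integral_mono) auto
        also have "\<dots> = ennreal (norm c) * ((\<integral>\<^sup>+x. indicator (W - K) x \<partial>lborel) + (\<integral>\<^sup>+x. indicator (W - K) (x - h) \<partial>lborel))"
          by (simp add: nn_integral_cmult nn_integral_add)
        also have "\<dots> = ennreal (norm c) * (emeasure lborel (W - K) + emeasure lborel (W - K))"
          by (subst nn_integral_shift) auto
        also have "\<dots> \<le> ennreal (norm c) * (ennreal e' + ennreal e')"
          using KW by (intro mult_left_mono add_mono) auto
        also have "\<dots> = ennreal (norm c * (2 * e'))"
          using \<open>e' > 0\<close> by (simp add: ennreal_mult flip: ennreal_plus)
        also have "\<dots> \<le> ennreal e"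
        proof (rule ennreal_leI)
          have "norm c * (2 * e') = e * (norm c / (norm c + 1))"
            using nc by (simp add: e'_def field_simps)
          also have "\<dots> \<le> e" using nc \<open>e > 0\<close> by (intro mult_left_le) auto
          finally show "norm c * (2 * e') \<le> e" .
        qed
        finally show "?I (\<lambda>x. indicator A x *\<^sub>R c) h \<le> ennreal e" .
      qed (use d in auto)
    qed
  next
    case (add f g)
    show ?case
    proof (intro allI impI)
      fix e :: real assume "e > 0"
      then have e2: "e / 2 > 0" by simp
      obtain d1 where d1: "d1 > 0" "\<And>h. norm h < d1 \<Longrightarrow> ?I f h \<le> ennreal (e / 2)"
        using add.IH(1) e2 by meson
      obtain d2 where d2: "d2 > 0" "\<And>h. norm h < d2 \<Longrightarrow> ?I g h \<le> ennreal (e / 2)"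
        using add.IH(2) e2 by meson
      have [measurable]: "f \<in> borel_measurable borel" "g \<in> borel_measurable borel"
        using add.hyps by (auto dest: borel_measurable_integrable)
      show "\<exists>d>0. \<forall>h. norm h < d \<longrightarrow> ?I (\<lambda>x. f x + g x) h \<le> ennreal e"
      proof (intro exI[of _ "min d1 d2"] conjI allI impI)
        fix h :: 'a assume h: "norm h < min d1 d2"
        have "?I (\<lambda>x. f x + g x) h \<le>
          (\<integral>\<^sup>+x. ennreal (norm (f (x - h) - f x)) + ennreal (norm (g (x - h) - g x)) \<partial>lborel)"
          by (intro nn_integral_mono) (simp add: norm_diff_triangle_ineq flip: ennreal_plus)
        also have "\<dots> = ?I f h + ?I g h"
          by (intro nn_integral_add) auto
        also have "\<dots> \<le> ennreal (e / 2) + ennreal (e / 2)"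
          using d1 d2 h by (intro add_mono) auto
        also have "\<dots> = ennreal e" using \<open>e > 0\<close> by (simp flip: ennreal_plus)
        finally show "?I (\<lambda>x. f x + g x) h \<le> ennreal e" .
      qed (use d1 d2 in auto)
    qed
  next
    case (lim f s)
    have [measurable]: "f \<in> borel_measurable borel" "\<And>i. s i \<in> borel_measurable borel"
      using lim.hyps(1,4) by (auto dest: borel_measurable_integrable)
    have "(\<lambda>i. \<integral>x. norm (s i x - f x) \<partial>lborel) \<longlonglongrightarrow> (\<integral>x. 0 \<partial>(lborel::'a measure))"
    proof (rule integral_dominated_convergence[where w = "\<lambda>x. 3 * norm (f x)"])
      show "AE x in lborel. (\<lambda>i. norm (s i x - f x)) \<longlonglongrightarrow> 0"
        using lim.hyps(2) by (intro AE_I2) (simp add: LIM_zero tendsto_norm_zero)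
      show "AE x in lborel. norm (norm (s i x - f x)) \<le> 3 * norm (f x)" for i
      proof (intro AE_I2)
        fix x
        have "norm (s i x - f x) \<le> norm (s i x) + norm (f x)" by (rule norm_triangle_ineq4)
        with lim.hyps(3)[of x i] show "norm (norm (s i x - f x)) \<le> 3 * norm (f x)" by simp
      qed
    qed (use lim.hyps(4) in auto)
    then have L: "(\<lambda>i. \<integral>x. norm (s i x - f x) \<partial>lborel) \<longlonglongrightarrow> 0" by simp
    show ?case
    proof (intro allI impI)
      fix e :: real assume "e > 0"
      then have e3: "e / 3 > 0" by simp
      have "eventually (\<lambda>i. (\<integral>x. norm (s i x - f x) \<partial>lborel) < e / 3) sequentially"
        using L e3 by (rule order_tendstoD(2))
      then obtain i where i: "(\<integral>x. norm (s i x - f x) \<partial>lborel) < e / 3"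
        using eventually_happens trivial_limit_sequentially by blast
      have i': "(\<integral>\<^sup>+x. norm (s i x - f x) \<partial>lborel) \<le> ennreal (e / 3)"
        using i lim.hyps(1,4) by (subst nn_integral_eq_integral) (auto intro!: ennreal_leI)
      obtain d where d: "d > 0" "\<And>h. norm h < d \<Longrightarrow> ?I (s i) h \<le> ennreal (e / 3)"
        using lim.IH[of i] e3 by meson
      show "\<exists>d>0. \<forall>h. norm h < d \<longrightarrow> ?I f h \<le> ennreal e"
      proof (intro exI[of _ d] conjI allI impI)
        fix h :: 'a assume h: "norm h < d"
        have "norm (f (x - h) - f x) \<le> norm (s i (x - h) - f (x - h)) + (norm (s i (x - h) - s i x) + norm (s i x - f x))" for x
        proof -
          have "f (x - h) - f x = - (s i (x - h) - f (x - h)) + ((s i (x - h) - s i x) + (s i x - f x))" by simp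
          also have "norm \<dots> \<le> norm (- (s i (x - h) - f (x - h))) + norm ((s i (x - h) - s i x) + (s i x - f x))"
            by (rule norm_triangle_ineq)
          also have "\<dots> \<le> norm (s i (x - h) - f (x - h)) + (norm (s i (x - h) - s i x) + norm (s i x - f x))"
            unfolding norm_minus_cancel by (intro add_left_mono norm_triangle_ineq)
          finally show ?thesis .
        qed
        then have "?I f h \<le>
          (\<integral>\<^sup>+x. ennreal (norm (s i (x - h) - f (x - h))) + (ennreal (norm (s i (x - h) - s i x)) + ennreal (norm (s i x - f x))) \<partial>lborel)"
          by (intro nn_integral_mono) (simp flip: ennreal_plus)
        also have "\<dots> = (\<integral>\<^sup>+x. norm (s i (x - h) - f (x - h)) \<partial>lborel) + (?I (s i) h + (\<integral>\<^sup>+x. norm (s i x - f x) \<partial>lborel))"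
          by (simp add: nn_integral_add)
        also have "(\<integral>\<^sup>+x. norm (s i (x - h) - f (x - h)) \<partial>lborel) = (\<integral>\<^sup>+x. norm (s i x - f x) \<partial>lborel)"
          using nn_integral_shift[of "\<lambda>x. ennreal (norm (s i x - f x))" h] by simp
        also have "(\<integral>\<^sup>+x. norm (s i x - f x) \<partial>lborel) + (?I (s i) h + (\<integral>\<^sup>+x. norm (s i x - f x) \<partial>lborel))
           \<le> ennreal (e / 3) + (ennreal (e / 3) + ennreal (e / 3))"
          using d h i' by (intro add_mono) auto
        also have "\<dots> = ennreal e" using \<open>e > 0\<close> by (simp flip: ennreal_plus)
        finally show "?I f h \<le> ennreal e" .
      qed (use d in auto)
    qed
  qed
qed

section \<open>Mollifiers and their effect on L1 errors, gradients and thresholds\<close>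

definition mollifier :: "real \<Rightarrow> (real^'n \<Rightarrow> real) \<Rightarrow> bool" where
  "mollifier \<epsilon> \<eta> \<longleftrightarrow> \<eta> \<in> test_functions UNIV \<and> (\<forall>x. 0 \<le> \<eta> x) \<and> (\<forall>x. norm x \<ge> \<epsilon> \<longrightarrow> \<eta> x = 0) \<and>
     (\<integral>x. \<eta> x \<partial>lborel) = 1"

lemma ex_mollifier:
  assumes "\<epsilon> > 0"
  obtains \<eta> :: "real^'n::finite \<Rightarrow> real" where "mollifier \<epsilon> \<eta>"
proof -
  \<comment> \<open>The squared norm is written as a sum of products of coordinates so that the
    closure rules for \<open>smooth\<close> apply.\<close>
  define \<phi> :: "real^'n \<Rightarrow> real" where "\<phi> = (\<lambda>x. flat 1 0 (\<epsilon>\<^sup>2 - (\<Sum>i\<in>UNIV. x $ i * x $ i)))"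
  have norm2: "(\<Sum>i\<in>UNIV. x $ i * x $ i) = (norm x)\<^sup>2" for x :: "real^'n"
    by (simp add: power2_norm_eq_inner inner_vec_def)
  have sm: "smooth \<phi>" unfolding \<phi>_def
    by (intro smooth_flat smooth_diff smooth_const smooth_sum smooth_mult smooth_nth) auto
  have z: "\<phi> x = 0" if "norm x \<ge> \<epsilon>" for x
    using that assms by (simp add: \<phi>_def norm2 flat_def power_mono)
  have p: "\<phi> x > 0" if "norm x < \<epsilon>" for x
    using that assms by (simp add: \<phi>_def norm2 flat_def power_strict_mono not_le)
  have nn: "\<phi> x \<ge> 0" for x using z[of x] p[of x] by linarith
  have sub: "closure {x. \<phi> x \<noteq> 0} \<subseteq> cball 0 \<epsilon>"
    using z by (intro closure_minimal) (auto simp: not_le[symmetric] intro: ccontr)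
  have test: "(\<lambda>x. c * \<phi> x) \<in> test_functions UNIV" for c
  proof -
    have "closure {x. c * \<phi> x \<noteq> 0} \<subseteq> cball 0 \<epsilon>"
      by (rule order_trans[OF closure_mono sub]) auto
    then have "compact (closure {x. c * \<phi> x \<noteq> 0})"
      by (metis closed_Int_compact closed_closure compact_cball inf.absorb_iff1)
    then show ?thesis using smooth_mult[OF smooth_const sm] by (simp add: test_functions_def)
  qed
  have int: "integrable lborel \<phi>" using test_function_integrable[OF test[of 1]] by simp
  have "(\<integral>x. \<phi> x \<partial>lborel) \<noteq> 0"
  proof
    assume "(\<integral>x. \<phi> x \<partial>lborel) = 0"
    then have "AE x in lborel. \<phi> x = 0"
      using integral_nonneg_eq_0_iff_AE[OF int] nn by simp
    then have "AE x in lborel. (x::real^'n) \<notin> ball 0 \<epsilon>"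
      by (rule eventually_mono) (use p in \<open>auto simp: less_le\<close>)
    then have "emeasure lborel (ball (0::real^'n) \<epsilon>) = 0"
      by (subst (asm) AE_iff_measurable[OF _ refl]) (auto simp: ball_def)
    then have "negligible (ball (0::real^'n) \<epsilon>)"
      by (simp add: negligible_iff_emeasure0 emeasure_completion)
    then show False using assms by (simp add: open_not_negligible)
  qed
  moreover have "(\<integral>x. \<phi> x \<partial>lborel) \<ge> 0" using nn by simp
  ultimately have I: "(\<integral>x. \<phi> x \<partial>lborel) > 0" by simp
  show thesis
  proof
    show "mollifier \<epsilon> (\<lambda>x. (1 / (\<integral>x. \<phi> x \<partial>lborel)) * \<phi> x)"
      unfolding mollifier_def using test[of "1 / (\<integral>x. \<phi> x \<partial>lborel)"] I nn z by auto
  qed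
qed

lemma pred_ball [measurable (raw)]:
  fixes f :: "'b \<Rightarrow> 'a::euclidean_space"
  assumes [measurable]: "f \<in> borel_measurable M"
  shows "Measurable.pred M (\<lambda>x. f x \<in> ball a R)"
  unfolding mem_ball by measurable

lemma mollifier_nn_integral:
  assumes "mollifier \<epsilon> \<eta>"
  shows "(\<integral>\<^sup>+y. ennreal (\<eta> y) \<partial>lborel) = 1"
proof -
  have "(\<integral>\<^sup>+y. ennreal (\<eta> y) \<partial>lborel) = ennreal (\<integral>y. \<eta> y \<partial>lborel)"
    using assms by (intro nn_integral_eq_integral test_function_integrable) (auto simp: mollifier_def)
  then show ?thesis using assms by (simp add: mollifier_def)
qed

lemma mollifier_measurable: "mollifier \<epsilon> \<eta> \<Longrightarrow> \<eta> \<in> borel_measurable borel"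
  by (auto simp: mollifier_def intro: smooth_measurable test_function_smooth)

lemma mollifier_nn_integral_reflect:
  assumes "mollifier \<epsilon> \<eta>"
  shows "(\<integral>\<^sup>+y. ennreal (\<eta> (x - y)) \<partial>lborel) = 1"
proof -
  have [measurable]: "\<eta> \<in> borel_measurable borel" by (rule mollifier_measurable[OF assms])
  show ?thesis
    using nn_integral_reflect[of "\<lambda>y. ennreal (\<eta> y)" x] mollifier_nn_integral[OF assms] by simp
qed

lemma mollifier_nn_integral_shift:
  assumes "mollifier \<epsilon> \<eta>"
  shows "(\<integral>\<^sup>+x. ennreal (\<eta> (x - y)) \<partial>lborel) = 1"
proof -
  have [measurable]: "\<eta> \<in> borel_measurable borel" by (rule mollifier_measurable[OF assms])
  show ?thesis
    using nn_integral_shift[of "\<lambda>y. ennreal (\<eta> y)" y] mollifier_nn_integral[OF assms] by simp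
qed

lemma mollifier_integrable_reflect:
  assumes "mollifier \<epsilon> \<eta>"
  shows "integrable lborel (\<lambda>y. \<eta> (x - y))" "(\<integral>y. \<eta> (x - y) \<partial>lborel) = 1"
proof -
  have [measurable]: "\<eta> \<in> borel_measurable borel" by (rule mollifier_measurable[OF assms])
  have nn: "\<eta> y \<ge> 0" for y using assms by (simp add: mollifier_def)
  show "integrable lborel (\<lambda>y. \<eta> (x - y))"
    using mollifier_nn_integral_reflect[OF assms] nn
    by (intro integrableI_nonneg) auto
  show "(\<integral>y. \<eta> (x - y) \<partial>lborel) = 1"
    using mollifier_nn_integral_reflect[OF assms] nn
    by (subst integral_eq_nn_integral) auto
qed

text \<open>As \<open>\<eta>\<close> has integral 1, the error at x is the average of U (x - h) - U
  x with weight \<open>\<eta> h\<close>. After exchanging the integrals only |h| < \<epsilon>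
  contributes.\<close>

lemma conv_L1_error:
  fixes U :: "real^'n \<Rightarrow> 'b::euclidean_space"
  assumes m: "mollifier \<epsilon> \<eta>" and U: "integrable lborel U"
    and e: "\<And>h. norm h < \<epsilon> \<Longrightarrow> (\<integral>\<^sup>+x. norm (U (x - h) - U x) \<partial>lborel) \<le> e"
  shows "(\<integral>\<^sup>+x. norm (conv \<eta> U x - U x) \<partial>lborel) \<le> e"
proof -
  have [measurable]: "\<eta> \<in> borel_measurable borel" "U \<in> borel_measurable borel"
    using mollifier_measurable[OF m] U by (auto dest: borel_measurable_integrable)
  have nn: "\<eta> y \<ge> 0" for y using m by (simp add: mollifier_def)
  have "ennreal (norm (conv \<eta> U x - U x)) \<le> (\<integral>\<^sup>+h. ennreal (\<eta> h) * ennreal (norm (U (x - h) - U x)) \<partial>lborel)" for x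
  proof -
    have i: "integrable lborel (\<lambda>y. \<eta> (x - y) *\<^sub>R U y)"
      using m U by (intro integrable_conv) (auto simp: mollifier_def)
    have i2: "integrable lborel (\<lambda>y. \<eta> (x - y) *\<^sub>R U x)"
      using mollifier_integrable_reflect[OF m] by (intro integrable_scaleR_left) auto
    have "conv \<eta> U x - U x = (\<integral>y. \<eta> (x - y) *\<^sub>R U y - \<eta> (x - y) *\<^sub>R U x \<partial>lborel)"
      using i i2 mollifier_integrable_reflect[OF m] by (simp add: conv_def)
    also have "norm \<dots> \<le> (\<integral>\<^sup>+y. norm (\<eta> (x - y) *\<^sub>R U y - \<eta> (x - y) *\<^sub>R U x) \<partial>lborel)"
      using i i2 by (intro integral_norm_bound_ennreal) auto
    also have "\<dots> = (\<integral>\<^sup>+y. ennreal (\<eta> (x - y)) * ennreal (norm (U y - U x)) \<partial>lborel)"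
      using nn by (intro nn_integral_cong) (simp add: ennreal_mult flip: scaleR_diff_right)
    also have "\<dots> = (\<integral>\<^sup>+h. ennreal (\<eta> h) * ennreal (norm (U (x - h) - U x)) \<partial>lborel)"
      using nn_integral_reflect[of "\<lambda>y. ennreal (\<eta> (x - y)) * ennreal (norm (U y - U x))" x] by simp
    finally show ?thesis by simp
  qed
  then have "(\<integral>\<^sup>+x. norm (conv \<eta> U x - U x) \<partial>lborel) \<le>
      (\<integral>\<^sup>+x. \<integral>\<^sup>+h. ennreal (\<eta> h) * ennreal (norm (U (x - h) - U x)) \<partial>lborel \<partial>lborel)"
    by (intro nn_integral_mono) auto
  also have "\<dots> = (\<integral>\<^sup>+h. \<integral>\<^sup>+x. ennreal (\<eta> h) * ennreal (norm (U (x - h) - U x)) \<partial>lborel \<partial>lborel)"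
    by (rule lborel_pair.Fubini') measurable
  also have "\<dots> = (\<integral>\<^sup>+h. ennreal (\<eta> h) * (\<integral>\<^sup>+x. ennreal (norm (U (x - h) - U x)) \<partial>lborel) \<partial>lborel)"
    by (intro nn_integral_cong nn_integral_cmult) auto
  also have "\<dots> \<le> (\<integral>\<^sup>+h. ennreal (\<eta> h) * e \<partial>lborel)"
  proof (intro nn_integral_mono)
    fix h
    show "ennreal (\<eta> h) * (\<integral>\<^sup>+x. ennreal (norm (U (x - h) - U x)) \<partial>lborel) \<le> ennreal (\<eta> h) * e"
    proof (cases "norm h < \<epsilon>")
      case True then show ?thesis using e by (intro mult_left_mono) auto
    next
      case False then show ?thesis using m by (simp add: mollifier_def)
    qed
  qed
  also have "\<dots> = e"
    using mollifier_nn_integral[OF m] by (simp add: nn_integral_multc)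
  finally show ?thesis .
qed

text \<open>The reflected kernel y \<mapsto> \<eta> (x - y) is an admissible test function as long
  as the closed \<epsilon>-ball about x lies in \<open>D\<close>. The sign produced by the
  reflection cancels the one in the definition of the weak gradient.\<close>

lemma gradient_conv:
  fixes U :: "real^'n \<Rightarrow> real"
  assumes m: "mollifier \<epsilon> \<eta>" and U: "integrable lborel U" and V: "integrable lborel V"
    and weak: "\<And>\<phi> i. \<phi> \<in> test_functions D \<Longrightarrow>
      (\<integral>y. U y * partial i \<phi> y \<partial>lborel) = - (\<integral>y. V y $ i * \<phi> y \<partial>lborel)"
    and D: "cball x \<epsilon> \<subseteq> D"
  shows "gradient (conv \<eta> U) x = conv \<eta> V x"
proof -
  have \<eta>: "\<eta> \<in> test_functions UNIV" using m by (simp add: mollifier_def)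
  have sm: "smooth \<eta>" by (rule test_function_smooth[OF \<eta>])
  define \<phi> where "\<phi> = (\<lambda>y. \<eta> (x - y))"
  have "{y. \<phi> y \<noteq> 0} \<subseteq> cball x \<epsilon>"
    using m by (auto simp: \<phi>_def mollifier_def dist_norm intro: ccontr)
  then have cl: "closure {y. \<phi> y \<noteq> 0} \<subseteq> cball x \<epsilon>" by (simp add: closure_minimal)
  then have "compact (closure {y. \<phi> y \<noteq> 0})"
    by (metis closed_Int_compact closed_closure compact_cball inf.absorb_iff1)
  with cl D have \<phi>: "\<phi> \<in> test_functions D"
    using smooth_reflect[OF sm] by (auto simp: test_functions_def \<phi>_def)
  have p\<phi>: "partial i \<phi> y = - partial i \<eta> (x - y)" for i y
    using partial_reflect[of \<eta> x y i 1] smooth_differentiable[OF sm] by (simp add: \<phi>_def)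
  have "partial i (conv \<eta> U) x = conv \<eta> V x $ i" for i
  proof -
    have "partial i (conv \<eta> U) x = (\<integral>y. partial i \<eta> (x - y) * U y \<partial>lborel)"
      by (simp add: partial_conv[OF \<eta> U] conv_def)
    also have "\<dots> = - (\<integral>y. U y * partial i \<phi> y \<partial>lborel)"
      by (simp add: p\<phi> mult.commute)
    also have "\<dots> = (\<integral>y. V y $ i * \<phi> y \<partial>lborel)"
      by (simp add: weak[OF \<phi>])
    also have "\<dots> = (\<integral>y. (\<eta> (x - y) *\<^sub>R V y) $ i \<partial>lborel)"
      by (simp add: \<phi>_def mult.commute)
    also have "\<dots> = conv \<eta> V x $ i"
      unfolding conv_def by (intro integral_bounded_linear[OF bounded_linear_vec_nth] integrable_conv[OF \<eta> V])
    finally show ?thesis .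
  qed
  then show ?thesis by (simp add: gradient_def vec_eq_iff)
qed

text \<open>Jensen's inequality for the convex function max (r - \<tau>) 0. Since
  \<open>ennreal\<close> sends negative numbers to 0, \<open>ennreal (r - \<tau>)\<close> is the
  positive part; the same encoding is used in \<open>shell\<close> and
  \<open>excess\<close>.\<close>

lemma conv_truncation:
  fixes V :: "real^'n \<Rightarrow> 'b::euclidean_space"
  assumes m: "mollifier \<epsilon> \<eta>" and V: "integrable lborel V" and "\<tau> \<ge> 0"
  shows "ennreal (norm (conv \<eta> V x) - \<tau>) \<le> (\<integral>\<^sup>+y. ennreal (\<eta> (x - y)) * ennreal (norm (V y) - \<tau>) \<partial>lborel)"
proof -
  have [measurable]: "\<eta> \<in> borel_measurable borel" "V \<in> borel_measurable borel"
    using mollifier_measurable[OF m] V by (auto dest: borel_measurable_integrable)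
  have nn: "\<eta> y \<ge> 0" for y using m by (simp add: mollifier_def)
  have i: "integrable lborel (\<lambda>y. \<eta> (x - y) *\<^sub>R V y)"
    using m V by (intro integrable_conv) (auto simp: mollifier_def)
  let ?I = "\<integral>\<^sup>+y. ennreal (\<eta> (x - y)) * ennreal (norm (V y) - \<tau>) \<partial>lborel"
  have "ennreal (norm (conv \<eta> V x)) \<le> (\<integral>\<^sup>+y. norm (\<eta> (x - y) *\<^sub>R V y) \<partial>lborel)"
    unfolding conv_def by (rule integral_norm_bound_ennreal[OF i])
  also have "\<dots> \<le> (\<integral>\<^sup>+y. ennreal (\<eta> (x - y)) * ennreal \<tau> + ennreal (\<eta> (x - y)) * ennreal (norm (V y) - \<tau>) \<partial>lborel)"
  proof (intro nn_integral_mono)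
    fix y
    have "ennreal (norm (V y)) \<le> ennreal \<tau> + ennreal (norm (V y) - \<tau>)"
      using \<open>\<tau> \<ge> 0\<close> by (cases "norm (V y) \<ge> \<tau>") (auto simp flip: ennreal_plus simp: ennreal_neg intro: ennreal_leI)
    from mult_left_mono[OF this, of "ennreal (\<eta> (x - y))"]
    show "ennreal (norm (\<eta> (x - y) *\<^sub>R V y)) \<le>
      ennreal (\<eta> (x - y)) * ennreal \<tau> + ennreal (\<eta> (x - y)) * ennreal (norm (V y) - \<tau>)"
      using nn by (simp add: ennreal_mult distrib_left)
  qed
  also have "\<dots> = ennreal \<tau> + ?I"
    using mollifier_nn_integral_reflect[OF m, of x]
    by (subst nn_integral_add) (auto simp: nn_integral_multc)
  finally have "ennreal (norm (conv \<eta> V x)) \<le> ennreal \<tau> + ?I" .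
  then have "ennreal (norm (conv \<eta> V x)) - ennreal \<tau> \<le> ?I"
    by (simp add: ennreal_minus_le_iff)
  then show ?thesis using \<open>\<tau> \<ge> 0\<close> by (simp add: ennreal_minus)
qed

text \<open>The gradient of a mollification is thus controlled above any threshold by
  \<open>V\<close> above the same threshold, with constant 1 and uniformly in the mollifier, at the
  price of a slightly larger ball.\<close>

lemma conv_truncation_ball:
  fixes V :: "real^'n \<Rightarrow> 'b::euclidean_space"
  assumes m: "mollifier \<epsilon> \<eta>" and V: "integrable lborel V" and "\<tau> \<ge> 0" and "R + \<epsilon> \<le> R'"
  shows "(\<integral>\<^sup>+x. indicator (ball a R) x * ennreal (norm (conv \<eta> V x) - \<tau>) \<partial>lborel) \<le>
    (\<integral>\<^sup>+y. indicator (ball a R') y * ennreal (norm (V y) - \<tau>) \<partial>lborel)"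
proof -
  have [measurable]: "\<eta> \<in> borel_measurable borel" "V \<in> borel_measurable borel"
    using mollifier_measurable[OF m] V by (auto dest: borel_measurable_integrable)
  have "(\<integral>\<^sup>+x. indicator (ball a R) x * ennreal (norm (conv \<eta> V x) - \<tau>) \<partial>lborel) \<le>
     (\<integral>\<^sup>+x. indicator (ball a R) x * (\<integral>\<^sup>+y. ennreal (\<eta> (x - y)) * ennreal (norm (V y) - \<tau>) \<partial>lborel) \<partial>lborel)"
    using conv_truncation[OF m V \<open>\<tau> \<ge> 0\<close>] by (intro nn_integral_mono mult_left_mono) auto
  also have "\<dots> = (\<integral>\<^sup>+x. \<integral>\<^sup>+y. indicator (ball a R) x * (ennreal (\<eta> (x - y)) * ennreal (norm (V y) - \<tau>)) \<partial>lborel \<partial>lborel)"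
    by (intro nn_integral_cong nn_integral_cmult[symmetric]) measurable
  also have "\<dots> \<le> (\<integral>\<^sup>+x. \<integral>\<^sup>+y. ennreal (\<eta> (x - y)) * (indicator (ball a R') y * ennreal (norm (V y) - \<tau>)) \<partial>lborel \<partial>lborel)"
  proof (intro nn_integral_mono)
    fix x y
    have "y \<in> ball a R'" if "x \<in> ball a R" "\<eta> (x - y) \<noteq> 0"
    proof -
      have "norm (x - y) < \<epsilon>" using m that(2) by (force simp: mollifier_def not_le[symmetric])
      then have "dist a y < R + \<epsilon>"
        using that(1) dist_triangle[of a y x] by (simp add: dist_norm)
      then show ?thesis using assms(4) by simp
    qed
    then show "indicator (ball a R) x * (ennreal (\<eta> (x - y)) * ennreal (norm (V y) - \<tau>)) \<le>
       ennreal (\<eta> (x - y)) * (indicator (ball a R') y * ennreal (norm (V y) - \<tau>))"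
      by (cases "x \<in> ball a R"; cases "\<eta> (x - y) = 0") (simp_all add: indicator_def)
  qed
  also have "\<dots> = (\<integral>\<^sup>+y. \<integral>\<^sup>+x. ennreal (\<eta> (x - y)) * (indicator (ball a R') y * ennreal (norm (V y) - \<tau>)) \<partial>lborel \<partial>lborel)"
    by (rule lborel_pair.Fubini') measurable
  also have "\<dots> = (\<integral>\<^sup>+y. indicator (ball a R') y * ennreal (norm (V y) - \<tau>) \<partial>lborel)"
    using mollifier_nn_integral_shift[OF m] by (intro nn_integral_cong) (simp add: nn_integral_multc)
  finally show ?thesis .
qed

section \<open>A truncated potential estimate on spheres\<close>

lemma nn_integral_Ioo_Icc:
  "(\<integral>\<^sup>+s. indicator {a..b::real} s * f s \<partial>lborel) = (\<integral>\<^sup>+s. indicator {a<..<b} s * f s \<partial>lborel)"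
proof (rule nn_integral_cong_AE)
  have "AE s in lborel. s \<noteq> a" "AE s in lborel. s \<noteq> b" by (rule AE_lborel_singleton)+
  then show "AE s in lborel. indicator {a..b::real} s * f s = indicator {a<..<b} s * f s"
    by eventually_elim (auto simp: indicator_def)
qed

lemma segment_gradient_bound:
  assumes "smooth v"
  shows "ennreal \<bar>v y - v x\<bar> \<le>
    ennreal (norm (y - x)) * (\<integral>\<^sup>+s. indicator {0<..<1} s * ennreal (norm (gradient v (x + s *\<^sub>R (y - x)))) \<partial>lborel)"
proof -
  let ?F = "\<lambda>s. v (x + s *\<^sub>R (y - x))"
  let ?f = "\<lambda>s. gradient v (x + s *\<^sub>R (y - x)) \<bullet> (y - x)"
  have [measurable]: "gradient v \<in> borel_measurable borel" by (rule gradient_measurable[OF assms])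
  have d: "(?F has_vector_derivative ?f s) (at s within {0..1})" for s
  proof -
    have "((\<lambda>s. x + s *\<^sub>R (y - x)) has_derivative (\<lambda>h. h *\<^sub>R (y - x))) (at s within {0..1})"
      by (auto intro!: derivative_eq_intros)
    from has_derivative_compose[OF this smooth_has_derivative[OF assms]]
    show ?thesis by (simp add: has_vector_derivative_def)
  qed
  have c: "continuous_on {0..1} ?f"
    by (intro continuous_intros continuous_on_compose2[OF continuous_gradient[OF assms]]) auto
  have b: "has_bochner_integral lborel (\<lambda>s. indicator {0..1} s *\<^sub>R ?f s) (?F 1 - ?F 0)"
    using d c by (intro has_bochner_integral_FTC_Icc) auto
  then have "v y - v x = (\<integral>s. indicator {0..1} s *\<^sub>R ?f s \<partial>lborel)"
    by (simp add: has_bochner_integral_integral_eq)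
  then have "ennreal \<bar>v y - v x\<bar> \<le> (\<integral>\<^sup>+s. norm (indicator {0..1} s *\<^sub>R ?f s) \<partial>lborel)"
    using integral_norm_bound_ennreal[of lborel "\<lambda>s. indicator {0..1} s *\<^sub>R ?f s"] b
    by (simp add: has_bochner_integral_iff)
  also have "\<dots> \<le> (\<integral>\<^sup>+s. ennreal (norm (y - x)) * (indicator {0..1} s * ennreal (norm (gradient v (x + s *\<^sub>R (y - x))))) \<partial>lborel)"
  proof (intro nn_integral_mono)
    fix s :: real
    have "ennreal \<bar>?f s\<bar> \<le> ennreal (norm (y - x)) * ennreal (norm (gradient v (x + s *\<^sub>R (y - x))))"
      using Cauchy_Schwarz_ineq2[of "gradient v (x + s *\<^sub>R (y - x))" "y - x"]
      by (simp add: ennreal_mult[symmetric] mult.commute ennreal_leI)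
    then show "ennreal (norm (indicator {0..1} s *\<^sub>R ?f s)) \<le>
      ennreal (norm (y - x)) * (indicator {0..1} s * ennreal (norm (gradient v (x + s *\<^sub>R (y - x)))))"
      by (auto simp: indicator_def)
  qed
  also have "\<dots> = ennreal (norm (y - x)) * (\<integral>\<^sup>+s. indicator {0<..<1} s * ennreal (norm (gradient v (x + s *\<^sub>R (y - x)))) \<partial>lborel)"
    by (simp add: nn_integral_cmult nn_integral_Ioo_Icc)
  finally show ?thesis .
qed

text \<open>
  \<open>shell a R \<tau> g t\<close> bounds, up to constants, the part of the Riesz potential of \<open>g\<close> above the
  threshold \<open>\<tau> s\<close>, uniformly over the points of the sphere of radius \<open>t\<close>: from such a point, the
  homothety of ratio \<open>s\<close> maps the ball into the shell of points within \<open>2 R s\<close> of the sphere.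
\<close>

definition shell :: "real^'n \<Rightarrow> real \<Rightarrow> (real \<Rightarrow> real) \<Rightarrow> (real^'n \<Rightarrow> real) \<Rightarrow> real \<Rightarrow> ennreal" where
  "shell a R \<tau> g t = (\<integral>\<^sup>+s. indicator {0<..<1} s * ennreal (s powr (- real CARD('n))) *
     (\<integral>\<^sup>+z. indicator (ball a R) z * indicator {z. \<bar>dist a z - t\<bar> \<le> 2 * R * s} z * ennreal (g z - \<tau> s) \<partial>lborel) \<partial>lborel)"

text \<open>Substitution z = x + s (y - x), with Jacobian s^n. Convexity keeps z in the ball, and |z
  - x| = s |y - x| \<le> 2 R s puts it in the shell about the sphere through x.\<close>

lemma homothety_integral_bound:
  fixes x a :: "real^'n::finite"
  assumes [measurable]: "g \<in> borel_measurable borel" and x: "x \<in> ball a R" and s: "0 < s" "s < 1"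
  shows "(\<integral>\<^sup>+y. indicator (ball a R) y * ennreal (g (x + s *\<^sub>R (y - x)) - c) \<partial>lborel) \<le>
    ennreal (s powr (- real CARD('n))) *
    (\<integral>\<^sup>+z. indicator (ball a R) z * indicator {z. \<bar>dist a z - dist a x\<bar> \<le> 2 * R * s} z * ennreal (g z - c) \<partial>lborel)"
proof -
  define F :: "real^'n \<Rightarrow> ennreal" where
    "F z = indicator (ball a R) (x + (1 / s) *\<^sub>R (z - x)) * ennreal (g z - c)" for z
  have [measurable]: "F \<in> borel_measurable borel" unfolding F_def by measurable
  have "(\<integral>\<^sup>+z. F z \<partial>lborel) = ennreal (\<bar>s\<bar> ^ DIM(real^'n)) * (\<integral>\<^sup>+y. F ((x - s *\<^sub>R x) + s *\<^sub>R y) \<partial>lborel)"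
    using s by (intro nn_integral_affine) auto
  also have "(\<integral>\<^sup>+y. F ((x - s *\<^sub>R x) + s *\<^sub>R y) \<partial>lborel) = (\<integral>\<^sup>+y. indicator (ball a R) y * ennreal (g (x + s *\<^sub>R (y - x)) - c) \<partial>lborel)"
  proof (intro nn_integral_cong)
    fix y
    have 1: "(x - s *\<^sub>R x) + s *\<^sub>R y = x + s *\<^sub>R (y - x)" by (simp add: algebra_simps)
    show "F ((x - s *\<^sub>R x) + s *\<^sub>R y) = indicator (ball a R) y * ennreal (g (x + s *\<^sub>R (y - x)) - c)"
      unfolding 1 F_def using s by simp
  qed
  finally have eq: "(\<integral>\<^sup>+z. F z \<partial>lborel) = ennreal (s ^ CARD('n)) *
      (\<integral>\<^sup>+y. indicator (ball a R) y * ennreal (g (x + s *\<^sub>R (y - x)) - c) \<partial>lborel)" (is "_ = _ * ?J")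
    using s by simp
  have "?J = ennreal (s powr (- real CARD('n))) * (ennreal (s ^ CARD('n)) * ?J)"
  proof -
    have "ennreal (s powr (- real CARD('n))) * ennreal (s ^ CARD('n)) = 1"
      using s by (simp add: powr_minus powr_realpow flip: ennreal_mult)
    then show ?thesis by (simp flip: mult.assoc)
  qed
  also have "\<dots> = ennreal (s powr (- real CARD('n))) * (\<integral>\<^sup>+z. F z \<partial>lborel)" by (simp add: eq)
  also have "\<dots> \<le> ennreal (s powr (- real CARD('n))) *
    (\<integral>\<^sup>+z. indicator (ball a R) z * indicator {z. \<bar>dist a z - dist a x\<bar> \<le> 2 * R * s} z * ennreal (g z - c) \<partial>lborel)"
  proof (intro mult_left_mono nn_integral_mono)
    fix z
    show "F z \<le> indicator (ball a R) z * indicator {z. \<bar>dist a z - dist a x\<bar> \<le> 2 * R * s} z * ennreal (g z - c)"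
    proof (cases "x + (1 / s) *\<^sub>R (z - x) \<in> ball a R")
      case True
      define y where "y = x + (1 / s) *\<^sub>R (z - x)"
      have y: "y \<in> ball a R" using True by (simp add: y_def)
      have z: "z = x + s *\<^sub>R (y - x)" using s by (simp add: y_def)
      then have z': "z = (1 - s) *\<^sub>R x + s *\<^sub>R y" by (simp add: algebra_simps)
      have "z \<in> ball a R"
        unfolding z' using convexD_alt[OF convex_ball x y, of s] s by simp
      moreover have "dist z x \<le> 2 * R * s"
      proof -
        have "dist z x = s * dist x y" using s by (simp add: z dist_norm norm_minus_commute)
        also have "dist x y \<le> 2 * R"
          using x y dist_triangle[of x y a] by (simp add: dist_commute)
        finally show ?thesis using s by (simp add: mult.commute)
      qed
      then have "\<bar>dist a z - dist a x\<bar> \<le> 2 * R * s"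
        using dist_triangle[of a z x] dist_triangle[of a x z] by (simp add: dist_commute abs_le_iff)
      ultimately show ?thesis using True by (simp add: F_def)
    qed (simp add: F_def)
  qed auto
  finally show ?thesis .
qed

text \<open>The difference is integrated along the segment from x to y, and the integrals over y and
  s are exchanged. For each s the gradient is split at the level \<open>\<tau> s\<close>. The
  resulting bound depends on x only through its distance to \<open>a\<close>, so it is uniform on
  spheres.\<close>

lemma mean_oscillation_bound:
  fixes x a :: "real^'n::finite"
  assumes sm: "smooth v" and x: "x \<in> ball a R" and [measurable]: "\<tau> \<in> borel_measurable borel"
    and \<tau>: "\<And>s. \<tau> s \<ge> 0"
  shows "(\<integral>\<^sup>+y. indicator (ball a R) y * ennreal \<bar>v y - v x\<bar> \<partial>lborel) \<le>
    ennreal (2 * R) * (emeasure lborel (ball a R) * (\<integral>\<^sup>+s. indicator {0<..<1} s * ennreal (\<tau> s) \<partial>lborel) +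
      shell a R \<tau> (\<lambda>z. norm (gradient v z)) (dist a x))"
proof -
  let ?g = "\<lambda>z. norm (gradient v z)"
  let ?q = "\<lambda>y s. indicator {0<..<1} s * (indicator (ball a R) y * ennreal (?g (x + s *\<^sub>R (y - x))))"
  let ?H = "\<lambda>s. \<integral>\<^sup>+z. indicator (ball a R) z * indicator {z. \<bar>dist a z - dist a x\<bar> \<le> 2 * R * s} z * ennreal (?g z - \<tau> s) \<partial>lborel"
  have [measurable]: "gradient v \<in> borel_measurable borel" "v \<in> borel_measurable borel"
    using sm by (auto intro: gradient_measurable smooth_measurable)
  have "(\<integral>\<^sup>+y. indicator (ball a R) y * ennreal \<bar>v y - v x\<bar> \<partial>lborel) \<le>
    (\<integral>\<^sup>+y. ennreal (2 * R) * (\<integral>\<^sup>+s. ?q y s \<partial>lborel) \<partial>lborel)"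
  proof (intro nn_integral_mono)
    fix y
    show "indicator (ball a R) y * ennreal \<bar>v y - v x\<bar> \<le>
      ennreal (2 * R) * (\<integral>\<^sup>+s. ?q y s \<partial>lborel)"
    proof (cases "y \<in> ball a R")
      case True
      have "norm (y - x) \<le> 2 * R"
        using x True dist_triangle[of x y a] by (simp add: dist_commute dist_norm norm_minus_commute)
      then have "ennreal (norm (y - x)) \<le> ennreal (2 * R)" by (rule ennreal_leI)
      from order_trans[OF segment_gradient_bound[OF sm, of y x] mult_right_mono[OF this]] True
      show ?thesis by simp
    qed simp
  qed
  also have "\<dots> = ennreal (2 * R) * (\<integral>\<^sup>+y. (\<integral>\<^sup>+s. ?q y s \<partial>lborel) \<partial>lborel)"
    by (intro nn_integral_cmult) measurable
  also have "(\<integral>\<^sup>+y. (\<integral>\<^sup>+s. ?q y s \<partial>lborel) \<partial>lborel)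
     = (\<integral>\<^sup>+s. (\<integral>\<^sup>+y. ?q y s \<partial>lborel) \<partial>lborel)"
    by (rule lborel_pair.Fubini') measurable
  also have "\<dots> \<le> (\<integral>\<^sup>+s. emeasure lborel (ball a R) * (indicator {0<..<1} s * ennreal (\<tau> s)) +
      indicator {0<..<1} s * ennreal (s powr (- real CARD('n))) *
     ?H s \<partial>lborel)"
  proof (intro nn_integral_mono)
    fix s :: real
    show "(\<integral>\<^sup>+y. ?q y s \<partial>lborel) \<le>
      emeasure lborel (ball a R) * (indicator {0<..<1} s * ennreal (\<tau> s)) +
      indicator {0<..<1} s * ennreal (s powr (- real CARD('n))) *
     ?H s"
    proof (cases "s \<in> {0<..<1}")
      case True
      have "(\<integral>\<^sup>+y. indicator (ball a R) y * ennreal (?g (x + s *\<^sub>R (y - x))) \<partial>lborel) \<le>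
        (\<integral>\<^sup>+y. ennreal (\<tau> s) * indicator (ball a R) y + indicator (ball a R) y * ennreal (?g (x + s *\<^sub>R (y - x)) - \<tau> s) \<partial>lborel)"
      proof (intro nn_integral_mono)
        fix y
        let ?h = "?g (x + s *\<^sub>R (y - x))"
        have "ennreal ?h \<le> ennreal (\<tau> s) + ennreal (?h - \<tau> s)"
          using \<tau>[of s] by (cases "?h \<ge> \<tau> s") (auto simp flip: ennreal_plus simp: ennreal_neg intro: ennreal_leI)
        then show "indicator (ball a R) y * ennreal ?h \<le> ennreal (\<tau> s) * indicator (ball a R) y + indicator (ball a R) y * ennreal (?h - \<tau> s)"
          by (simp add: indicator_def)
      qed
      also have "\<dots> = ennreal (\<tau> s) * emeasure lborel (ball a R) + (\<integral>\<^sup>+y. indicator (ball a R) y * ennreal (?g (x + s *\<^sub>R (y - x)) - \<tau> s) \<partial>lborel)"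
        by (subst nn_integral_add) (auto simp: nn_integral_cmult)
      also have "\<dots> \<le> ennreal (\<tau> s) * emeasure lborel (ball a R) + ennreal (s powr (- real CARD('n))) *
        ?H s"
        using True x by (intro add_left_mono homothety_integral_bound) auto
      finally show ?thesis using True by (simp add: mult.commute)
    qed simp
  qed
  also have "\<dots> = emeasure lborel (ball a R) * (\<integral>\<^sup>+s. indicator {0<..<1} s * ennreal (\<tau> s) \<partial>lborel) +
      shell a R \<tau> ?g (dist a x)"
    unfolding shell_def by (subst nn_integral_add) (auto simp: nn_integral_cmult)
  finally show ?thesis by (simp add: mult_left_mono)
qed

lemma shell_measurable [measurable]:
  fixes a :: "real^'n::finite"
  assumes [measurable]: "\<tau> \<in> borel_measurable borel" "g \<in> borel_measurable borel"
  shows "shell a R \<tau> g \<in> borel_measurable borel"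
  unfolding shell_def by measurable

text \<open>For fixed s and z the radii t that count form an interval of length 4 R s. This extra
  factor s improves the weight s^(-n) to s^(1-n); it is what a sphere estimate gains over a
  pointwise one.\<close>

lemma shell_integral:
  fixes a :: "real^'n::finite"
  assumes [measurable]: "\<tau> \<in> borel_measurable borel" "g \<in> borel_measurable borel" and "R \<ge> 0"
  shows "(\<integral>\<^sup>+t. shell a R \<tau> g t \<partial>lborel) \<le> ennreal (4 * R) *
    (\<integral>\<^sup>+s. indicator {0<..<1} s * ennreal (s powr (1 - real CARD('n))) *
      (\<integral>\<^sup>+z. indicator (ball a R) z * ennreal (g z - \<tau> s) \<partial>lborel) \<partial>lborel)"
proof -
  let ?w = "\<lambda>s. indicator {0<..<1} s * ennreal (s powr (- real CARD('n)))"
  let ?in = "\<lambda>t s z. indicator (ball a R) z * indicator {z. \<bar>dist a z - t\<bar> \<le> 2 * R * s} z * ennreal (g z - \<tau> s)"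
  let ?G = "\<lambda>s. \<integral>\<^sup>+z. indicator (ball a R) z * ennreal (g z - \<tau> s) \<partial>lborel"
  have "(\<integral>\<^sup>+t. shell a R \<tau> g t \<partial>lborel) = (\<integral>\<^sup>+s. \<integral>\<^sup>+t. ?w s *
     (\<integral>\<^sup>+z. ?in t s z \<partial>lborel) \<partial>lborel \<partial>lborel)"
    unfolding shell_def by (rule lborel_pair.Fubini') measurable
  also have "\<dots> = (\<integral>\<^sup>+s. ?w s * (\<integral>\<^sup>+t. 
     (\<integral>\<^sup>+z. ?in t s z \<partial>lborel) \<partial>lborel) \<partial>lborel)"
    by (intro nn_integral_cong nn_integral_cmult) measurable
  also have "\<dots> = (\<integral>\<^sup>+s. ennreal (4 * R) * (indicator {0<..<1} s * ennreal (s powr (1 - real CARD('n))) *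
      ?G s) \<partial>lborel)"
  proof (intro nn_integral_cong)
    fix s :: real
    show "?w s * (\<integral>\<^sup>+t. 
     (\<integral>\<^sup>+z. ?in t s z \<partial>lborel) \<partial>lborel) =
      ennreal (4 * R) * (indicator {0<..<1} s * ennreal (s powr (1 - real CARD('n))) *
      ?G s)"
    proof (cases "s \<in> {0<..<1}")
      case True
      have "(\<integral>\<^sup>+t. (\<integral>\<^sup>+z. ?in t s z \<partial>lborel) \<partial>lborel)
       = (\<integral>\<^sup>+z. (\<integral>\<^sup>+t. ?in t s z \<partial>lborel) \<partial>lborel)"
        by (rule lborel_pair.Fubini') measurable
      also have "\<dots> = (\<integral>\<^sup>+z. ennreal (4 * R * s) * (indicator (ball a R) z * ennreal (g z - \<tau> s)) \<partial>lborel)"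
      proof (intro nn_integral_cong)
        fix z
        have "(\<integral>\<^sup>+t. ?in t s z \<partial>lborel) =
          (\<integral>\<^sup>+t. (indicator (ball a R) z * ennreal (g z - \<tau> s)) * indicator {dist a z - 2 * R * s .. dist a z + 2 * R * s} t \<partial>lborel)"
          by (intro nn_integral_cong) (auto simp: indicator_def abs_le_iff)
        also have "\<dots> = (indicator (ball a R) z * ennreal (g z - \<tau> s)) * ennreal (4 * R * s)"
          using True \<open>R \<ge> 0\<close> by (subst nn_integral_cmult_indicator) (auto simp: mult.assoc)
        finally show "(\<integral>\<^sup>+t. ?in t s z \<partial>lborel) =
           ennreal (4 * R * s) * (indicator (ball a R) z * ennreal (g z - \<tau> s))"
          by (simp add: mult.commute)
      qed
      also have "\<dots> = ennreal (4 * R * s) * ?G s"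
        by (intro nn_integral_cmult) measurable
      finally have eq: "(\<integral>\<^sup>+t. (\<integral>\<^sup>+z. ?in t s z \<partial>lborel) \<partial>lborel)
        = ennreal (4 * R * s) * ?G s" .
      have "s powr (- real CARD('n)) * (4 * R * s) = (4 * R) * s powr (1 - real CARD('n))"
        using True by (simp add: powr_diff powr_minus field_simps)
      then have "ennreal (s powr (- real CARD('n))) * ennreal (4 * R * s) = ennreal (4 * R) * ennreal (s powr (1 - real CARD('n)))"
        using True \<open>R \<ge> 0\<close> by (simp flip: ennreal_mult)
      then show ?thesis using True unfolding eq by (simp flip: mult.assoc)
    qed simp
  qed
  also have "\<dots> = ennreal (4 * R) *
    (\<integral>\<^sup>+s. indicator {0<..<1} s * ennreal (s powr (1 - real CARD('n))) *
      ?G s \<partial>lborel)"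
    by (intro nn_integral_cmult) measurable
  finally show ?thesis by simp
qed

text \<open>The sphere must not depend on the mollification, while each single bound holds only in
  the mean over t. If every t failed from some index on, the lower limit would be at least
  \<open>c\<close> on the whole interval, against Fatou's lemma.\<close>

lemma Fatou_good_point:
  fixes \<Phi> :: "nat \<Rightarrow> real \<Rightarrow> ennreal"
  assumes [measurable]: "\<And>j. \<Phi> j \<in> borel_measurable borel"
    and D: "\<And>j. (\<integral>\<^sup>+t. \<Phi> j t \<partial>lborel) \<le> D" and "a < b" and c: "D < ennreal c * ennreal (b - a)"
  shows "\<exists>t. a < t \<and> t < b \<and> (\<exists>\<^sub>F j in sequentially. \<Phi> j t \<le> ennreal c)"
proof (rule ccontr)
  assume no: "\<not> ?thesis"
  then have *: "eventually (\<lambda>j. \<Phi> j t > ennreal c) sequentially" if "a < t" "t < b" for t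
    using that by (auto simp: frequently_def not_le)
  have "ennreal c * indicator {a<..<b} t \<le> liminf (\<lambda>j. \<Phi> j t)" for t
  proof (cases "t \<in> {a<..<b}")
    case True
    then have "eventually (\<lambda>j. ennreal c \<le> \<Phi> j t) sequentially"
      using *[of t] by (auto elim: eventually_mono)
    then show ?thesis using True by (simp add: Liminf_bounded)
  qed simp
  then have "(\<integral>\<^sup>+t. ennreal c * indicator {a<..<b} t \<partial>lborel) \<le> (\<integral>\<^sup>+t. liminf (\<lambda>j. \<Phi> j t) \<partial>lborel)"
    by (intro nn_integral_mono) auto
  also have "\<dots> \<le> liminf (\<lambda>j. \<integral>\<^sup>+t. \<Phi> j t \<partial>lborel)"
    by (rule nn_integral_liminf) auto
  also have "\<dots> \<le> D"
    using D by (intro order_trans[OF Liminf_le_Limsup Limsup_bounded]) auto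
  finally show False using c \<open>a < b\<close> by (simp add: nn_integral_cmult_indicator not_le[symmetric])
qed

text \<open>The contribution of a point with gradient norm \<open>g\<close> once
  \<open>shell\<close> has been integrated over the radii, up to the factor 4 R: the double integral
  in \<open>shell_integral\<close> with its order exchanged.\<close>

definition excess :: "nat \<Rightarrow> (real \<Rightarrow> real) \<Rightarrow> real \<Rightarrow> ennreal" where
  "excess n \<tau> g = (\<integral>\<^sup>+s. indicator {0<..<1} s * ennreal (s powr (1 - real n)) * ennreal (g - \<tau> s) \<partial>lborel)"

lemma measure_ball_pos:
  fixes a :: "'a::euclidean_space"
  assumes "R > 0"
  shows "measure lborel (ball a R) > 0" "emeasure lborel (ball a R) = ennreal (measure lborel (ball a R))"
proof -
  have "emeasure lborel (ball a R) \<noteq> \<infinity>"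
    using emeasure_bounded_finite[of "ball a R"] by simp
  then show eq: "emeasure lborel (ball a R) = ennreal (measure lborel (ball a R))"
    by (simp add: emeasure_eq_ennreal_measure)
  have "\<not> negligible (ball a R)" using assms by (simp add: open_not_negligible)
  then have "emeasure lborel (ball a R) \<noteq> 0"
    by (simp add: negligible_iff_emeasure0 emeasure_completion)
  then show "measure lborel (ball a R) > 0"
    unfolding eq by (simp add: zero_less_measure_iff measure_nonneg less_le)
qed

lemma conv_approximation:
  fixes U :: "real^'n \<Rightarrow> real"
  assumes U: "integrable lborel U" and V: "integrable lborel V"
    and weak: "\<And>\<phi> i. \<phi> \<in> test_functions (ball a (2 * R)) \<Longrightarrow>
      (\<integral>y. U y * partial i \<phi> y \<partial>lborel) = - (\<integral>y. V y $ i * \<phi> y \<partial>lborel)"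
    and "R > 0" and "\<delta> > 0"
  obtains v where "smooth v" "(\<integral>\<^sup>+x. ennreal \<bar>v x - U x\<bar> \<partial>lborel) \<le> ennreal \<delta>"
    "(\<integral>\<^sup>+x. indicator (ball a R) x * ennreal (norm (gradient v x - V x)) \<partial>lborel) \<le> ennreal \<delta>"
    "\<And>c. c \<ge> 0 \<Longrightarrow> (\<integral>\<^sup>+x. indicator (ball a R) x * ennreal (norm (gradient v x) - c) \<partial>lborel) \<le>
       (\<integral>\<^sup>+y. indicator (ball a (2 * R)) y * ennreal (norm (V y) - c) \<partial>lborel)"
proof -
  obtain d1 where d1: "d1 > 0" "\<And>h. norm h < d1 \<Longrightarrow> (\<integral>\<^sup>+x. norm (U (x - h) - U x) \<partial>lborel) \<le> ennreal \<delta>"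
    using L1_translation[OF U] \<open>\<delta> > 0\<close> by blast
  obtain d2 where d2: "d2 > 0" "\<And>h. norm h < d2 \<Longrightarrow> (\<integral>\<^sup>+x. norm (V (x - h) - V x) \<partial>lborel) \<le> ennreal \<delta>"
    using L1_translation[OF V] \<open>\<delta> > 0\<close> by blast
  define \<epsilon> where "\<epsilon> = min (min d1 d2) (R / 2)"
  have \<epsilon>: "\<epsilon> > 0" "\<epsilon> \<le> d1" "\<epsilon> \<le> d2" "\<epsilon> \<le> R / 2" using d1 d2 \<open>R > 0\<close> by (auto simp: \<epsilon>_def)
  obtain \<eta> :: "real^'n \<Rightarrow> real" where m: "mollifier \<epsilon> \<eta>" using ex_mollifier[OF \<epsilon>(1)] .
  have \<eta>: "\<eta> \<in> test_functions UNIV" using m by (simp add: mollifier_def)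
  have grad: "gradient (conv \<eta> U) x = conv \<eta> V x" if x: "x \<in> ball a R" for x
  proof (rule gradient_conv[OF m U V weak])
    show "cball x \<epsilon> \<subseteq> ball a (2 * R)"
    proof
      fix y assume "y \<in> cball x \<epsilon>"
      then have "dist a y < R + \<epsilon>" using x dist_triangle[of a y x] by simp
      then show "y \<in> ball a (2 * R)" using \<epsilon>(4) \<open>R > 0\<close> by simp
    qed
  qed auto
  show thesis
  proof
    show "smooth (conv \<eta> U)" by (rule smooth_conv[OF \<eta> U])
    show "(\<integral>\<^sup>+x. ennreal \<bar>conv \<eta> U x - U x\<bar> \<partial>lborel) \<le> ennreal \<delta>"
      using conv_L1_error[OF m U, of "ennreal \<delta>"] d1(2) \<epsilon>(2) by simp
    have "(\<integral>\<^sup>+x. indicator (ball a R) x * ennreal (norm (gradient (conv \<eta> U) x - V x)) \<partial>lborel) \<le>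
       (\<integral>\<^sup>+x. ennreal (norm (conv \<eta> V x - V x)) \<partial>lborel)"
      using grad by (intro nn_integral_mono) (auto simp: indicator_def)
    also have "\<dots> \<le> ennreal \<delta>"
      using conv_L1_error[OF m V, of "ennreal \<delta>"] d2(2) \<epsilon>(3) by simp
    finally show "(\<integral>\<^sup>+x. indicator (ball a R) x * ennreal (norm (gradient (conv \<eta> U) x - V x)) \<partial>lborel) \<le> ennreal \<delta>" .
    fix c :: real assume "c \<ge> 0"
    have "(\<integral>\<^sup>+x. indicator (ball a R) x * ennreal (norm (gradient (conv \<eta> U) x) - c) \<partial>lborel) =
      (\<integral>\<^sup>+x. indicator (ball a R) x * ennreal (norm (conv \<eta> V x) - c) \<partial>lborel)"
      using grad by (intro nn_integral_cong) (auto simp: indicator_def)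
    also have "\<dots> \<le> (\<integral>\<^sup>+y. indicator (ball a (2 * R)) y * ennreal (norm (V y) - c) \<partial>lborel)"
      using \<epsilon>(4) \<open>R > 0\<close> by (intro conv_truncation_ball[OF m V \<open>c \<ge> 0\<close>]) auto
    finally show "(\<integral>\<^sup>+x. indicator (ball a R) x * ennreal (norm (gradient (conv \<eta> U) x) - c) \<partial>lborel) \<le>
       (\<integral>\<^sup>+y. indicator (ball a (2 * R)) y * ennreal (norm (V y) - c) \<partial>lborel)" .
  qed
qed

text \<open>The two terms below \<open>X\<close> come from the parts of the gradient below and above
  the threshold. By \<open>shell_integral\<close> the mean of the shell term over the radii in (R/2,
  R) is at most 4 R e / (R/2) = 8 e; \<open>mean_oscillation_bound\<close> multiplies it by 2 R and
  the mean over the ball divides by its volume, hence the 16.\<close>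

lemma good_sphere:
  fixes U :: "real^'n::finite \<Rightarrow> real"
  assumes U: "integrable lborel U" and V: "integrable lborel V"
    and weak: "\<And>\<phi> i. \<phi> \<in> test_functions (ball a (2 * R)) \<Longrightarrow>
      (\<integral>y. U y * partial i \<phi> y \<partial>lborel) = - (\<integral>y. V y $ i * \<phi> y \<partial>lborel)"
    and R: "R > 0" and \<tau>m [measurable]: "\<tau> \<in> borel_measurable borel" and \<tau>: "\<And>s. \<tau> s \<ge> 0"
    and A: "(\<integral>\<^sup>+s. indicator {0<..<1} s * ennreal (\<tau> s) \<partial>lborel) \<le> ennreal A" "A \<ge> 0"
    and E: "(\<integral>\<^sup>+z. indicator (ball a (2 * R)) z * excess CARD('n) \<tau> (norm (V z)) \<partial>lborel) \<le> ennreal e" "e \<ge> 0"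
    and X: "X > 2 * R * A + 16 * R * e / measure lborel (ball a R)"
  shows "\<exists>b t. R / 2 < t \<and> t < R \<and> (\<forall>\<epsilon>>0. \<exists>v. smooth v \<and>
      (\<integral>\<^sup>+x. ennreal \<bar>v x - U x\<bar> \<partial>lborel) \<le> ennreal \<epsilon> \<and>
      (\<integral>\<^sup>+x. indicator (ball a R) x * ennreal (norm (gradient v x - V x)) \<partial>lborel) \<le> ennreal \<epsilon> \<and>
      (\<forall>x. dist a x = t \<longrightarrow> \<bar>v x - b\<bar> < X))"
proof -
  let ?B = "ball a R"
  define \<beta> where "\<beta> = measure lborel ?B"
  have \<beta>: "\<beta> > 0" "emeasure lborel ?B = ennreal \<beta>"
    using measure_ball_pos[OF R, of a] by (auto simp: \<beta>_def)
  have [measurable]: "U \<in> borel_measurable borel" "V \<in> borel_measurable borel"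
    using U V by (auto dest: borel_measurable_integrable)
  define gap where "gap = X - (2 * R * A + 16 * R * e / \<beta>)"
  have gap: "gap > 0" using X by (simp add: gap_def \<beta>_def)
  \<comment> \<open>\<open>c\<close> exceeds the mean 8 e by an amount that uses up half of
    \<open>gap\<close>; the other half absorbs the L1 error of the mollification.\<close>
  define c where "c = 8 * e + gap * \<beta> / (4 * R)"
  have c: "c > 8 * e" "c > 0" using gap \<beta> R E(2) by (auto simp: c_def intro!: add_nonneg_pos)
  have cX: "2 * R * (\<beta> * A + c) = \<beta> * X - \<beta> * gap / 2"
    using \<beta> R by (simp add: c_def gap_def field_simps)
  let ?\<delta> = "\<lambda>j. 1 / real (Suc j)"
  have "\<forall>j. \<exists>v. smooth v \<and> (\<integral>\<^sup>+x. ennreal \<bar>v x - U x\<bar> \<partial>lborel) \<le> ennreal (?\<delta> j) \<and>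
    (\<integral>\<^sup>+x. indicator ?B x * ennreal (norm (gradient v x - V x)) \<partial>lborel) \<le> ennreal (?\<delta> j) \<and>
    (\<forall>c\<ge>0. (\<integral>\<^sup>+x. indicator ?B x * ennreal (norm (gradient v x) - c) \<partial>lborel) \<le>
       (\<integral>\<^sup>+y. indicator (ball a (2 * R)) y * ennreal (norm (V y) - c) \<partial>lborel))" (is "\<forall>j. ?P j")
  proof
    fix j
    have "?\<delta> j > 0" by simp
    from conv_approximation[OF U V weak R this] show "?P j" by blast
  qed
  from choice[OF this] obtain v where sm: "\<And>j. smooth (v j)"
    and vU: "\<And>j. (\<integral>\<^sup>+x. ennreal \<bar>v j x - U x\<bar> \<partial>lborel) \<le> ennreal (?\<delta> j)"
    and vV: "\<And>j. (\<integral>\<^sup>+x. indicator ?B x * ennreal (norm (gradient (v j) x - V x)) \<partial>lborel) \<le> ennreal (?\<delta> j)"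
    and tr: "\<And>j c. c \<ge> 0 \<Longrightarrow> (\<integral>\<^sup>+x. indicator ?B x * ennreal (norm (gradient (v j) x) - c) \<partial>lborel) \<le>
       (\<integral>\<^sup>+y. indicator (ball a (2 * R)) y * ennreal (norm (V y) - c) \<partial>lborel)"
    by blast
  have [measurable]: "gradient (v j) \<in> borel_measurable borel" "v j \<in> borel_measurable borel" for j
    using sm gradient_measurable smooth_measurable by auto
  define \<Phi> where "\<Phi> j = shell a R \<tau> (\<lambda>z. norm (gradient (v j) z))" for j
  have \<Phi>m: "\<Phi> j \<in> borel_measurable borel" for j unfolding \<Phi>_def by measurable
  have \<Phi>D: "(\<integral>\<^sup>+t. \<Phi> j t \<partial>lborel) \<le> ennreal (4 * R * e)" for j
  proof -
    let ?w = "\<lambda>s. indicator {0<..<1} s * ennreal (s powr (1 - real CARD('n)))"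
    have "(\<integral>\<^sup>+t. \<Phi> j t \<partial>lborel) \<le> ennreal (4 * R) * (\<integral>\<^sup>+s. ?w s *
      (\<integral>\<^sup>+z. indicator ?B z * ennreal (norm (gradient (v j) z) - \<tau> s) \<partial>lborel) \<partial>lborel)"
      unfolding \<Phi>_def using R by (intro shell_integral) auto
    \<comment> \<open>The estimate above a threshold is applied at the level \<open>\<tau> s\<close>
      for each s separately; it removes the dependence on \<open>j\<close>.\<close>
    also have "\<dots> \<le> ennreal (4 * R) * (\<integral>\<^sup>+s. ?w s *
      (\<integral>\<^sup>+z. indicator (ball a (2 * R)) z * ennreal (norm (V z) - \<tau> s) \<partial>lborel) \<partial>lborel)"
      by (rule mult_left_mono[OF nn_integral_mono[OF mult_left_mono[OF tr[OF \<tau>]]]]) auto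
    also have "(\<integral>\<^sup>+s. ?w s * (\<integral>\<^sup>+z. indicator (ball a (2 * R)) z * ennreal (norm (V z) - \<tau> s) \<partial>lborel) \<partial>lborel) =
      (\<integral>\<^sup>+s. \<integral>\<^sup>+z. ?w s * (indicator (ball a (2 * R)) z * ennreal (norm (V z) - \<tau> s)) \<partial>lborel \<partial>lborel)"
      by (intro nn_integral_cong nn_integral_cmult[symmetric]) measurable
    also have "\<dots> = (\<integral>\<^sup>+z. \<integral>\<^sup>+s. ?w s * (indicator (ball a (2 * R)) z * ennreal (norm (V z) - \<tau> s)) \<partial>lborel \<partial>lborel)"
      by (rule lborel_pair.Fubini') measurable
    also have "\<dots> = (\<integral>\<^sup>+z. indicator (ball a (2 * R)) z * excess CARD('n) \<tau> (norm (V z)) \<partial>lborel)"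
      unfolding excess_def
      by (intro nn_integral_cong, subst nn_integral_cmult[symmetric])
        (auto intro!: nn_integral_cong simp: mult_ac)
    also have "ennreal (4 * R) * \<dots> \<le> ennreal (4 * R) * ennreal e"
      using E by (intro mult_left_mono) auto
    also have "\<dots> = ennreal (4 * R * e)" using R E(2) by (simp add: ennreal_mult)
    finally show ?thesis .
  qed
  have "ennreal (4 * R * e) < ennreal c * ennreal (R - R / 2)"
  proof -
    have "4 * R * e < c * (R - R / 2)" using c(1) R by (simp add: field_simps)
    then show ?thesis using c(2) R E(2) by (simp add: ennreal_lessI flip: ennreal_mult)
  qed
  then obtain t where t: "R / 2 < t" "t < R" "\<exists>\<^sub>F j in sequentially. \<Phi> j t \<le> ennreal c"
    using Fatou_good_point[of \<Phi> "ennreal (4 * R * e)" "R / 2" R c] \<Phi>m \<Phi>D R by auto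
  \<comment> \<open>The mean of \<open>U\<close> and not of \<open>v j\<close>, so that one constant
    serves all \<open>j\<close>.\<close>
  define b where "b = (\<integral>y. indicator ?B y * U y \<partial>lborel) / \<beta>"
  have sphere: "\<bar>v j x - b\<bar> < X" if j: "\<Phi> j t \<le> ennreal c" "?\<delta> j < \<beta> * gap / 2" and x: "dist a x = t" for j x
  proof -
    have xB: "x \<in> ?B" using x t by simp
    have i1: "integrable lborel (\<lambda>y. indicator ?B y * U y)"
      using integrable_mult_indicator[of ?B lborel U] U by simp
    have i2: "integrable lborel (\<lambda>y. indicator ?B y * v j x)"
      using \<beta>(2) by (intro integrable_mult_left) (auto simp: integrable_indicator_iff)
    have "\<beta> * (v j x - b) = (\<integral>y. indicator ?B y * v j x \<partial>lborel) - (\<integral>y. indicator ?B y * U y \<partial>lborel)"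
      using \<beta>(1) by (simp add: b_def algebra_simps \<beta>_def)
    also have "\<dots> = (\<integral>y. indicator ?B y * v j x - indicator ?B y * U y \<partial>lborel)"
      using i1 i2 by simp
    finally have eq: "\<beta> * (v j x - b) = (\<integral>y. indicator ?B y * v j x - indicator ?B y * U y \<partial>lborel)" .
    have "ennreal \<bar>\<beta> * (v j x - b)\<bar> \<le> (\<integral>\<^sup>+y. norm (indicator ?B y * v j x - indicator ?B y * U y) \<partial>lborel)"
      unfolding eq using integral_norm_bound_ennreal[OF Bochner_Integration.integrable_diff[OF i2 i1]] by simp
    also have "\<dots> \<le> (\<integral>\<^sup>+y. indicator ?B y * ennreal \<bar>v j y - v j x\<bar> + ennreal \<bar>v j y - U y\<bar> \<partial>lborel)"
    proof (intro nn_integral_mono)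
      fix y
      have "\<bar>v j x - U y\<bar> \<le> \<bar>v j y - v j x\<bar> + \<bar>v j y - U y\<bar>" by linarith
      then have "ennreal \<bar>v j x - U y\<bar> \<le> ennreal \<bar>v j y - v j x\<bar> + ennreal \<bar>v j y - U y\<bar>"
        by (simp flip: ennreal_plus)
      then show "ennreal (norm (indicator ?B y * v j x - indicator ?B y * U y)) \<le>
        indicator ?B y * ennreal \<bar>v j y - v j x\<bar> + ennreal \<bar>v j y - U y\<bar>"
        by (cases "y \<in> ?B") auto
    qed
    also have "\<dots> = (\<integral>\<^sup>+y. indicator ?B y * ennreal \<bar>v j y - v j x\<bar> \<partial>lborel) + (\<integral>\<^sup>+y. ennreal \<bar>v j y - U y\<bar> \<partial>lborel)"
      by (intro nn_integral_add) measurable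
    also have "\<dots> \<le> ennreal (2 * R) * (ennreal \<beta> * ennreal A + ennreal c) + ennreal (?\<delta> j)"
    proof (intro add_mono vU)
      have "(\<integral>\<^sup>+y. indicator ?B y * ennreal \<bar>v j y - v j x\<bar> \<partial>lborel) \<le>
        ennreal (2 * R) * (emeasure lborel ?B * (\<integral>\<^sup>+s. indicator {0<..<1} s * ennreal (\<tau> s) \<partial>lborel) + \<Phi> j t)"
        using mean_oscillation_bound[OF sm xB \<tau>m \<tau>, of j] x by (simp add: \<Phi>_def)
      also have "\<dots> \<le> ennreal (2 * R) * (ennreal \<beta> * ennreal A + ennreal c)"
        unfolding \<beta>(2) using A(1) j(1) by (intro mult_left_mono add_mono) auto
      finally show "(\<integral>\<^sup>+y. indicator ?B y * ennreal \<bar>v j y - v j x\<bar> \<partial>lborel) \<le>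
         ennreal (2 * R) * (ennreal \<beta> * ennreal A + ennreal c)" .
    qed
    also have "\<dots> = ennreal (2 * R * (\<beta> * A + c) + ?\<delta> j)"
      using R \<beta>(1) A(2) c(2) by (simp add: ennreal_mult ennreal_plus)
    finally have "\<bar>\<beta> * (v j x - b)\<bar> \<le> 2 * R * (\<beta> * A + c) + ?\<delta> j"
      using R \<beta>(1) A(2) c(2) by (subst (asm) ennreal_le_iff) auto
    also have "\<dots> < \<beta> * X" using j(2) unfolding cX by linarith
    finally show ?thesis using \<beta>(1) by (simp add: abs_mult)
  qed
  have "\<exists>v. smooth v \<and> (\<integral>\<^sup>+x. ennreal \<bar>v x - U x\<bar> \<partial>lborel) \<le> ennreal \<epsilon> \<and>
      (\<integral>\<^sup>+x. indicator ?B x * ennreal (norm (gradient v x - V x)) \<partial>lborel) \<le> ennreal \<epsilon> \<and>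
      (\<forall>x. dist a x = t \<longrightarrow> \<bar>v x - b\<bar> < X)" if "\<epsilon> > 0" for \<epsilon>
  proof -
    have "min \<epsilon> (\<beta> * gap / 2) > 0" using that \<beta> gap by simp
    then have "eventually (\<lambda>j. ?\<delta> j < min \<epsilon> (\<beta> * gap / 2)) sequentially"
      by (rule order_tendstoD(2)[OF LIMSEQ_Suc[OF lim_1_over_n]])
    then have "\<exists>\<^sub>F j in sequentially. \<Phi> j t \<le> ennreal c \<and> ?\<delta> j < min \<epsilon> (\<beta> * gap / 2)"
      using frequently_eventually_frequently[OF t(3)] by simp
    then obtain j where j: "\<Phi> j t \<le> ennreal c" "?\<delta> j < min \<epsilon> (\<beta> * gap / 2)"
      using frequently_ex by blast
    have "ennreal (?\<delta> j) \<le> ennreal \<epsilon>" using j(2) by (intro ennreal_leI) auto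
    then show ?thesis
      using sm vU[of j] vV[of j] sphere[OF j(1)] j(2) by (intro exI[of _ "v j"]) (auto intro: order_trans)
  qed
  then show ?thesis using t by blast
qed

section \<open>Truncations with zero boundary values\<close>

lemma integral_reflect:
  fixes f :: "'a::euclidean_space \<Rightarrow> 'b::euclidean_space"
  assumes [measurable]: "f \<in> borel_measurable borel"
  shows "(\<integral>y. f (x - y) \<partial>lborel) = (\<integral>y. f y \<partial>lborel)"
proof -
  have "(lborel::'a measure) = density (distr lborel borel (\<lambda>y. x + (- 1) *\<^sub>R y)) (\<lambda>_. ennreal (\<bar>- 1\<bar> ^ DIM('a)))"
    by (rule lborel_affine) simp
  then have "(lborel::'a measure) = distr lborel borel (\<lambda>y. x - y)"
    by (simp add: density_1)
  then have "(\<integral>y. f y \<partial>lborel) = (\<integral>y. f y \<partial>distr lborel borel (\<lambda>y. x - y))" by simp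
  also have "\<dots> = (\<integral>y. f (x - y) \<partial>lborel)" by (intro integral_distr) auto
  finally show ?thesis by simp
qed

text \<open>Convolve \<open>\<phi>\<close> with the indicator of a ball so large that the
  convolution is constant near 0, equal to the integral of \<open>\<phi>\<close>. Its partial
  derivative at 0 vanishes, and it is the integral of \<open>partial i \<phi>\<close> after a
  reflection.\<close>

lemma integral_partial_eq_0:
  fixes \<phi> :: "real^'n::finite \<Rightarrow> real"
  assumes \<phi>: "\<phi> \<in> test_functions S"
  shows "(\<integral>x. partial i \<phi> x \<partial>lborel) = 0"
proof -
  obtain r where r: "r > 0" "\<And>x. norm x > r \<Longrightarrow> \<phi> x = 0"
    using test_function_support[OF \<phi>] by blast
  let ?U = "indicator (ball 0 (r + 2)) :: real^'n \<Rightarrow> real"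
  have U: "integrable lborel ?U"
    using emeasure_bounded_finite[of "ball 0 (r + 2) :: (real^'n) set"] by (simp add: integrable_indicator_iff)
  have m: "partial i \<phi> \<in> borel_measurable borel" "\<phi> \<in> borel_measurable borel"
    using \<phi> smooth_measurable smooth_partial test_function_smooth by blast+
  have out: "partial i \<phi> x = 0" if "norm x > r" for x
  proof (rule partial_zero_open[of "- cball 0 r"])
    show "\<phi> y = 0" if "y \<in> - cball 0 r" for y using r(2)[of y] that by simp
  qed (use that in auto)
  have "partial i (conv \<phi> ?U) 0 = partial i (\<lambda>x. (\<integral>y. \<phi> y \<partial>lborel)) 0"
  proof (rule partial_cong_open[of "ball 0 1"])
    fix x :: "real^'n" assume x: "x \<in> ball 0 1"
    have "conv \<phi> ?U x = (\<integral>y. \<phi> (x - y) \<partial>lborel)"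
      unfolding conv_def
    proof (intro Bochner_Integration.integral_cong refl)
      fix y
      show "\<phi> (x - y) *\<^sub>R ?U y = \<phi> (x - y)"
      proof (cases "y \<in> ball 0 (r + 2)")
        case False
        then have "norm (x - y) > r" using x norm_triangle_sub[of y x] by (simp add: norm_minus_commute)
        then show ?thesis using r(2) by simp
      qed simp
    qed
    then show "conv \<phi> ?U x = (\<integral>y. \<phi> y \<partial>lborel)" by (simp add: integral_reflect[OF m(2)])
  qed auto
  then have "conv (partial i \<phi>) ?U 0 = 0" by (simp add: partial_conv[OF \<phi> U])
  moreover have "conv (partial i \<phi>) ?U 0 = (\<integral>y. partial i \<phi> (0 - y) \<partial>lborel)"
    unfolding conv_def
  proof (intro Bochner_Integration.integral_cong refl)
    fix y
    show "partial i \<phi> (0 - y) *\<^sub>R ?U y = partial i \<phi> (0 - y)"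
      using out[of "- y"] by (cases "y \<in> ball 0 (r + 2)") auto
  qed
  ultimately show ?thesis by (simp only: integral_reflect[OF m(1)])
qed

lemma test_function_mult:
  assumes "\<phi> \<in> test_functions S" "smooth f" shows "(\<lambda>x. f x * \<phi> x) \<in> test_functions S"
proof -
  have "closure {x. f x * \<phi> x \<noteq> 0} \<subseteq> closure {x. \<phi> x \<noteq> 0}" by (intro closure_mono) auto
  moreover from this have "compact (closure {x. f x * \<phi> x \<noteq> 0})"
    using assms unfolding test_functions_def
    by (metis (no_types, lifting) closed_Int_compact closed_closure inf.absorb_iff1 mem_Collect_eq)
  ultimately show ?thesis
    using assms smooth_mult unfolding test_functions_def by blast
qed

lemma integral_by_parts_test:
  assumes \<phi>: "\<phi> \<in> test_functions S" and \<psi>: "\<psi> \<in> test_functions S"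
  shows "(\<integral>x. \<psi> x * partial i \<phi> x \<partial>lborel) = - (\<integral>x. partial i \<psi> x * \<phi> x \<partial>lborel)"
proof -
  have sm: "smooth \<phi>" "smooth \<psi>" using assms test_function_smooth by auto
  have "partial i (\<lambda>x. \<psi> x * \<phi> x) = (\<lambda>x. \<psi> x * partial i \<phi> x + partial i \<psi> x * \<phi> x)"
    by (intro ext partial_mult smooth_differentiable sm)
  then have "(\<integral>x. \<psi> x * partial i \<phi> x + partial i \<psi> x * \<phi> x \<partial>lborel) = 0"
    using integral_partial_eq_0[OF test_function_mult[OF \<phi> sm(2)], of i] by simp
  moreover have "integrable lborel (\<lambda>x. \<psi> x * partial i \<phi> x)" "integrable lborel (\<lambda>x. partial i \<psi> x * \<phi> x)"
    using test_function_integrable[OF test_function_mult[OF test_function_partial[OF \<phi>] sm(2)]]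
      test_function_integrable[OF test_function_mult[OF \<phi> smooth_partial[OF sm(2)]]] by auto
  ultimately show ?thesis by simp
qed

lemma test_function_zero_outside: "\<phi> \<in> test_functions S \<Longrightarrow> x \<notin> S \<Longrightarrow> \<phi> x = 0"
  using closure_subset[of "{x. \<phi> x \<noteq> 0}"] unfolding test_functions_def by blast

text \<open>The weak gradient identity required in \<open>W11_0\<close> follows from the
  approximation: it holds for the approximating test functions by parts, and since
  \<open>\<phi>\<close> and \<open>partial i \<phi>\<close> are bounded, both sides pass to the
  limit in L1.\<close>

lemma W11_0I:
  fixes u :: "real^'n::finite \<Rightarrow> real"
  assumes B: "B \<in> sets lebesgue" and u: "u absolutely_integrable_on B" and g: "g absolutely_integrable_on B"
    and approx: "\<And>\<epsilon>. \<epsilon> > 0 \<Longrightarrow> \<exists>\<phi>\<in>test_functions B.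
        (LINT x:B|lebesgue. \<bar>u x - \<phi> x\<bar>) + (LINT x:B|lebesgue. norm (g x - gradient \<phi> x)) < \<epsilon>"
  shows "u \<in> W11_0 B"
proof -
  have "(LINT x:B|lebesgue. u x * partial i \<phi> x) = - (LINT x:B|lebesgue. g x $ i * \<phi> x)"
    if \<phi>: "\<phi> \<in> test_functions B" for \<phi> i
  proof -
    have p\<phi>: "partial i \<phi> \<in> test_functions B" by (rule test_function_partial[OF \<phi>])
    obtain C1 where C1: "C1 > 0" "\<And>x. \<bar>\<phi> x\<bar> \<le> C1" using test_function_bounded[OF \<phi>] by blast
    obtain C2 where C2: "C2 > 0" "\<And>x. \<bar>partial i \<phi> x\<bar> \<le> C2" using test_function_bounded[OF p\<phi>] by blast
    define C where "C = C1 + C2"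
    have C: "C > 0" "\<And>x. \<bar>\<phi> x\<bar> \<le> C" "\<And>x. \<bar>partial i \<phi> x\<bar> \<le> C"
      using C1 C2 by (auto simp: C_def intro: order_trans add_increasing add_increasing2)
    have [measurable]: "\<phi> \<in> borel_measurable lebesgue" "partial i \<phi> \<in> borel_measurable lebesgue"
      using test_function_measurable[OF \<phi>] test_function_measurable[OF p\<phi>]
      by (auto intro: measurable_completion)
    have iu: "integrable lebesgue (\<lambda>x. indicator B x * u x)"
      using u by (simp add: set_integrable_def)
    have ig: "integrable lebesgue (\<lambda>x. indicator B x *\<^sub>R g x)"
      using g by (simp add: set_integrable_def)
    have igi: "integrable lebesgue (\<lambda>x. indicator B x * g x $ i)"
      using integrable_bounded_linear[OF bounded_linear_vec_nth ig, of i] by simp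
    have iu\<phi>: "integrable lebesgue (\<lambda>x. partial i \<phi> x * (indicator B x * u x))"
      using integrable_bounded_mult[OF iu, of "partial i \<phi>" C] C by simp
    have ig\<phi>: "integrable lebesgue (\<lambda>x. \<phi> x * (indicator B x * g x $ i))"
      using integrable_bounded_mult[OF igi, of \<phi> C] C by simp
    let ?L = "(LINT x|lebesgue. partial i \<phi> x * (indicator B x * u x)) + (LINT x|lebesgue. \<phi> x * (indicator B x * g x $ i))"
    have "\<bar>?L\<bar> \<le> C * \<epsilon>" if "\<epsilon> > 0" for \<epsilon>
    proof -
      obtain \<psi> where \<psi>: "\<psi> \<in> test_functions B"
        and err: "(LINT x:B|lebesgue. \<bar>u x - \<psi> x\<bar>) + (LINT x:B|lebesgue. norm (g x - gradient \<psi> x)) < \<epsilon>"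
        using approx[OF \<open>\<epsilon> > 0\<close>] by blast
      have p\<psi>: "partial j \<psi> \<in> test_functions B" for j by (rule test_function_partial[OF \<psi>])
      have int: "integrable lebesgue \<theta>" if "\<theta> \<in> test_functions B" for \<theta>
        using test_function_integrable[OF that] test_function_measurable[OF that]
        by (subst integrable_completion) auto
      have ind: "indicator B x * \<theta> x = \<theta> x" if "\<theta> \<in> test_functions B" for \<theta> :: "real^'n \<Rightarrow> real" and x
        using test_function_zero_outside[OF that] by (auto simp: indicator_def)
      have i\<psi>1: "integrable lebesgue (\<lambda>x. \<psi> x * partial i \<phi> x)" "integrable lebesgue (\<lambda>x. partial i \<psi> x * \<phi> x)"
        using int[OF test_function_mult[OF p\<phi> test_function_smooth[OF \<psi>]]]
          int[OF test_function_mult[OF \<phi> test_function_smooth[OF p\<psi>]]] by auto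
      have parts: "(LINT x|lebesgue. \<psi> x * partial i \<phi> x) + (LINT x|lebesgue. partial i \<psi> x * \<phi> x) = 0"
        using integral_by_parts_test[OF \<phi> \<psi>, of i]
          test_function_measurable[OF \<phi>] test_function_measurable[OF p\<phi>]
          test_function_measurable[OF \<psi>] test_function_measurable[OF p\<psi>]
        by (subst (1 2) integral_completion) auto
      have i1: "integrable lebesgue (\<lambda>x. indicator B x * \<bar>u x - \<psi> x\<bar>)"
      proof -
        have "integrable lebesgue (\<lambda>x. \<bar>indicator B x * u x - \<psi> x\<bar>)"
          using iu int[OF \<psi>] by auto
        also have "(\<lambda>x. \<bar>indicator B x * u x - \<psi> x\<bar>) = (\<lambda>x. indicator B x * \<bar>u x - \<psi> x\<bar>)"
          using test_function_zero_outside[OF \<psi>] by (auto simp: fun_eq_iff indicator_def)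
        finally show ?thesis .
      qed
      have gz: "gradient \<psi> x = 0" if "x \<notin> B" for x
        using test_function_zero_outside[OF p\<psi> that] by (simp add: gradient_def vec_eq_iff)
      have ig\<psi>: "integrable lebesgue (gradient \<psi>)"
      proof -
        have "integrable lebesgue (\<lambda>x. \<Sum>j\<in>UNIV. partial j \<psi> x *\<^sub>R axis j 1)"
          using int[OF p\<psi>] by (intro Bochner_Integration.integrable_sum integrable_scaleR_left) auto
        also have "(\<lambda>x. \<Sum>j\<in>UNIV. partial j \<psi> x *\<^sub>R axis j 1) = gradient \<psi>"
          using basis_expansion[of "gradient \<psi> _"]
          by (auto simp: fun_eq_iff gradient_def scalar_mult_eq_scaleR)
        finally show ?thesis .
      qed
      have i2: "integrable lebesgue (\<lambda>x. indicator B x * norm (g x - gradient \<psi> x))"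
      proof -
        have "integrable lebesgue (\<lambda>x. norm (indicator B x *\<^sub>R g x - gradient \<psi> x))"
          using ig ig\<psi> by auto
        also have "(\<lambda>x. norm (indicator B x *\<^sub>R g x - gradient \<psi> x)) = (\<lambda>x. indicator B x * norm (g x - gradient \<psi> x))"
          using gz by (auto simp: fun_eq_iff indicator_def)
        finally show ?thesis .
      qed
      \<comment> \<open>Subtracting the vanishing expression for \<open>\<psi>\<close> leaves only
        the differences of u and \<psi> and of their gradients.\<close>
      have "?L = ?L - ((LINT x|lebesgue. \<psi> x * partial i \<phi> x) + (LINT x|lebesgue. partial i \<psi> x * \<phi> x))"
        using parts by simp
      also have "\<dots> = (LINT x|lebesgue. (partial i \<phi> x * (indicator B x * u x) - \<psi> x * partial i \<phi> x) +
          (\<phi> x * (indicator B x * g x $ i) - partial i \<psi> x * \<phi> x))" (is "_ = ?J")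
        using iu\<phi> ig\<phi> i\<psi>1 by simp
      finally have LJ: "?L = ?J" .
      have "norm ?J \<le> (LINT x|lebesgue. C * (indicator B x * \<bar>u x - \<psi> x\<bar>) + C * (indicator B x * norm (g x - gradient \<psi> x)))"
      proof (rule Bochner_Integration.integral_norm_bound_integral)
        fix x
        show "norm ((partial i \<phi> x * (indicator B x * u x) - \<psi> x * partial i \<phi> x) +
          (\<phi> x * (indicator B x * g x $ i) - partial i \<psi> x * \<phi> x)) \<le>
          C * (indicator B x * \<bar>u x - \<psi> x\<bar>) + C * (indicator B x * norm (g x - gradient \<psi> x))"
        proof (cases "x \<in> B")
          case True
          have "\<bar>g x $ i - partial i \<psi> x\<bar> \<le> norm (g x - gradient \<psi> x)"
            using component_le_norm_cart[of "g x - gradient \<psi> x" i] by (simp add: gradient_def)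
          then have 1: "\<bar>\<phi> x\<bar> * \<bar>g x $ i - partial i \<psi> x\<bar> \<le> C * norm (g x - gradient \<psi> x)"
            using C by (intro mult_mono) auto
          have 2: "\<bar>partial i \<phi> x\<bar> * \<bar>u x - \<psi> x\<bar> \<le> C * \<bar>u x - \<psi> x\<bar>"
            using C by (intro mult_right_mono) auto
          have "norm ((partial i \<phi> x * (indicator B x * u x) - \<psi> x * partial i \<phi> x) +
            (\<phi> x * (indicator B x * g x $ i) - partial i \<psi> x * \<phi> x)) =
            \<bar>partial i \<phi> x * (u x - \<psi> x) + \<phi> x * (g x $ i - partial i \<psi> x)\<bar>"
            using True by (simp add: algebra_simps)
          also have "\<dots> \<le> \<bar>partial i \<phi> x\<bar> * \<bar>u x - \<psi> x\<bar> + \<bar>\<phi> x\<bar> * \<bar>g x $ i - partial i \<psi> x\<bar>"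
            unfolding abs_mult[symmetric] by (rule abs_triangle_ineq)
          finally show ?thesis using 1 2 True by simp
        next
          case False
          then show ?thesis
            using test_function_zero_outside[OF \<psi> False] test_function_zero_outside[OF p\<psi> False] by simp
        qed
      qed (use iu\<phi> ig\<phi> i\<psi>1 i1 i2 in auto)
      also have "\<dots> = C * ((LINT x:B|lebesgue. \<bar>u x - \<psi> x\<bar>) + (LINT x:B|lebesgue. norm (g x - gradient \<psi> x)))"
        using i1 i2 by (simp add: set_lebesgue_integral_def distrib_left)
      also have "\<dots> \<le> C * \<epsilon>" using err C by (intro mult_left_mono) auto
      finally show ?thesis unfolding LJ by simp
    qed
    note L_bound = this
    have "\<bar>?L\<bar> \<le> 0"
    proof (rule field_le_epsilon)
      fix \<epsilon> :: real assume "\<epsilon> > 0"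
      then have "\<epsilon> / C > 0" using C by simp
      from L_bound[OF this] show "\<bar>?L\<bar> \<le> 0 + \<epsilon>" using C(1) by simp
    qed
    then have "?L = 0" by simp
    then show ?thesis
      by (simp add: set_lebesgue_integral_def mult_ac)
  qed
  moreover have "loc_integrable B u" "loc_integrable B g"
    using u g unfolding loc_integrable_def
    by (auto intro: set_integrable_subset simp: compact_imp_closed lmeasurable_compact fmeasurableD)
  ultimately show ?thesis
    unfolding W11_0_def weak_gradient_def using u g approx by blast
qed

section \<open>The truncation in weak monotonicity and its smooth approximations\<close>

abbreviation dflat :: "real \<Rightarrow> real \<Rightarrow> real" where
  "dflat \<delta> s \<equiv> (1 - real 0) * flat \<delta> (Suc 0) s + \<delta> * flat \<delta> (Suc (Suc 0)) s"

lemma flat_continuous: "\<delta> > 0 \<Longrightarrow> continuous_on UNIV (flat \<delta> j)"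
  by (meson DERIV_isCont continuous_at_imp_continuous_on flat_has_derivative)

lemma flat_approx:
  assumes "\<delta> > 0" shows "\<bar>flat \<delta> 0 s - max s 0\<bar> \<le> \<delta>"
proof (cases "s \<le> 0")
  case False
  have "1 - \<delta> / s \<le> exp (- \<delta> / s)" using exp_ge_add_one_self[of "- \<delta> / s"] by simp
  then have "s * (1 - exp (- \<delta> / s)) \<le> s * (\<delta> / s)" using False by (intro mult_left_mono) auto
  moreover have "exp (- \<delta> / s) \<le> 1" using assms False by simp
  ultimately show ?thesis using False by (simp add: flat_def algebra_simps)
qed (use assms in \<open>simp add: flat_def\<close>)

text \<open>For s > 0 the value is (1 + x) exp (-x) with x = \<delta>/s, at most 1 since 1 + x \<le>
  exp x. The factor \<open>1 - real 0\<close> is kept in \<open>dflat\<close> so that it is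
  literally the derivative supplied by \<open>flat_has_derivative\<close> at j = 0.\<close>

lemma dflat_bounds:
  assumes "\<delta> > 0" shows "0 \<le> dflat \<delta> s" "dflat \<delta> s \<le> 1"
proof -
  show "0 \<le> dflat \<delta> s" using assms by (simp add: flat_def)
  show "dflat \<delta> s \<le> 1"
  proof (cases "s \<le> 0")
    case False
    have "dflat \<delta> s = (1 + \<delta> / s) * exp (- (\<delta> / s))"
      using False by (simp add: flat_def field_simps)
    also have "\<dots> \<le> exp (\<delta> / s) * exp (- (\<delta> / s))"
      using exp_ge_add_one_self[of "\<delta> / s"] by (intro mult_right_mono) auto
    also have "\<dots> = 1" by (simp flip: exp_add)
    finally show ?thesis .
  qed (simp add: flat_def)
qed

lemma dflat_tendsto: "(\<lambda>k. dflat (1 / real (Suc k)) s) \<longlonglongrightarrow> (if s > 0 then 1 else 0)"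
proof (cases "s > 0")
  case True
  have "(\<lambda>k. (1 + (1 / real (Suc k)) / s) * exp (- ((1 / real (Suc k)) / s))) \<longlonglongrightarrow> (1 + 0 / s) * exp (- (0 / s))"
    by (intro tendsto_intros LIMSEQ_Suc[OF lim_1_over_n]) (use True in auto)
  moreover have "(1 + (1 / real (Suc k)) / s) * exp (- ((1 / real (Suc k)) / s)) = dflat (1 / real (Suc k)) s" for k
    using True by (simp add: flat_def field_simps)
  ultimately show ?thesis using True by simp
qed (simp add: flat_def)

definition smooth_trunc :: "real \<Rightarrow> real \<Rightarrow> real \<Rightarrow> real \<Rightarrow> real" where
  "smooth_trunc \<delta> m M s = 2 * flat \<delta> 0 (s - M) - 2 * flat \<delta> 0 (m - s)"

definition smooth_trunc' :: "real \<Rightarrow> real \<Rightarrow> real \<Rightarrow> real \<Rightarrow> real" where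
  "smooth_trunc' \<delta> m M s = 2 * dflat \<delta> (s - M) + 2 * dflat \<delta> (m - s)"

text \<open>The expression occurring in \<open>weakly_monotone\<close>. For m \<le> M it equals 2
  max (s - M) 0 - 2 max (m - s) 0, twice the signed amount by which s leaves [m, M].\<close>

definition trunc :: "real \<Rightarrow> real \<Rightarrow> real \<Rightarrow> real" where
  "trunc m M s = \<bar>M - s\<bar> - \<bar>s - m\<bar> + 2 * s - m - M"

text \<open>The derivative of \<open>trunc\<close> for m \<le> M away from the corners. At the
  corners it is 0, the limit of the smooth derivatives there, so that these converge at every
  point.\<close>

definition trunc' :: "real \<Rightarrow> real \<Rightarrow> real \<Rightarrow> real" where
  "trunc' m M s = 2 * (if s - M > 0 then 1 else 0) + 2 * (if m - s > 0 then 1 else 0)"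

lemma smooth_trunc_deriv:
  assumes "\<delta> > 0" shows "(smooth_trunc \<delta> m M has_real_derivative smooth_trunc' \<delta> m M s) (at s)"
proof -
  have 1: "((\<lambda>s. flat \<delta> 0 (s - M)) has_real_derivative dflat \<delta> (s - M) * 1) (at s)"
    by (rule DERIV_chain2[OF flat_has_derivative[OF assms]]) (auto intro!: derivative_eq_intros)
  have 2: "((\<lambda>s. flat \<delta> 0 (m - s)) has_real_derivative dflat \<delta> (m - s) * (- 1)) (at s)"
    by (rule DERIV_chain2[OF flat_has_derivative[OF assms]]) (auto intro!: derivative_eq_intros)
  show ?thesis unfolding smooth_trunc_def smooth_trunc'_def
    by (rule DERIV_cong[OF DERIV_diff[OF DERIV_cmult[OF 1] DERIV_cmult[OF 2]]]) simp
qed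

lemma smooth_trunc'_bounds:
  assumes "\<delta> > 0" shows "\<bar>smooth_trunc' \<delta> m M s\<bar> \<le> 4"
proof -
  have gen: "\<bar>2 * p + 2 * q\<bar> \<le> 4" if "0 \<le> p" "p \<le> 1" "0 \<le> q" "q \<le> 1" for p q :: real
    using that by linarith
  then show ?thesis unfolding smooth_trunc'_def by (intro gen dflat_bounds assms)
qed

lemma smooth_trunc_lipschitz:
  assumes "\<delta> > 0" shows "\<bar>smooth_trunc \<delta> m M s - smooth_trunc \<delta> m M r\<bar> \<le> 4 * \<bar>s - r\<bar>"
  using field_differentiable_bound[of UNIV "smooth_trunc \<delta> m M" "smooth_trunc' \<delta> m M" 4 s r]
    smooth_trunc_deriv[OF assms] smooth_trunc'_bounds[OF assms] by auto

lemma smooth_trunc'_continuous: "\<delta> > 0 \<Longrightarrow> continuous_on UNIV (smooth_trunc' \<delta> m M)"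
  unfolding smooth_trunc'_def
  by (intro continuous_intros continuous_on_compose2[OF flat_continuous]) auto

lemma smooth_trunc_approx:
  assumes "\<delta> > 0" "m \<le> M" shows "\<bar>trunc m M s - smooth_trunc \<delta> m M s\<bar> \<le> 4 * \<delta>"
proof -
  have "trunc m M s = 2 * max (s - M) 0 - 2 * max (m - s) 0" using assms(2)
    unfolding trunc_def max_def abs_if by auto
  moreover have "\<bar>2 * p' - 2 * q' - (2 * p - 2 * q)\<bar> \<le> 4 * d"
    if "\<bar>p - p'\<bar> \<le> d" "\<bar>q - q'\<bar> \<le> d" for p p' q q' d :: real
    using that by linarith
  ultimately show ?thesis
    using flat_approx[OF assms(1)] unfolding smooth_trunc_def by metis
qed

lemma smooth_trunc'_tendsto: "(\<lambda>k. smooth_trunc' (1 / real (Suc k)) m M s) \<longlonglongrightarrow> trunc' m M s"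
  unfolding smooth_trunc'_def trunc'_def by (intro tendsto_add tendsto_mult tendsto_const dflat_tendsto)

lemma trunc'_bounds: "\<bar>trunc' m M s\<bar> \<le> 4" by (auto simp: trunc'_def)

lemma smooth_smooth_trunc: "\<delta> > 0 \<Longrightarrow> smooth v \<Longrightarrow> smooth (\<lambda>x. smooth_trunc \<delta> m M (v x))"
  unfolding smooth_trunc_def
  by (intro smooth_diff smooth_mult smooth_const smooth_flat) auto

lemma smooth_trunc_inside: "m \<le> s \<Longrightarrow> s \<le> M \<Longrightarrow> smooth_trunc \<delta> m M s = 0"
  by (simp add: smooth_trunc_def flat_def)

text \<open>Near the sphere the truncation vanishes, so cutting it off there stays smooth.\<close>

lemma test_function_truncation:
  fixes v :: "real^'n::finite \<Rightarrow> real"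
  assumes sm: "smooth v" and "\<delta> > 0" and "t > 0" and bd: "\<And>x. dist a x = t \<Longrightarrow> m < v x \<and> v x < M"
  defines "\<phi> \<equiv> \<lambda>x. if x \<in> ball a t then smooth_trunc \<delta> m M (v x) else 0"
  shows "\<phi> \<in> test_functions (ball a t)"
    and "\<And>x. x \<in> ball a t \<Longrightarrow> gradient \<phi> x = smooth_trunc' \<delta> m M (v x) *\<^sub>R gradient v x"
proof -
  define N where "N = {x. m < v x \<and> v x < M}"
  have "open N" unfolding N_def
    using smooth_continuous[OF sm] by (intro open_Collect_conj open_Collect_less) auto
  have cover: "closure (ball a t) \<subseteq> ball a t \<union> N"
    using bd \<open>t > 0\<close> by (auto simp: N_def)
  have sm\<phi>: "smooth \<phi>" unfolding \<phi>_def
    using smooth_cut[OF open_ball \<open>open N\<close> cover smooth_smooth_trunc[OF \<open>\<delta> > 0\<close> sm]]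
    by (simp add: N_def smooth_trunc_inside)
  have "closure {x. \<phi> x \<noteq> 0} \<subseteq> cball a t \<inter> - N"
  proof (rule closure_minimal)
    show "{x. \<phi> x \<noteq> 0} \<subseteq> cball a t \<inter> - N"
      by (auto simp: \<phi>_def N_def smooth_trunc_inside)
    show "closed (cball a t \<inter> - N)" using \<open>open N\<close> by auto
  qed
  moreover have "cball a t \<inter> - N \<subseteq> ball a t" using cover \<open>t > 0\<close> by auto
  moreover have "compact (closure {x. \<phi> x \<noteq> 0})"
  proof -
    have "bounded (closure {x. \<phi> x \<noteq> 0})"
      using calculation(1) by (meson bounded_cball bounded_subset le_inf_iff)
    then show ?thesis by (simp add: compact_eq_bounded_closed)
  qed
  ultimately show "\<phi> \<in> test_functions (ball a t)" using sm\<phi> unfolding test_functions_def by blast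
  fix x assume x: "x \<in> ball a t"
  have "partial i \<phi> x = smooth_trunc' \<delta> m M (v x) * partial i v x" for i
  proof -
    have "partial i \<phi> x = partial i (\<lambda>x. smooth_trunc \<delta> m M (v x)) x"
      by (rule partial_cong_open[OF open_ball x]) (simp add: \<phi>_def)
    also have "\<dots> = smooth_trunc' \<delta> m M (v x) * partial i v x"
      by (rule partial_comp(1)[OF smooth_trunc_deriv[OF \<open>\<delta> > 0\<close>] smooth_differentiable[OF sm]])
    finally show ?thesis .
  qed
  then show "gradient \<phi> x = smooth_trunc' \<delta> m M (v x) *\<^sub>R gradient v x"
    by (simp add: gradient_def vec_eq_iff)
qed

text \<open>The fixed integrable \<open>V\<close> supplies the majorant for dominated convergence.
  This serves both when the smoothing parameter of the truncation tends to 0 and when the smooth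
  functions tend to u.\<close>

lemma multiplier_L1_limit:
  fixes V :: "real^'n::finite \<Rightarrow> 'b::euclidean_space"
  assumes V: "integrable N V" and [measurable]: "\<And>k. c k \<in> borel_measurable N" "d \<in> borel_measurable N"
    and bd: "\<And>k x. \<bar>c k x\<bar> \<le> C" "\<And>x. \<bar>d x\<bar> \<le> C"
    and lim: "AE x in N. (\<lambda>k. c k x) \<longlonglongrightarrow> d x"
  shows "integrable N (\<lambda>x. \<bar>d x - c k x\<bar> * norm (V x))"
    and "(\<lambda>k. \<integral>x. \<bar>d x - c k x\<bar> * norm (V x) \<partial>N) \<longlonglongrightarrow> 0"
proof -
  have b2: "\<bar>d x - c k x\<bar> \<le> 2 * C" for k x using bd(1)[of k x] bd(2)[of x] by linarith
  then have "integrable N (\<lambda>x. \<bar>d x - c k x\<bar> *\<^sub>R norm (V x))"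
    by (intro integrable_bounded_mult[of N "\<lambda>x. norm (V x)" _ "2 * C"] integrable_norm V) auto
  then show "integrable N (\<lambda>x. \<bar>d x - c k x\<bar> * norm (V x))" by simp
  have "(\<lambda>k. \<integral>x. \<bar>d x - c k x\<bar> * norm (V x) \<partial>N) \<longlonglongrightarrow> (\<integral>x. 0 \<partial>N)"
  proof (rule integral_dominated_convergence[where w = "\<lambda>x. 2 * C * norm (V x)"])
    show "AE x in N. (\<lambda>k. \<bar>d x - c k x\<bar> * norm (V x)) \<longlonglongrightarrow> 0"
      using lim
    proof eventually_elim
      case (elim x)
      then have "(\<lambda>k. \<bar>d x - c k x\<bar> * norm (V x)) \<longlonglongrightarrow> \<bar>d x - d x\<bar> * norm (V x)"
        by (intro tendsto_intros)
      then show ?case by simp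
    qed
    show "AE x in N. norm (\<bar>d x - c k x\<bar> * norm (V x)) \<le> 2 * C * norm (V x)" for k
      using b2 by (intro AE_I2) (simp add: mult_right_mono)
  qed (use V in auto)
  then show "(\<lambda>k. \<integral>x. \<bar>d x - c k x\<bar> * norm (V x) \<partial>N) \<longlonglongrightarrow> 0" by simp
qed

text \<open>Two limits are taken one after the other. As \<open>trunc'\<close> jumps at the levels,
  convergence of the smooth functions to u does not pass through it. So first the truncation is
  replaced by a smooth one with a fixed \<delta>, whose derivative is continuous, and only then are
  the smooth functions brought close to u.\<close>

lemma truncation_W11_0:
  fixes u :: "real^'n::finite \<Rightarrow> real"
  assumes t: "t > 0" and mM: "m \<le> M"
    and u: "u absolutely_integrable_on ball a t" and V: "V absolutely_integrable_on ball a t"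
    and approx: "\<And>\<epsilon>. \<epsilon> > 0 \<Longrightarrow> \<exists>v. smooth v \<and>
      (\<integral>\<^sup>+x. indicator (ball a t) x * ennreal \<bar>v x - u x\<bar> \<partial>lebesgue) \<le> ennreal \<epsilon> \<and>
      (\<integral>\<^sup>+x. indicator (ball a t) x * ennreal (norm (gradient v x - V x)) \<partial>lebesgue) \<le> ennreal \<epsilon> \<and>
      (\<forall>x. dist a x = t \<longrightarrow> m < v x \<and> v x < M)"
  shows "(\<lambda>x. trunc m M (u x)) \<in> W11_0 (ball a t)"
proof -
  let ?B = "ball a t"
  define N where "N = lebesgue_on ?B"
  have B: "?B \<in> sets lebesgue" "?B \<inter> space lebesgue \<in> sets lebesgue" by auto
  have fin: "finite_measure N"
    unfolding N_def
    by (rule finite_measureI)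
      (simp add: emeasure_restrict_space emeasure_completion measure_ball_pos(2)[OF t])
  interpret N: finite_measure N by (rule fin)
  have intN: "f absolutely_integrable_on ?B \<longleftrightarrow> integrable N f" for f :: "real^'n \<Rightarrow> 'c::euclidean_space"
    unfolding N_def set_integrable_def by (rule integrable_restrict_space[OF B(2), symmetric])
  have LINT_N: "(LINT x:?B|lebesgue. f x) = (\<integral>x. f x \<partial>N)" for f :: "real^'n \<Rightarrow> real"
    unfolding N_def set_lebesgue_integral_def by (rule integral_restrict_space[OF B(2), symmetric])
  have nnN: "(\<integral>\<^sup>+x. f x \<partial>N) = (\<integral>\<^sup>+x. indicator ?B x * f x \<partial>lebesgue)" for f
    unfolding N_def using B by (simp add: nn_integral_restrict_space mult.commute)
  have measN: "f \<in> borel_measurable N" if "f \<in> borel_measurable borel" for f :: "real^'n \<Rightarrow> 'c::euclidean_space"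
    unfolding N_def using that by (intro measurable_restrict_space1 measurable_completion) auto
  have iu: "integrable N u" and iV: "integrable N V" using u V intN by auto
  then have [measurable]: "u \<in> borel_measurable N" "V \<in> borel_measurable N" by auto
  have "\<forall>k. \<exists>v. smooth v \<and>
      (\<integral>\<^sup>+x. indicator ?B x * ennreal \<bar>v x - u x\<bar> \<partial>lebesgue) \<le> ennreal (1 / real (Suc k)) \<and>
      (\<integral>\<^sup>+x. indicator ?B x * ennreal (norm (gradient v x - V x)) \<partial>lebesgue) \<le> ennreal (1 / real (Suc k)) \<and>
      (\<forall>x. dist a x = t \<longrightarrow> m < v x \<and> v x < M)"
    by (intro allI approx) simp
  from choice[OF this] obtain v where sm: "\<And>k. smooth (v k)"
    and vu: "\<And>k. (\<integral>\<^sup>+x. ennreal \<bar>v k x - u x\<bar> \<partial>N) \<le> ennreal (1 / real (Suc k))"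
    and vV: "\<And>k. (\<integral>\<^sup>+x. ennreal (norm (gradient (v k) x - V x)) \<partial>N) \<le> ennreal (1 / real (Suc k))"
    and bd: "\<And>k x. dist a x = t \<Longrightarrow> m < v k x \<and> v k x < M"
    unfolding nnN by blast
  have [measurable]: "v k \<in> borel_measurable N" "gradient (v k) \<in> borel_measurable N" for k
    using sm by (auto intro!: measN smooth_measurable gradient_measurable)
  have ivu: "integrable N (\<lambda>x. v k x - u x)" for k
    using vu[of k] by (intro integrableI_bounded) (auto intro: order_le_less_trans)
  have ivV: "integrable N (\<lambda>x. gradient (v k) x - V x)" for k
    using vV[of k] by (intro integrableI_bounded) (auto intro: order_le_less_trans)
  have vu': "(\<integral>x. norm (v k x - u x) \<partial>N) \<le> 1 / real (Suc k)" for k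
    using vu[of k] ivu[of k] by (subst (asm) nn_integral_eq_integral) auto
  have vV': "(\<integral>x. norm (gradient (v k) x - V x) \<partial>N) \<le> 1 / real (Suc k)" for k
    using vV[of k] ivV[of k] by (subst (asm) nn_integral_eq_integral) auto
  have lim1: "(\<lambda>k. 1 / real (Suc k)) \<longlonglongrightarrow> 0" by (rule LIMSEQ_Suc[OF lim_1_over_n])
  have Lu: "(\<lambda>k. \<integral>x. norm (v k x - u x) \<partial>N) \<longlonglongrightarrow> 0"
    by (rule tendsto_sandwich[OF _ _ tendsto_const lim1]) (use vu' in auto)
  have LV: "(\<lambda>k. \<integral>x. norm (gradient (v k) x - V x) \<partial>N) \<longlonglongrightarrow> 0"
    by (rule tendsto_sandwich[OF _ _ tendsto_const lim1]) (use vV' in auto)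
  \<comment> \<open>L1 convergence gives convergence almost everywhere only along a subsequence, and
    the multipliers below need the latter.\<close>
  obtain r where r: "strict_mono r" "AE x in N. (\<lambda>k. v (r k) x - u x) \<longlonglongrightarrow> 0"
    using tendsto_L1_AE_subseq[OF ivu Lu] by blast
  define S where "S k = v (r k)" for k
  have smS: "smooth (S k)" for k by (simp add: S_def sm)
  have [measurable]: "S k \<in> borel_measurable N" "gradient (S k) \<in> borel_measurable N" for k
    by (simp_all add: S_def)
  have iSu: "integrable N (\<lambda>x. S k x - u x)" and iSV: "integrable N (\<lambda>x. gradient (S k) x - V x)" for k
    by (simp_all add: S_def ivu ivV)
  have SLu: "(\<lambda>k. \<integral>x. norm (S k x - u x) \<partial>N) \<longlonglongrightarrow> 0"
    using LIMSEQ_subseq_LIMSEQ[OF Lu r(1)] by (simp add: S_def o_def)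
  have SLV: "(\<lambda>k. \<integral>x. norm (gradient (S k) x - V x) \<partial>N) \<longlonglongrightarrow> 0"
    using LIMSEQ_subseq_LIMSEQ[OF LV r(1)] by (simp add: S_def o_def)
  have AES: "AE x in N. (\<lambda>k. S k x) \<longlonglongrightarrow> u x"
    using r(2) by eventually_elim (simp add: S_def LIM_zero_iff)
  let ?T' = "\<lambda>\<delta>. smooth_trunc' \<delta> m M"
  let ?D = "\<lambda>\<delta> k x. \<bar>?T' \<delta> (u x) - ?T' \<delta> (S k x)\<bar>"
  let ?E2 = "\<lambda>\<delta> k x. ?T' \<delta> (u x) *\<^sub>R V x - ?T' \<delta> (S k x) *\<^sub>R gradient (S k) x"
  have T'm [measurable]: "?T' \<delta> \<in> borel_measurable borel" if "\<delta> > 0" for \<delta>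
    by (rule borel_measurable_continuous_onI[OF smooth_trunc'_continuous[OF that]])
  have trm [measurable]: "trunc' m M \<in> borel_measurable borel" unfolding trunc'_def by measurable
  define gw where "gw x = trunc' m M (u x) *\<^sub>R V x" for x
  let ?E1 = "\<lambda>K x. gw x - ?T' (1 / real (Suc K)) (u x) *\<^sub>R V x"
  have iw: "integrable N (\<lambda>x. trunc m M (u x))" unfolding trunc_def using iu by auto
  have igw: "integrable N gw"
    unfolding gw_def by (rule integrable_bounded_mult[OF iV _ trunc'_bounds]) measurable
  have i\<delta>u: "integrable N (\<lambda>x. ?T' \<delta> (u x) *\<^sub>R V x)" if "\<delta> > 0" for \<delta>
    using that by (intro integrable_bounded_mult[OF iV _ smooth_trunc'_bounds[OF that]]) measurable
  have L1: "(\<lambda>K. \<integral>x. norm (?E1 K x) \<partial>N) \<longlonglongrightarrow> 0"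
  proof -
    have "norm (?E1 K x) = \<bar>trunc' m M (u x) - ?T' (1 / real (Suc K)) (u x)\<bar> * norm (V x)" for K x
      by (simp add: gw_def flip: scaleR_diff_left)
    moreover have "?T' (1 / real (Suc K)) \<in> borel_measurable borel" for K by (rule T'm) simp
    ultimately show ?thesis
      using multiplier_L1_limit(2)[OF iV, of "\<lambda>K x. ?T' (1 / real (Suc K)) (u x)" "\<lambda>x. trunc' m M (u x)" 4]
        smooth_trunc'_bounds trunc'_bounds smooth_trunc'_tendsto by simp
  qed
  have L2: "(\<lambda>k. \<integral>x. norm (?E2 \<delta> k x) \<partial>N) \<longlonglongrightarrow> 0"
    and iL2: "integrable N (\<lambda>x. ?T' \<delta> (S k x) *\<^sub>R gradient (S k) x)" if "\<delta> > 0" for \<delta> k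
  proof -
    have [measurable]: "?T' \<delta> \<in> borel_measurable borel" using that by (rule T'm)
    have iS: "integrable N (gradient (S k))" for k
      using Bochner_Integration.integrable_add[OF iSV[of k] iV] by simp
    have iTS: "integrable N (\<lambda>x. ?T' \<delta> (S k x) *\<^sub>R gradient (S k) x)" for k
      by (intro integrable_bounded_mult[OF iS _ smooth_trunc'_bounds[OF that]]) measurable
    then show "integrable N (\<lambda>x. ?T' \<delta> (S k x) *\<^sub>R gradient (S k) x)" .
    have "AE x in N. (\<lambda>k. ?T' \<delta> (S k x)) \<longlonglongrightarrow> ?T' \<delta> (u x)"
      using AES
    proof eventually_elim
      case (elim x)
      have "isCont (?T' \<delta>) (u x)"
        using smooth_trunc'_continuous[OF that] by (simp add: continuous_on_eq_continuous_at)
      then show ?case using elim by (rule isCont_tendsto_compose)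
    qed
    then have iD: "integrable N (\<lambda>x. ?D \<delta> k x * norm (V x))"
      and "(\<lambda>k. \<integral>x. ?D \<delta> k x * norm (V x) \<partial>N) \<longlonglongrightarrow> 0" for k
      using multiplier_L1_limit[OF iV, of "\<lambda>k x. ?T' \<delta> (S k x)" "\<lambda>x. ?T' \<delta> (u x)" 4]
        smooth_trunc'_bounds[OF that] by auto
    then have "(\<lambda>k. (\<integral>x. ?D \<delta> k x * norm (V x) \<partial>N) + 4 * (\<integral>x. norm (gradient (S k) x - V x) \<partial>N)) \<longlonglongrightarrow> 0 + 4 * 0"
      by (intro tendsto_add tendsto_mult tendsto_const SLV) simp
    then have lim: "(\<lambda>k. (\<integral>x. ?D \<delta> k x * norm (V x) \<partial>N) + 4 * (\<integral>x. norm (gradient (S k) x - V x) \<partial>N)) \<longlonglongrightarrow> 0"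
      by simp
    have le: "(\<integral>x. norm (?E2 \<delta> k x) \<partial>N) \<le>
       (\<integral>x. ?D \<delta> k x * norm (V x) \<partial>N) + 4 * (\<integral>x. norm (gradient (S k) x - V x) \<partial>N)" for k
    proof -
      have "(\<integral>x. norm (?E2 \<delta> k x) \<partial>N) \<le>
        (\<integral>x. ?D \<delta> k x * norm (V x) + 4 * norm (gradient (S k) x - V x) \<partial>N)"
      proof (rule integral_mono)
        show "integrable N (\<lambda>x. norm (?E2 \<delta> k x))"
          using i\<delta>u[OF that] iTS by auto
        show "integrable N (\<lambda>x. ?D \<delta> k x * norm (V x) + 4 * norm (gradient (S k) x - V x))"
          using iD iSV by auto
        fix x
        \<comment> \<open>A multiplier error acting on the fixed \<open>V\<close>, and a bounded
          multiplier acting on the error of the gradient.\<close>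
        have "?E2 \<delta> k x =
          (?T' \<delta> (u x) - ?T' \<delta> (S k x)) *\<^sub>R V x - ?T' \<delta> (S k x) *\<^sub>R (gradient (S k) x - V x)"
          by (simp add: algebra_simps)
        then have "norm (?E2 \<delta> k x) \<le>
          norm ((?T' \<delta> (u x) - ?T' \<delta> (S k x)) *\<^sub>R V x) + norm (?T' \<delta> (S k x) *\<^sub>R (gradient (S k) x - V x))"
          using norm_triangle_ineq4 by metis
        also have "\<dots> \<le> ?D \<delta> k x * norm (V x) + 4 * norm (gradient (S k) x - V x)"
          unfolding norm_scaleR by (intro add_mono mult_right_mono smooth_trunc'_bounds[OF that]) auto
        finally show "norm (?E2 \<delta> k x) \<le>
          ?D \<delta> k x * norm (V x) + 4 * norm (gradient (S k) x - V x)" .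
      qed
      then show ?thesis using iD[of k] iSV[of k] by simp
    qed
    show "(\<lambda>k. \<integral>x. norm (?E2 \<delta> k x) \<partial>N) \<longlonglongrightarrow> 0"
      by (rule tendsto_sandwich[OF _ _ tendsto_const lim]) (use le in auto)
  qed
  show ?thesis
  proof (rule W11_0I)
    show "?B \<in> sets lebesgue" by (rule B)
    show "(\<lambda>x. trunc m M (u x)) absolutely_integrable_on ?B" using iw intN by blast
    show "gw absolutely_integrable_on ?B" using igw intN by blast
    fix \<epsilon> :: real assume "\<epsilon> > 0"
    then have e2: "\<epsilon> / 2 > 0" by simp
    have "(\<lambda>K. 4 * (1 / real (Suc K)) * measure N (space N) + (\<integral>x. norm (?E1 K x) \<partial>N)) \<longlonglongrightarrow> 4 * 0 * measure N (space N) + 0"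
      by (intro tendsto_add tendsto_mult tendsto_const lim1 L1)
    then have "eventually (\<lambda>K. 4 * (1 / real (Suc K)) * measure N (space N) + (\<integral>x. norm (?E1 K x) \<partial>N) < \<epsilon> / 2) sequentially"
      by (rule order_tendstoD(2)) (use e2 in simp)
    then obtain K where K: "4 * (1 / real (Suc K)) * measure N (space N) + (\<integral>x. norm (?E1 K x) \<partial>N) < \<epsilon> / 2"
      using eventually_happens trivial_limit_sequentially by blast
    define \<delta> where "\<delta> = 1 / real (Suc K)"
    have \<delta>: "\<delta> > 0" by (simp add: \<delta>_def)
    have "(\<lambda>k. 4 * (\<integral>x. norm (S k x - u x) \<partial>N) + (\<integral>x. norm (?E2 \<delta> k x) \<partial>N)) \<longlonglongrightarrow> 4 * 0 + 0"
      by (intro tendsto_add tendsto_mult tendsto_const SLu L2[OF \<delta>])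
    then have "eventually (\<lambda>k. 4 * (\<integral>x. norm (S k x - u x) \<partial>N) + (\<integral>x. norm (?E2 \<delta> k x) \<partial>N) < \<epsilon> / 2) sequentially"
      by (rule order_tendstoD(2)) (use e2 in simp)
    then obtain k where k: "4 * (\<integral>x. norm (S k x - u x) \<partial>N) + (\<integral>x. norm (?E2 \<delta> k x) \<partial>N) < \<epsilon> / 2"
      using eventually_happens trivial_limit_sequentially by blast
    define \<phi> where "\<phi> = (\<lambda>x. if x \<in> ?B then smooth_trunc \<delta> m M (S k x) else 0)"
    have bdS: "\<And>x. dist a x = t \<Longrightarrow> m < S k x \<and> S k x < M" using bd by (simp add: S_def)
    have \<phi>: "\<phi> \<in> test_functions ?B"
      and g\<phi>: "\<And>x. x \<in> ?B \<Longrightarrow> gradient \<phi> x = ?T' \<delta> (S k x) *\<^sub>R gradient (S k) x"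
      unfolding \<phi>_def
      using test_function_truncation[OF smS \<delta> t bdS] by auto
    have spN: "space N = ?B" by (simp add: N_def)
    have "(\<integral>x. \<bar>trunc m M (u x) - \<phi> x\<bar> \<partial>N) \<le> (\<integral>x. 4 * \<delta> + 4 * norm (S k x - u x) \<partial>N)"
    proof (rule integral_mono')
      show "integrable N (\<lambda>x. 4 * \<delta> + 4 * norm (S k x - u x))" using iSu by auto
      fix x assume "x \<in> space N"
      then have "\<phi> x = smooth_trunc \<delta> m M (S k x)" by (simp add: \<phi>_def spN)
      then show "\<bar>trunc m M (u x) - \<phi> x\<bar> \<le> 4 * \<delta> + 4 * norm (S k x - u x)"
        using smooth_trunc_approx[OF \<delta> mM, of "u x"] smooth_trunc_lipschitz[OF \<delta>, of m M "u x" "S k x"]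
          abs_triangle_ineq[of "trunc m M (u x) - smooth_trunc \<delta> m M (u x)"
            "smooth_trunc \<delta> m M (u x) - smooth_trunc \<delta> m M (S k x)"]
        by (simp add: abs_minus_commute)
    qed (use \<delta> in auto)
    also have "\<dots> = 4 * \<delta> * measure N (space N) + 4 * (\<integral>x. norm (S k x - u x) \<partial>N)"
      using iSu[of k] by simp
    finally have e1: "(\<integral>x. \<bar>trunc m M (u x) - \<phi> x\<bar> \<partial>N) \<le> 4 * \<delta> * measure N (space N) + 4 * (\<integral>x. norm (S k x - u x) \<partial>N)" .
    have "(\<integral>x. norm (gw x - gradient \<phi> x) \<partial>N) \<le>
      (\<integral>x. norm (gw x - ?T' \<delta> (u x) *\<^sub>R V x) + norm (?E2 \<delta> k x) \<partial>N)"
    proof (rule integral_mono')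
      show "integrable N (\<lambda>x. norm (gw x - ?T' \<delta> (u x) *\<^sub>R V x) + norm (?E2 \<delta> k x))"
        using igw i\<delta>u[OF \<delta>] iL2[OF \<delta>] by auto
      fix x assume "x \<in> space N"
      then have "gradient \<phi> x = ?T' \<delta> (S k x) *\<^sub>R gradient (S k) x" using g\<phi> by (simp add: spN)
      then show "norm (gw x - gradient \<phi> x) \<le> norm (gw x - ?T' \<delta> (u x) *\<^sub>R V x) + norm (?E2 \<delta> k x)"
        using norm_triangle_ineq[of "gw x - ?T' \<delta> (u x) *\<^sub>R V x" "?E2 \<delta> k x"] by simp
    qed auto
    also have "\<dots> = (\<integral>x. norm (gw x - ?T' \<delta> (u x) *\<^sub>R V x) \<partial>N) + (\<integral>x. norm (?E2 \<delta> k x) \<partial>N)"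
      using igw i\<delta>u[OF \<delta>] iL2[OF \<delta>, of k] by simp
    finally have e2: "(\<integral>x. norm (gw x - gradient \<phi> x) \<partial>N) \<le> (\<integral>x. norm (?E1 K x) \<partial>N) + (\<integral>x. norm (?E2 \<delta> k x) \<partial>N)"
      unfolding \<delta>_def .
    have "(\<integral>x. \<bar>trunc m M (u x) - \<phi> x\<bar> \<partial>N) + (\<integral>x. norm (gw x - gradient \<phi> x) \<partial>N) < \<epsilon>"
      using e1 e2 K k unfolding \<delta>_def by linarith
    then show "\<exists>\<phi>\<in>test_functions ?B. (LINT x:?B|lebesgue. \<bar>trunc m M (u x) - \<phi> x\<bar>) +
       (LINT x:?B|lebesgue. norm (gw x - gradient \<phi> x)) < \<epsilon>"
      by (intro bexI[OF _ \<phi>]) (simp add: LINT_N)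
  qed
qed

section \<open>Oscillation of weakly monotone functions\<close>

lemma borel_version:
  fixes u :: "real^'n::finite \<Rightarrow> real"
  assumes "integrable lebesgue u"
  obtains U where "integrable lborel U" "AE x in lebesgue. u x = U x"
proof -
  obtain U where U: "U \<in> borel_measurable lborel" "AE x in lborel. u x = U x"
    using completion_ex_borel_measurable_real[OF borel_measurable_integrable[OF assms]] by blast
  have AE: "AE x in lebesgue. u x = U x" by (rule AE_completion[OF U(2)])
  have "integrable lebesgue U"
    using assms AE U(1) by (subst integrable_cong_AE[of _ _ u]) (auto intro: measurable_completion)
  then have "integrable lborel U" using U(1) integrable_completion by blast
  then show thesis using that AE by blast
qed

text \<open>The approximants of \<open>good_sphere\<close> lie strictly between b - X and b + X on a
  sphere of radius t > R/2, and strictness lets their truncations vanish near that sphere. Hence the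
  truncation of u is in \<open>W11_0\<close> of the ball of radius t, which contains the ball of
  radius R/2.\<close>

lemma weakly_monotone_oscillation:
  fixes u :: "real^'n::finite \<Rightarrow> real"
  assumes wm: "weakly_monotone \<Omega> u" and wg: "weak_gradient \<Omega> u V"
    and sub: "cball a (2 * R) \<subseteq> \<Omega>" and R: "R > 0"
    and \<tau>m: "\<tau> \<in> borel_measurable borel" and \<tau>: "\<And>s. \<tau> s \<ge> 0"
    and A: "(\<integral>\<^sup>+s. indicator {0<..<1} s * ennreal (\<tau> s) \<partial>lborel) \<le> ennreal A" "A \<ge> 0"
    and E: "(\<integral>\<^sup>+z. indicator (ball a (2 * R)) z * excess CARD('n) \<tau> (norm (V z)) \<partial>lebesgue) \<le> ennreal e" "e \<ge> 0"
    and X: "X > 2 * R * A + 16 * R * e / measure lborel (ball a R)"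
  shows "\<exists>b. AE x in lebesgue. x \<in> ball a (R / 2) \<longrightarrow> \<bar>u x - b\<bar> \<le> X"
proof -
  let ?K = "cball a (2 * R)"
  have uK: "u absolutely_integrable_on ?K" and VK: "V absolutely_integrable_on ?K"
    using wg sub unfolding weak_gradient_def loc_integrable_def by auto
  have iu: "integrable lebesgue (\<lambda>x. indicator ?K x * u x)"
    using uK by (simp add: set_integrable_def)
  have iV: "integrable lebesgue (\<lambda>x. indicator ?K x *\<^sub>R V x)"
    using VK by (simp add: set_integrable_def)
  have iVi: "integrable lebesgue (\<lambda>x. indicator ?K x * V x $ i)" for i
    using integrable_bounded_linear[OF bounded_linear_vec_nth iV, of i] by simp
  \<comment> \<open>Convolution and Tonelli are set over \<open>lborel\<close>, so u and V, cut off
    outside the closed ball, are replaced by Borel functions that agree with them almost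
    everywhere.\<close>
  obtain U where U: "integrable lborel U" "AE x in lebesgue. indicator ?K x * u x = U x"
    using borel_version[OF iu] .
  have "\<forall>i. \<exists>G. integrable lborel G \<and> (AE x in lebesgue. indicator ?K x * V x $ i = G x)"
    using borel_version[OF iVi] by blast
  from choice[OF this] obtain G where G: "\<And>i. integrable lborel (G i)" "\<And>i. AE x in lebesgue. indicator ?K x * V x $ i = G i x"
    by blast
  define W where "W x = (\<chi> i. G i x)" for x
  have W: "integrable lborel W"
  proof -
    have "integrable lborel (\<lambda>x. \<Sum>i\<in>UNIV. G i x *\<^sub>R axis i 1)"
      using G(1) by (intro Bochner_Integration.integrable_sum integrable_scaleR_left) auto
    also have "(\<lambda>x. \<Sum>i\<in>UNIV. G i x *\<^sub>R axis i 1) = W"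
      using basis_expansion[of "W _"] by (auto simp: fun_eq_iff W_def scalar_mult_eq_scaleR)
    finally show ?thesis .
  qed
  have [measurable]: "U \<in> borel_measurable borel" "W \<in> borel_measurable borel" "\<And>i. G i \<in> borel_measurable borel"
    using U(1) W G(1) by (auto dest: borel_measurable_integrable)
  have AE_W: "AE x in lebesgue. x \<in> ?K \<longrightarrow> V x = W x"
  proof -
    have "AE x in lebesgue. \<forall>i. indicator ?K x * V x $ i = G i x"
      using G(2) by (simp add: AE_all_countable)
    then show ?thesis by eventually_elim (auto simp: W_def vec_eq_iff)
  qed
  have AE_U: "AE x in lebesgue. x \<in> ?K \<longrightarrow> u x = U x"
    using U(2) by eventually_elim auto
  have weak: "(\<integral>y. U y * partial i \<phi> y \<partial>lborel) = - (\<integral>y. W y $ i * \<phi> y \<partial>lborel)"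
    if \<phi>: "\<phi> \<in> test_functions (ball a (2 * R))" for \<phi> i
  proof -
    have \<phi>\<Omega>: "\<phi> \<in> test_functions \<Omega>"
      using \<phi> sub ball_subset_cball test_function_mono by blast
    have p\<phi>: "partial i \<phi> \<in> test_functions (ball a (2 * R))" by (rule test_function_partial[OF \<phi>])
    have mb: "\<phi> \<in> borel_measurable borel" "partial i \<phi> \<in> borel_measurable borel"
      using test_function_measurable[OF \<phi>] test_function_measurable[OF p\<phi>] .
    then have [measurable]: "\<phi> \<in> borel_measurable lebesgue" "partial i \<phi> \<in> borel_measurable lebesgue"
      by (auto intro: measurable_completion)
    have [measurable]: "(\<lambda>x. indicator ?K x * u x) \<in> borel_measurable lebesgue"
      "(\<lambda>x. indicator ?K x * V x $ i) \<in> borel_measurable lebesgue"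
      using iu iVi[of i] by (auto dest: borel_measurable_integrable)
    have [measurable]: "U \<in> borel_measurable lebesgue" "G i \<in> borel_measurable lebesgue"
      by (auto intro: measurable_completion)
    \<comment> \<open>A test function of the open ball vanishes outside it and does not notice the
      cut-off.\<close>
    have ind: "indicator \<Omega> x * (w * \<theta> x) = (indicator ?K x * w) * \<theta> x"
      if "\<theta> \<in> test_functions (ball a (2 * R))" for \<theta> :: "real^'n \<Rightarrow> real" and w x
    proof (cases "x \<in> ball a (2 * R)")
      case True
      then have "x \<in> ?K" by simp
      moreover from this have "x \<in> \<Omega>" using sub by blast
      ultimately show ?thesis by simp
    qed (simp add: test_function_zero_outside[OF that])
    have "(LINT x:\<Omega>|lebesgue. u x * partial i \<phi> x) = (\<integral>x. (indicator ?K x * u x) * partial i \<phi> x \<partial>lebesgue)"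
      unfolding set_lebesgue_integral_def by (simp only: ind[OF p\<phi>] real_scaleR_def)
    also have "\<dots> = (\<integral>x. U x * partial i \<phi> x \<partial>lebesgue)"
      using U(2) by (intro integral_cong_AE) (measurable, auto)
    also have "\<dots> = (\<integral>x. U x * partial i \<phi> x \<partial>lborel)"
      using mb borel_measurable_integrable[OF U(1)] by (intro integral_completion borel_measurable_times) simp_all
    finally have 1: "(LINT x:\<Omega>|lebesgue. u x * partial i \<phi> x) = (\<integral>x. U x * partial i \<phi> x \<partial>lborel)" .
    have "(LINT x:\<Omega>|lebesgue. V x $ i * \<phi> x) = (\<integral>x. (indicator ?K x * V x $ i) * \<phi> x \<partial>lebesgue)"
      unfolding set_lebesgue_integral_def by (simp only: ind[OF \<phi>] real_scaleR_def)
    also have "\<dots> = (\<integral>x. G i x * \<phi> x \<partial>lebesgue)"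
      using G(2)[of i] by (intro integral_cong_AE) (measurable, auto)
    also have "\<dots> = (\<integral>x. G i x * \<phi> x \<partial>lborel)"
      using mb borel_measurable_integrable[OF G(1)] by (intro integral_completion borel_measurable_times) simp_all
    finally have 2: "(LINT x:\<Omega>|lebesgue. V x $ i * \<phi> x) = (\<integral>x. W x $ i * \<phi> x \<partial>lborel)"
      by (simp add: W_def)
    show ?thesis using wg \<phi>\<Omega> unfolding weak_gradient_def 1[symmetric] 2[symmetric] by blast
  qed
  have "(\<integral>\<^sup>+z. indicator (ball a (2 * R)) z * excess CARD('n) \<tau> (norm (W z)) \<partial>lborel) =
     (\<integral>\<^sup>+z. indicator (ball a (2 * R)) z * excess CARD('n) \<tau> (norm (W z)) \<partial>lebesgue)"
    by (simp add: nn_integral_completion)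
  also have "\<dots> = (\<integral>\<^sup>+z. indicator (ball a (2 * R)) z * excess CARD('n) \<tau> (norm (V z)) \<partial>lebesgue)"
    using AE_W by (intro nn_integral_cong_AE) (auto elim!: eventually_mono simp: indicator_def)
  also have "\<dots> \<le> ennreal e" by (rule E)
  finally have EW: "(\<integral>\<^sup>+z. indicator (ball a (2 * R)) z * excess CARD('n) \<tau> (norm (W z)) \<partial>lborel) \<le> ennreal e" .
  obtain b t where t: "R / 2 < t" "t < R" and ap: "\<And>\<epsilon>. \<epsilon> > 0 \<Longrightarrow> \<exists>v. smooth v \<and>
      (\<integral>\<^sup>+x. ennreal \<bar>v x - U x\<bar> \<partial>lborel) \<le> ennreal \<epsilon> \<and>
      (\<integral>\<^sup>+x. indicator (ball a R) x * ennreal (norm (gradient v x - W x)) \<partial>lborel) \<le> ennreal \<epsilon> \<and>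
      (\<forall>x. dist a x = t \<longrightarrow> \<bar>v x - b\<bar> < X)"
    using good_sphere[OF U(1) W weak R \<tau>m \<tau> A EW E(2) X] by blast
  have "2 * R * A + 16 * R * e / measure lborel (ball a R) \<ge> 0"
    using R A(2) E(2) by simp
  then have X0: "X > 0" using X by linarith
  have ballK: "ball a t \<subseteq> ?K" "ball a t \<subseteq> ball a R" using t R by auto
  have "(\<lambda>x. trunc (b - X) (b + X) (u x)) \<in> W11_0 (ball a t)"
  proof (rule truncation_W11_0)
    show "u absolutely_integrable_on ball a t" "V absolutely_integrable_on ball a t"
      using uK VK ballK by (auto intro: set_integrable_subset)
    fix \<epsilon> :: real assume "\<epsilon> > 0"
    from ap[OF this] obtain v where v: "smooth v"
      "(\<integral>\<^sup>+x. ennreal \<bar>v x - U x\<bar> \<partial>lborel) \<le> ennreal \<epsilon>"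
      "(\<integral>\<^sup>+x. indicator (ball a R) x * ennreal (norm (gradient v x - W x)) \<partial>lborel) \<le> ennreal \<epsilon>"
      "\<And>x. dist a x = t \<Longrightarrow> \<bar>v x - b\<bar> < X" by blast
    have "(\<integral>\<^sup>+x. indicator (ball a t) x * ennreal \<bar>v x - u x\<bar> \<partial>lebesgue) \<le> (\<integral>\<^sup>+x. ennreal \<bar>v x - U x\<bar> \<partial>lebesgue)"
      using AE_U ballK by (intro nn_integral_mono_AE) (auto elim!: eventually_mono simp: indicator_def)
    also have "\<dots> \<le> ennreal \<epsilon>" using v(2) by (simp add: nn_integral_completion)
    finally have 1: "(\<integral>\<^sup>+x. indicator (ball a t) x * ennreal \<bar>v x - u x\<bar> \<partial>lebesgue) \<le> ennreal \<epsilon>" .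
    have "(\<integral>\<^sup>+x. indicator (ball a t) x * ennreal (norm (gradient v x - V x)) \<partial>lebesgue) \<le>
       (\<integral>\<^sup>+x. indicator (ball a R) x * ennreal (norm (gradient v x - W x)) \<partial>lebesgue)"
      using AE_W ballK by (intro nn_integral_mono_AE) (auto elim!: eventually_mono simp: indicator_def)
    also have "\<dots> \<le> ennreal \<epsilon>" using v(3) by (simp add: nn_integral_completion)
    finally have 2: "(\<integral>\<^sup>+x. indicator (ball a t) x * ennreal (norm (gradient v x - V x)) \<partial>lebesgue) \<le> ennreal \<epsilon>" .
    have 3: "b - X < v x \<and> v x < b + X" if "dist a x = t" for x using v(4)[OF that] by linarith
    show "\<exists>v. smooth v \<and>
      (\<integral>\<^sup>+x. indicator (ball a t) x * ennreal \<bar>v x - u x\<bar> \<partial>lebesgue) \<le> ennreal \<epsilon> \<and>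
      (\<integral>\<^sup>+x. indicator (ball a t) x * ennreal (norm (gradient v x - V x)) \<partial>lebesgue) \<le> ennreal \<epsilon> \<and>
      (\<forall>x. dist a x = t \<longrightarrow> b - X < v x \<and> v x < b + X)"
      using v(1) 1 2 3 by blast
  qed (use t R X0 in auto)
  moreover have "t > 0" "cball a t \<subseteq> \<Omega>" using t R sub by (auto intro: order_trans[OF subset_cball])
  moreover have "b - X \<le> b + X" using X0 by simp
  ultimately have "AE x in lebesgue_on (ball a t). b - X \<le> u x \<and> u x \<le> b + X"
    using wm unfolding weakly_monotone_def trunc_def by blast
  then have "AE x in lebesgue. x \<in> ball a t \<longrightarrow> b - X \<le> u x \<and> u x \<le> b + X"
    by (rule AE_restrict_space_iff[THEN iffD1, rotated]) simp
  then have "AE x in lebesgue. x \<in> ball a (R / 2) \<longrightarrow> \<bar>u x - b\<bar> \<le> X"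
    by (rule eventually_mono) (use t(1) in auto)
  then show ?thesis by blast
qed

section \<open>Continuous representatives\<close>

lemma AE_dense:
  fixes c :: "'a::euclidean_space"
  assumes "AE x in lebesgue. P x" "r > 0"
  obtains x where "x \<in> ball c r" "P x"
proof (rule ccontr)
  assume "\<not> thesis"
  then have *: "\<And>x. x \<in> ball c r \<Longrightarrow> \<not> P x" using that by blast
  have "AE x in lebesgue. x \<notin> ball c r" using assms(1) by (rule eventually_mono) (use * in blast)
  then have "ball c r \<in> null_sets lebesgue"
    by (subst (asm) AE_iff_null_sets[symmetric]) auto
  then have "negligible (ball c r)" by (simp add: negligible_iff_null_sets)
  then show False using assms(2) by (simp add: open_not_negligible)
qed

text \<open>The exceptional null set depends on the ball, and uncountably many balls occur. For each
  n Lindelof's theorem leaves countably many open sets on which u is within 1/(n+1) of a constant,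
  so all these bounds hold off a single null set. The remaining points are dense, and
  \<open>g\<close> is the limit of u along them.\<close>

lemma continuous_representative:
  fixes u :: "'a::euclidean_space \<Rightarrow> real"
  assumes osc: "\<And>a e. a \<in> \<Omega> \<Longrightarrow> e > 0 \<Longrightarrow> \<exists>r>0. \<exists>b. AE x in lebesgue. x \<in> ball a r \<longrightarrow> \<bar>u x - b\<bar> \<le> e"
  shows "\<exists>g. continuous_on \<Omega> g \<and> (AE x in lebesgue. x \<in> \<Omega> \<longrightarrow> g x = u x)"
proof -
  define F where "F n = {S. open S \<and> (\<exists>b. AE x in lebesgue. x \<in> S \<longrightarrow> \<bar>u x - b\<bar> \<le> 1 / real (Suc n))}" for n
  have "\<forall>n. \<exists>F'. F' \<subseteq> F n \<and> countable F' \<and> \<Union>F' = \<Union>(F n)"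
  proof
    fix n
    obtain G where "G \<subseteq> F n" "countable G" "\<Union>G = \<Union>(F n)"
      by (rule Lindelof[of "F n"]) (simp add: F_def)
    then show "\<exists>F'. F' \<subseteq> F n \<and> countable F' \<and> \<Union>F' = \<Union>(F n)" by (intro exI conjI)
  qed
  from choice[OF this] obtain F' where F0: "\<forall>n. F' n \<subseteq> F n \<and> countable (F' n) \<and> \<Union>(F' n) = \<Union>(F n)"
    by (rule exE)
  note F' = F0[rule_format, THEN conjunct1] F0[rule_format, THEN conjunct2, THEN conjunct1]
    F0[rule_format, THEN conjunct2, THEN conjunct2]
  have "\<forall>n. \<exists>b. \<forall>S\<in>F' n. AE x in lebesgue. x \<in> S \<longrightarrow> \<bar>u x - b S\<bar> \<le> 1 / real (Suc n)"
  proof (intro allI bchoice ballI)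
    fix n S assume "S \<in> F' n"
    then have "S \<in> F n" using F'(1) by blast
    then show "\<exists>b. AE x in lebesgue. x \<in> S \<longrightarrow> \<bar>u x - b\<bar> \<le> 1 / real (Suc n)" unfolding F_def by blast
  qed
  from choice[OF this] obtain b
    where b: "\<And>n S. S \<in> F' n \<Longrightarrow> AE x in lebesgue. x \<in> S \<longrightarrow> \<bar>u x - b n S\<bar> \<le> 1 / real (Suc n)"
    by blast
  define good where "good x \<longleftrightarrow> (\<forall>n. \<forall>S\<in>F' n. x \<in> S \<longrightarrow> \<bar>u x - b n S\<bar> \<le> 1 / real (Suc n))" for x
  have AE_good: "AE x in lebesgue. good x"
    unfolding good_def using b F'(2) by (simp add: AE_all_countable AE_ball_countable)
  have near: "\<exists>r>0. \<forall>x y. x \<in> ball a r \<longrightarrow> y \<in> ball a r \<longrightarrow> good x \<longrightarrow> good y \<longrightarrow> \<bar>u x - u y\<bar> \<le> e"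
    if a: "a \<in> \<Omega>" and e: "e > 0" for a e
  proof -
    obtain n where n: "1 / real (Suc n) < e / 2"
      using nat_approx_posE[of "e / 2"] e by auto
    obtain r c where "r > 0" "AE x in lebesgue. x \<in> ball a r \<longrightarrow> \<bar>u x - c\<bar> \<le> 1 / real (Suc n)"
      using osc[OF a, of "1 / real (Suc n)"] by auto
    then have "ball a r \<in> F n" "a \<in> ball a r" unfolding F_def by auto
    then have "a \<in> \<Union>(F' n)" unfolding F'(3) by blast
    then obtain S where S: "S \<in> F' n" "a \<in> S" by blast
    then have "open S" using F'(1)[of n] unfolding F_def by blast
    then obtain s where s: "s > 0" "ball a s \<subseteq> S" using S(2) open_contains_ball by blast
    have "\<bar>u x - u y\<bar> \<le> e" if "x \<in> ball a s" "y \<in> ball a s" "good x" "good y" for x y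
    proof -
      have "\<bar>u x - b n S\<bar> \<le> 1 / real (Suc n)" "\<bar>u y - b n S\<bar> \<le> 1 / real (Suc n)"
        using that s(2) S(1) unfolding good_def by blast+
      then show ?thesis using n by linarith
    qed
    then show ?thesis using s(1) by blast
  qed
  have "\<exists>l. \<forall>e>0. \<exists>r>0. \<forall>x. x \<in> ball a r \<longrightarrow> good x \<longrightarrow> \<bar>u x - l\<bar> \<le> e" if a: "a \<in> \<Omega>" for a
  proof -
    have "\<forall>k. \<exists>x. x \<in> ball a (1 / real (Suc k)) \<and> good x"
    proof
      fix k
      have "1 / real (Suc k) > 0" by simp
      from AE_dense[OF AE_good this, of a]
      show "\<exists>x. x \<in> ball a (1 / real (Suc k)) \<and> good x" by blast
    qed
    from choice[OF this] obtain X where X: "\<And>k. X k \<in> ball a (1 / real (Suc k))" "\<And>k. good (X k)"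
      by blast
    have ev: "eventually (\<lambda>k. X k \<in> ball a r) sequentially" if "r > 0" for r
    proof -
      have "eventually (\<lambda>k. 1 / real (Suc k) < r) sequentially"
        using LIMSEQ_Suc[OF lim_1_over_n] that by (rule order_tendstoD(2))
      then show ?thesis
        by (rule eventually_mono) (use X(1) in \<open>auto intro: less_trans\<close>)
    qed
    have "Cauchy (\<lambda>k. u (X k))"
    proof (rule metric_CauchyI)
      fix e :: real assume "e > 0"
      then obtain r where r: "r > 0" "\<And>x y. x \<in> ball a r \<Longrightarrow> y \<in> ball a r \<Longrightarrow> good x \<Longrightarrow> good y \<Longrightarrow> \<bar>u x - u y\<bar> \<le> e / 2"
        using near[OF a, of "e / 2"] by auto
      obtain M where "\<And>k. k \<ge> M \<Longrightarrow> X k \<in> ball a r"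
        using ev[OF r(1)] unfolding eventually_sequentially by blast
      then have "\<forall>m\<ge>M. \<forall>n\<ge>M. dist (u (X m)) (u (X n)) < e"
        using r(2) X(2) \<open>e > 0\<close> by (fastforce simp: dist_real_def)
      then show "\<exists>M. \<forall>m\<ge>M. \<forall>n\<ge>M. dist (u (X m)) (u (X n)) < e" by blast
    qed
    then obtain l where l: "(\<lambda>k. u (X k)) \<longlonglongrightarrow> l"
      using Cauchy_convergent convergent_def by blast
    have "\<exists>r>0. \<forall>x. x \<in> ball a r \<longrightarrow> good x \<longrightarrow> \<bar>u x - l\<bar> \<le> e" if e: "e > 0" for e
    proof -
      obtain r where r: "r > 0" "\<And>x y. x \<in> ball a r \<Longrightarrow> y \<in> ball a r \<Longrightarrow> good x \<Longrightarrow> good y \<Longrightarrow> \<bar>u x - u y\<bar> \<le> e"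
        using near[OF a e] by blast
      have "\<bar>u x - l\<bar> \<le> e" if x: "x \<in> ball a r" "good x" for x
      proof (rule tendsto_upperbound)
        show "(\<lambda>k. \<bar>u x - u (X k)\<bar>) \<longlonglongrightarrow> \<bar>u x - l\<bar>" by (intro tendsto_intros l)
        show "eventually (\<lambda>k. \<bar>u x - u (X k)\<bar> \<le> e) sequentially"
          using ev[OF r(1)] by (rule eventually_mono) (use r(2) x X(2) in blast)
      qed simp
      then show ?thesis using r(1) by blast
    qed
    then show ?thesis by blast
  qed
  then have "\<forall>a\<in>\<Omega>. \<exists>l. \<forall>e>0. \<exists>r>0. \<forall>x. x \<in> ball a r \<longrightarrow> good x \<longrightarrow> \<bar>u x - l\<bar> \<le> e" by blast
  from bchoice[OF this] obtain g
    where g: "\<And>a e. a \<in> \<Omega> \<Longrightarrow> e > 0 \<Longrightarrow> \<exists>r>0. \<forall>x. x \<in> ball a r \<longrightarrow> good x \<longrightarrow> \<bar>u x - g a\<bar> \<le> e"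
    by blast
  have "continuous_on \<Omega> g"
    unfolding continuous_on_iff
  proof (intro ballI allI impI)
    fix a and e :: real assume a: "a \<in> \<Omega>" and e: "e > 0"
    then have e3: "e / 3 > 0" by simp
    obtain r where r: "r > 0" "\<And>x. x \<in> ball a r \<Longrightarrow> good x \<Longrightarrow> \<bar>u x - g a\<bar> \<le> e / 3"
      using g[OF a e3] by blast
    show "\<exists>d>0. \<forall>c\<in>\<Omega>. dist c a < d \<longrightarrow> dist (g c) (g a) < e"
    proof (intro exI[of _ r] conjI ballI impI)
      fix c assume c: "c \<in> \<Omega>" "dist c a < r"
      obtain s where s: "s > 0" "\<And>x. x \<in> ball c s \<Longrightarrow> good x \<Longrightarrow> \<bar>u x - g c\<bar> \<le> e / 3"
        using g[OF c(1) e3] by blast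
      \<comment> \<open>A good point close to both c and a compares \<open>g c\<close> with
        \<open>g a\<close>.\<close>
      have "min s (r - dist c a) > 0" using s(1) c(2) by simp
      then obtain x where x: "x \<in> ball c (min s (r - dist c a))" "good x"
        using AE_dense[OF AE_good] by blast
      have "x \<in> ball c s" "x \<in> ball a r"
        using x(1) dist_triangle[of a x c] by (auto simp: dist_commute)
      then have "\<bar>u x - g c\<bar> \<le> e / 3" "\<bar>u x - g a\<bar> \<le> e / 3" using s(2) r(2) x(2) by auto
      then show "dist (g c) (g a) < e" 
        using e unfolding dist_real_def by linarith
    qed (rule r(1))
  qed
  moreover have "g x = u x" if "x \<in> \<Omega>" "good x" for x
  proof -
    have "\<bar>u x - g x\<bar> \<le> 0 + e" if "e > 0" for e
      using g[OF \<open>x \<in> \<Omega>\<close> that] \<open>good x\<close> by auto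
    then have "\<bar>u x - g x\<bar> \<le> 0" by (rule field_le_epsilon)
    then show ?thesis by simp
  qed
  then have "AE x in lebesgue. x \<in> \<Omega> \<longrightarrow> g x = u x"
    using AE_good by (auto elim: eventually_mono)
  ultimately show ?thesis by blast
qed

section \<open>The comass of a bounded form\<close>

text \<open>Different increasing multi-indices have different ranges of the same size, so some value
  of \<open>I'\<close> is missed by \<open>I\<close>, and the corresponding row of the matrix is
  zero.\<close>

lemma dx_coordinate_vectors:
  fixes I I' :: "'n::{finite,wellorder} \<Rightarrow> 'm::{finite,wellorder}"
  assumes "strict_mono I" "strict_mono I'"
  shows "dx I' (\<lambda>b. axis (I b) 1) = (if I' = I then 1 else 0)"
proof (cases "I' = I")
  case True
  have "inj I" using assms(1) by (rule strict_mono_imp_inj_on)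
  then have "(\<chi> a b. axis (I b) 1 $ I a) = (mat 1 :: (real^'n::_)^'n::_)"
    by (auto simp: vec_eq_iff mat_def axis_def inj_def)
  then show ?thesis using True by (simp add: dx_def det_I)
next
  case False
  have "\<exists>a. I' a \<notin> range I"
  proof (rule ccontr)
    assume "\<not> ?thesis"
    then have sub: "range I' \<subseteq> range I" by auto
    have "card (range I') = card (range I)"
      using assms by (simp add: card_image strict_mono_imp_inj_on)
    with sub have eq: "range I' = range I" by (intro card_subset_eq) auto
    \<comment> \<open>An increasing map is determined by its range: the values below
      \<open>a\<close> agree by induction, so I' a = I c and I a = I' d force c and d to be at least
      a, and both inequalities between I a and I' a follow.\<close>
    have "I' a = I a" for a
    proof (induction a rule: less_induct)
      case (less a)
      obtain c where c: "I' a = I c" using eq by (metis rangeE rangeI)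
      obtain d where d: "I a = I' d" using eq by (metis rangeE rangeI)
      have "\<not> c < a"
      proof
        assume "c < a"
        then have "I' c = I' a" using less c by simp
        then show False using \<open>c < a\<close> assms(2) by (metis strict_mono_less less_irrefl)
      qed
      moreover have "\<not> d < a"
      proof
        assume "d < a"
        then have "I d = I a" using less d by simp
        then show False using \<open>d < a\<close> assms(1) by (metis strict_mono_less less_irrefl)
      qed
      ultimately have "I a \<le> I c" "I' a \<le> I' d"
        using assms by (auto simp: strict_mono_less_eq)
      then show ?case using c d by simp
    qed
    then show False using False by auto
  qed
  then obtain a where a: "I' a \<notin> range I" by blast
  have "row a (\<chi> a b. axis (I b) 1 $ I' a :: (real^'n::_)^'n::_) = 0"
    using a by (auto simp: row_def vec_eq_iff axis_def)
  then have "det (\<chi> a b. axis (I b) 1 $ I' a :: (real^'n::_)^'n::_) = 0"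
    by (rule det_zero_row)
  then show ?thesis using False by (simp add: dx_def)
qed

text \<open>A crude Leibniz bound. It ensures that the set in \<open>comass\<close> is bounded
  above, so that its \<open>Sup\<close> really is an upper bound.\<close>

lemma dx_bound:
  fixes I :: "'n::finite \<Rightarrow> 'm::finite"
  assumes "\<And>i. norm (v i) \<le> 1"
  shows "\<bar>dx I v\<bar> \<le> fact CARD('n)"
proof -
  have "\<bar>v b $ I a\<bar> \<le> 1" for a b using component_le_norm_cart[of "v b" "I a"] assms[of b] by simp
  then have "\<bar>dx I v\<bar> \<le> (\<Sum>p\<in>{p. p permutes (UNIV::'n set)}. 1)"
    unfolding dx_def det_def
    by (intro order_trans[OF sum_abs] sum_mono)
      (auto simp: abs_mult abs_prod sign_def intro!: prod_le_1)
  also have "\<dots> = fact CARD('n)" using card_permutations[of "UNIV::'n set"] by simp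
  finally show ?thesis .
qed

text \<open>At each point take a multi-index whose coefficient exceeds c in absolute value; on its
  own coordinate vectors the form reduces to that coefficient.\<close>

lemma bounded_form_comass:
  fixes \<omega> :: "('n::{finite,wellorder}, 'm::{finite,wellorder}) form"
  assumes "bounded_form \<omega>"
  obtains c where "c > 0" "\<And>p. c \<le> comass \<omega> p"
proof -
  obtain c where c: "c > 0" "\<And>x. \<exists>I\<in>multi_indices. \<bar>\<omega> I x\<bar> > c"
    using assms unfolding bounded_form_def by blast
  have "c \<le> comass \<omega> p" for p
  proof -
    obtain I where I: "I \<in> multi_indices" "\<bar>\<omega> I p\<bar> > c" using c(2) by blast
    let ?S = "{\<bar>form_at \<omega> p v\<bar> | v. \<forall>i. norm (v i) \<le> 1}"
    let ?e = "\<lambda>b. axis (I b) 1 :: real^'m::_"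
    have "form_at \<omega> p ?e = (\<Sum>J\<in>multi_indices. if J = I then \<omega> I p else 0)"
      unfolding form_at_def using I(1)
      by (intro sum.cong) (auto simp: multi_indices_def dx_coordinate_vectors)
    also have "\<dots> = \<omega> I p" using I(1) by simp
    finally have "\<bar>\<omega> I p\<bar> \<in> ?S" by (auto intro!: exI[of _ ?e])
    moreover have "bdd_above ?S"
    proof (rule bdd_aboveI)
      fix y assume "y \<in> ?S"
      then obtain v where v: "y = \<bar>form_at \<omega> p v\<bar>" "\<And>i. norm (v i) \<le> 1" by blast
      have "y \<le> (\<Sum>J\<in>multi_indices. \<bar>\<omega> J p\<bar> * \<bar>dx J v\<bar>)"
        unfolding v(1) form_at_def abs_mult[symmetric] by (rule sum_abs)
      also have "\<dots> \<le> (\<Sum>J\<in>(multi_indices :: ('n \<Rightarrow> 'm) set). \<bar>\<omega> J p\<bar> * fact CARD('n))"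
        by (intro sum_mono mult_left_mono dx_bound v(2)) auto
      finally show "y \<le> (\<Sum>J\<in>(multi_indices :: ('n \<Rightarrow> 'm) set). \<bar>\<omega> J p\<bar> * fact CARD('n))" .
    qed
    ultimately have "\<bar>\<omega> I p\<bar> \<le> comass \<omega> p" unfolding comass_def by (rule cSup_upper)
    then show ?thesis using I(2) by simp
  qed
  then show thesis using that c(1) by blast
qed

text \<open>Apply the matrix to its own row: component i of the image of \<open>D $ i\<close> is the
  square of its norm.\<close>

lemma norm_row_le_onorm:
  fixes D :: "real^'n^'m"
  shows "norm (D $ i) \<le> onorm ((*v) D)"
proof (cases "D $ i = 0")
  case False
  have "(D *v (D $ i)) $ i = D $ i \<bullet> D $ i"
    by (simp add: matrix_vector_mult_def inner_vec_def)
  then have "norm (D $ i) * norm (D $ i) \<le> norm (D *v (D $ i))"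
    using component_le_norm_cart[of "D *v (D $ i)" i] by (simp flip: power2_eq_square power2_norm_eq_inner)
  also have "\<dots> \<le> onorm ((*v) D) * norm (D $ i)" by (rule onorm) (rule matrix_vector_mul_bounded_linear)
  finally show ?thesis using False by simp
qed (simp add: onorm_pos_le matrix_vector_mul_bounded_linear)

section \<open>Exponentially integrable distortion\<close>

lemma nn_integral_powr_01:
  assumes "p > -1"
  shows "(\<integral>\<^sup>+s. indicator {0<..<1} s * ennreal (s powr p) \<partial>lborel) = ennreal (1 / (p + 1))"
proof -
  have "((\<lambda>s::real. s powr p) has_integral (1 / (p + 1))) {0..1}"
    using has_integral_powr_from_0[OF assms, of 1] by simp
  then have "((\<lambda>s. if s \<in> {0..1} then s powr p else 0) has_integral (1 / (p + 1))) UNIV"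
    by (simp only: has_integral_restrict_UNIV)
  then have "(\<integral>\<^sup>+s. ennreal (if s \<in> {0..1} then s powr p else 0) \<partial>lborel) = ennreal (1 / (p + 1))"
    by (intro nn_integral_has_integral_lborel) auto
  also have "(\<integral>\<^sup>+s. ennreal (if s \<in> {0..1} then s powr p else 0) \<partial>lborel) =
      (\<integral>\<^sup>+s. indicator {0..1} s * ennreal (s powr p) \<partial>lborel)"
    by (intro nn_integral_cong) (auto simp: indicator_def)
  finally show ?thesis by (simp add: nn_integral_Ioo_Icc)
qed

text \<open>Where the integrand is positive, g exceeds T s^(-\<beta>). Write g = g^(n-1/2)
  g^(3/2-n); as 3/2 - n is negative, the second factor is at most (T s^(-\<beta>))^(3/2-n). With
  this \<beta> the remaining power of s is s^(-3/4), whose integral is 4. Every \<beta> between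
  (n-2)/(n-3/2) and 1 would give a convergent integral; the one chosen is the midpoint.\<close>

lemma excess_powr_bound:
  assumes n: "n \<ge> 2" and T: "T > 0"
  defines "\<beta> \<equiv> (real n - 7 / 4) / (real n - 3 / 2)"
  shows "excess n (\<lambda>s. T * s powr (- \<beta>)) g \<le>
    ennreal (4 * T powr (3 / 2 - real n)) * (indicator {T<..} g * ennreal (g powr (real n - 1 / 2)))"
proof -
  have n2: "real n \<ge> 2" using n by simp
  have \<beta>: "\<beta> \<ge> 0" "\<beta> * (real n - 3 / 2) = real n - 7 / 4" using n2 by (auto simp: \<beta>_def)
  let ?c = "T powr (3 / 2 - real n) * g powr (real n - 1 / 2)"
  have pt: "s powr (1 - real n) * (g - T * s powr (- \<beta>)) \<le> ?c * s powr (- 3 / 4) \<and> g > T"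
    if s: "0 < s" "s < 1" and g: "g > T * s powr (- \<beta>)" for s
  proof -
    have "s powr 0 \<le> s powr (- \<beta>)" using s \<beta>(1) by (intro powr_mono') auto
    then have "s powr (- \<beta>) \<ge> 1" using s by simp
    then have gT: "g > T" using mult_left_mono[of 1 "s powr (- \<beta>)" T] g T by linarith
    then have g0: "g > 0" using T by simp
    have "g powr (3 / 2 - real n) \<le> (T * s powr (- \<beta>)) powr (3 / 2 - real n)"
      using g T s n2 by (intro powr_mono2') auto
    also have "\<dots> = T powr (3 / 2 - real n) * s powr (real n - 7 / 4)"
    proof -
      have "- \<beta> * (3 / 2 - real n) = real n - 7 / 4" using \<beta>(2) by (simp add: algebra_simps)
      then show ?thesis using T s by (simp add: powr_mult powr_powr)
    qed
    finally have 1: "g powr (3 / 2 - real n) \<le> T powr (3 / 2 - real n) * s powr (real n - 7 / 4)" .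
    have "g - T * s powr (- \<beta>) \<le> g" using T s by simp
    also have "\<dots> = g powr (real n - 1 / 2) * g powr (3 / 2 - real n)" using g0 by (simp flip: powr_add)
    also have "\<dots> \<le> g powr (real n - 1 / 2) * (T powr (3 / 2 - real n) * s powr (real n - 7 / 4))"
      using 1 by (intro mult_left_mono) auto
    finally have "s powr (1 - real n) * (g - T * s powr (- \<beta>)) \<le>
      s powr (1 - real n) * (g powr (real n - 1 / 2) * (T powr (3 / 2 - real n) * s powr (real n - 7 / 4)))"
      by (intro mult_left_mono) auto
    also have "\<dots> = ?c * (s powr (1 - real n) * s powr (real n - 7 / 4))" by (simp add: mult_ac)
    also have "s powr (1 - real n) * s powr (real n - 7 / 4) = s powr (- 3 / 4)" by (simp flip: powr_add)
    finally show ?thesis using gT by simp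
  qed
  have "excess n (\<lambda>s. T * s powr (- \<beta>)) g \<le>
    (\<integral>\<^sup>+s. (indicator {T<..} g * ennreal ?c) * (indicator {0<..<1} s * ennreal (s powr (- 3 / 4))) \<partial>lborel)"
    unfolding excess_def
  proof (intro nn_integral_mono)
    fix s :: real
    show "indicator {0<..<1} s * ennreal (s powr (1 - real n)) * ennreal (g - T * s powr (- \<beta>)) \<le>
      (indicator {T<..} g * ennreal ?c) * (indicator {0<..<1} s * ennreal (s powr (- 3 / 4)))"
    proof (cases "s \<in> {0<..<1} \<and> g > T * s powr (- \<beta>)")
      case True
      then have p: "s powr (1 - real n) * (g - T * s powr (- \<beta>)) \<le> ?c * s powr (- 3 / 4)" "g > T"
        using pt[of s] by auto
      have "ennreal (s powr (1 - real n)) * ennreal (g - T * s powr (- \<beta>)) \<le> ennreal ?c * ennreal (s powr (- 3 / 4))"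
        using p True by (simp add: ennreal_mult[symmetric] ennreal_leI)
      then show ?thesis using True p(2) by simp
    qed (auto simp: indicator_def ennreal_neg)
  qed
  also have "\<dots> = (indicator {T<..} g * ennreal ?c) * ennreal (1 / (- 3 / 4 + 1))"
    by (simp add: nn_integral_cmult nn_integral_powr_01)
  also have "\<dots> = ennreal (4 * T powr (3 / 2 - real n)) * (indicator {T<..} g * ennreal (g powr (real n - 1 / 2)))"
    using T by (simp add: ennreal_mult mult_ac)
  finally show ?thesis .
qed

text \<open>The induction step amounts to 20 (m + 1) \<le> 19 sqrt 2 m. The ratio (m + 1)/m is below
  sqrt 2 only from m = 3 on, which is why the sum starts there, and 20 is large enough at m =
  3.\<close>

lemma geometric_harmonic_sum:
  assumes "m \<ge> 3"
  shows "(\<Sum>j=3..m. sqrt 2 ^ j / real j) \<le> 20 * sqrt 2 ^ m / real m"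
  using assms
proof (induction m rule: dec_induct)
  case base
  then show ?case by simp
next
  case (step m)
  have m: "real m \<ge> 3" using step by simp
  have s: "sqrt 2 \<ge> 141 / 100" by (rule real_le_rsqrt) (simp add: power2_eq_square)
  have "20 / real m + sqrt 2 / (real m + 1) \<le> 20 * sqrt 2 / (real m + 1)"
  proof -
    have "20 * (real m + 1) \<le> 19 * (141 / 100) * real m" using m by simp
    also have "\<dots> \<le> 19 * sqrt 2 * real m" using s m by (intro mult_right_mono) auto
    finally have "20 / real m \<le> 19 * sqrt 2 / (real m + 1)" using m by (simp add: field_simps)
    moreover have "20 * sqrt 2 / (real m + 1) = 19 * sqrt 2 / (real m + 1) + sqrt 2 / (real m + 1)"
      by (simp flip: add_divide_distrib)
    ultimately show ?thesis by linarith
  qed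
  then have "sqrt 2 ^ m * (20 / real m + sqrt 2 / (real m + 1)) \<le> sqrt 2 ^ m * (20 * sqrt 2 / (real m + 1))"
    by (intro mult_left_mono) auto
  then have 1: "20 * sqrt 2 ^ m / real m + sqrt 2 ^ Suc m / real (Suc m) \<le> 20 * sqrt 2 ^ Suc m / real (Suc m)"
    by (simp add: algebra_simps)
  have "(\<Sum>j=3..Suc m. sqrt 2 ^ j / real j) = (\<Sum>j=3..m. sqrt 2 ^ j / real j) + sqrt 2 ^ Suc m / real (Suc m)"
    using step by simp
  then show ?case using step.IH 1 by linarith
qed

text \<open>
  The geometric sum is dominated by its last term, \<open>2 ^ j\<close> about \<open>g\<close>, which leaves \<open>g ^ n / log g\<close>.
  Either \<open>g ^ n\<close> is at most \<open>exp (lam * k)\<close>, or \<open>log g\<close> is at least of order \<open>k\<close> and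
  cancels the factor \<open>k\<close> in the distortion inequality.
\<close>

lemma dyadic_sum_bound:
  assumes \<kappa>: "0 < \<kappa>" "\<kappa> \<le> 1" and "lam > 0" "c > 0" "k \<ge> 1" and n: "n \<ge> 1"
    and g: "g \<ge> 0" "c * g ^ n \<le> k * J"
  shows "(\<Sum>j | 3 \<le> j \<and> j \<le> N \<and> \<kappa> * 2 ^ j < g. sqrt 2 ^ j / real j) * g powr (real n - 1 / 2) \<le>
    40 * \<kappa> powr (- 1 / 2) * (1 + real n / (c * lam)) * (J + exp (lam * k))"
proof -
  let ?M = "{j. 3 \<le> j \<and> j \<le> N \<and> \<kappa> * 2 ^ j < g}"
  have "k * J \<ge> 0" using g \<open>c > 0\<close> by (meson mult_nonneg_nonneg less_imp_le order_trans zero_le_power)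
  then have J: "J \<ge> 0" using \<open>k \<ge> 1\<close> by (simp add: zero_le_mult_iff)
  show ?thesis
  proof (cases "?M = {}")
    case True
    have "0 \<le> 40 * \<kappa> powr (- 1 / 2) * (1 + real n / (c * lam)) * (J + exp (lam * k))"
      using J \<open>c > 0\<close> \<open>lam > 0\<close> by (intro mult_nonneg_nonneg add_nonneg_nonneg) auto
    then show ?thesis unfolding True by simp
  next
    case False
    then obtain j0 where j0: "3 \<le> j0" "\<kappa> * 2 ^ j0 < g" by blast
    have g0: "g > 0" using j0(2) \<kappa>(1) by (meson less_trans mult_pos_pos zero_less_numeral zero_less_power)
    define L where "L = log 2 (g / \<kappa>)"
    have jL: "real j < L" if "\<kappa> * 2 ^ j < g" for j
    proof -
      have "2 powr real j < g / \<kappa>" using that \<kappa>(1) by (simp add: powr_realpow field_simps)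
      then show ?thesis unfolding L_def using g0 \<kappa>(1) by (simp add: less_log_iff)
    qed
    have L3: "L > 3" using jL[OF j0(2)] j0(1) by linarith
    \<comment> \<open>The condition \<kappa> 2^j < g means j < L, so the sum runs at most up to the
      floor of \<open>L\<close>. From L > 3 one gets both m \<ge> 3 and m \<ge> L/2.\<close>
    define m where "m = nat \<lfloor>L\<rfloor>"
    have m: "real m \<le> L" "L < real m + 1" "m \<ge> 3"
      using L3 unfolding m_def by linarith+
    have sub: "?M \<subseteq> {3..m}"
    proof
      fix j assume j: "j \<in> ?M"
      then have "real j < L" using jL by blast
      then have "j \<le> m" using m(2) by linarith
      then show "j \<in> {3..m}" using j by simp
    qed
    have "(\<Sum>j\<in>?M. sqrt 2 ^ j / real j) \<le> (\<Sum>j=3..m. sqrt 2 ^ j / real j)"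
      using sub by (intro sum_mono2) auto
    also have "\<dots> \<le> 20 * sqrt 2 ^ m / real m" by (rule geometric_harmonic_sum[OF m(3)])
    also have "\<dots> \<le> 20 * (g / \<kappa>) powr (1 / 2) / (L / 2)"
    proof (rule frac_le)
      have "sqrt 2 ^ m = 2 powr (real m / 2)"
        by (simp add: powr_half_sqrt[symmetric] powr_realpow[symmetric] powr_powr)
      also have "\<dots> \<le> 2 powr (L / 2)" using m(1) by simp
      also have "\<dots> = (2 powr L) powr (1 / 2)" by (simp add: powr_powr)
      also have "2 powr L = g / \<kappa>" using g0 \<kappa>(1) by (simp add: L_def)
      finally show "20 * sqrt 2 ^ m \<le> 20 * (g / \<kappa>) powr (1 / 2)" by simp
      show "L / 2 \<le> real m" using m L3 by linarith
    qed (use L3 in auto)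
    also have "\<dots> = 40 * \<kappa> powr (- 1 / 2) * g powr (1 / 2) / L"
      using g0 \<kappa>(1) by (simp add: powr_divide powr_minus_divide)
    finally have "(\<Sum>j\<in>?M. sqrt 2 ^ j / real j) * g powr (real n - 1 / 2) \<le>
      40 * \<kappa> powr (- 1 / 2) * g powr (1 / 2) / L * g powr (real n - 1 / 2)"
      by (intro mult_right_mono) auto
    also have "\<dots> = 40 * \<kappa> powr (- 1 / 2) * ((g powr (1 / 2) * g powr (real n - 1 / 2)) / L)" by simp
    also have "g powr (1 / 2) * g powr (real n - 1 / 2) = g ^ n"
      using g0 by (simp add: powr_realpow flip: powr_add)
    finally have A: "(\<Sum>j\<in>?M. sqrt 2 ^ j / real j) * g powr (real n - 1 / 2) \<le> 40 * \<kappa> powr (- 1 / 2) * (g ^ n / L)" .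
    have "g ^ n / L \<le> (1 + real n / (c * lam)) * (J + exp (lam * k))"
    proof (cases "g ^ n \<le> exp (lam * k)")
      case True
      have "g ^ n / L \<le> g ^ n" using L3 g0 by (simp add: divide_le_eq)
      also have "\<dots> \<le> J + exp (lam * k)" using True J by simp
      also have "\<dots> \<le> (1 + real n / (c * lam)) * (J + exp (lam * k))"
        using J \<open>c > 0\<close> \<open>lam > 0\<close> by (simp add: distrib_right)
      finally show ?thesis .
    next
      case False
      have lk: "lam * k > 0" using \<open>lam > 0\<close> \<open>k \<ge> 1\<close> by simp
      have "exp (ln (g ^ n)) = g ^ n" using g0 by (intro exp_ln) simp
      with False have "exp (lam * k) < exp (ln (g ^ n))" by linarith
      then have "lam * k < ln (g ^ n)" by (simp only: exp_less_cancel_iff)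
      then have lng: "lam * k < real n * ln g" using g0 by (simp add: ln_realpow)
      have "real n * ln g > 0" using lng lk by linarith
      then have ln0: "ln g > 0" by (simp add: zero_less_mult_iff)
      have "ln g \<le> ln g / ln 2"
        using ln0 ln_le_minus_one[of 2] by (simp add: le_divide_eq)
      also have "\<dots> = log 2 g" by (simp add: log_def)
      \<comment> \<open>This is where \<kappa> \<le> 1 enters.\<close>
      also have "\<dots> \<le> L" unfolding L_def using g0 \<kappa> by (simp add: le_divide_eq)
      finally have "ln g \<le> L" .
      then have "real n * ln g \<le> real n * L" by (intro mult_left_mono) auto
      then have "lam * k \<le> real n * L" using lng by linarith
      then have nL: "1 / L \<le> real n / (lam * k)" using L3 lk by (simp add: field_simps)
      have "g ^ n \<le> k * J / c" using g(2) \<open>c > 0\<close> by (simp add: field_simps)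
      then have "g ^ n / L \<le> (k * J / c) / L" using L3 by (intro divide_right_mono) auto
      also have "\<dots> = (k * J / c) * (1 / L)" by simp
      also have "\<dots> \<le> (k * J / c) * (real n / (lam * k))"
        using nL J \<open>k \<ge> 1\<close> \<open>c > 0\<close> by (intro mult_left_mono) auto
      also have "\<dots> = real n / (c * lam) * J" using \<open>k \<ge> 1\<close> by simp
      also have "\<dots> \<le> (1 + real n / (c * lam)) * (J + exp (lam * k))"
        using J \<open>c > 0\<close> \<open>lam > 0\<close> by (intro mult_mono) auto
      finally show ?thesis .
    qed
    then have "40 * \<kappa> powr (- 1 / 2) * (g ^ n / L) \<le> 40 * \<kappa> powr (- 1 / 2) * ((1 + real n / (c * lam)) * (J + exp (lam * k)))"
      by (intro mult_left_mono) auto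
    with A show ?thesis by (simp add: mult.assoc)
  qed
qed

section \<open>Small oscillation at some scale, in dimension 1 and in higher dimensions\<close>

lemma measure_ball_scale:
  fixes a :: "real^'n::finite"
  shows "R \<ge> 0 \<Longrightarrow> measure lborel (ball a R) = unit_ball_vol (real CARD('n)) * R ^ CARD('n)"
  using content_ball[of R a] by simp

text \<open>With the constant threshold 1 the first term in
  \<open>weakly_monotone_oscillation\<close> is 2 R. The volume of the ball is v R, so the second is
  16 e / v with e the integral of |V| over the ball of radius 2 R. Both tend to 0 with R.\<close>

lemma vanishing_oscillation_1:
  fixes u :: "real^'n::finite \<Rightarrow> real"
  assumes wm: "weakly_monotone \<Omega> u" and wg: "weak_gradient \<Omega> u V"
    and sub: "cball a \<rho> \<subseteq> \<Omega>" and \<rho>: "\<rho> > 0" and n: "CARD('n) = 1" and o: "\<epsilon> > 0"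
  shows "\<exists>r>0. \<exists>b. AE x in lebesgue. x \<in> ball a r \<longrightarrow> \<bar>u x - b\<bar> \<le> \<epsilon>"
proof -
  define v where "v = unit_ball_vol (1::real)"
  have v: "v > 0" by (simp add: v_def)
  have iV: "integrable lebesgue (\<lambda>x. indicator (cball a \<rho>) x *\<^sub>R V x)"
    using wg sub unfolding weak_gradient_def loc_integrable_def set_integrable_def by auto
  then have [measurable]: "(\<lambda>x. indicator (cball a \<rho>) x *\<^sub>R V x) \<in> borel_measurable lebesgue" by auto
  let ?g = "\<lambda>x. norm (indicator (cball a \<rho>) x *\<^sub>R V x)"
  let ?R = "\<lambda>k. \<rho> / 2 * (1 / real (Suc k))"
  let ?h = "\<lambda>k x. indicator (ball a (2 * ?R k)) x * ?g x"
  have "(\<lambda>k. \<integral>x. ?h k x \<partial>lebesgue) \<longlonglongrightarrow> (\<integral>x. 0 \<partial>(lebesgue :: (real^'n) measure))"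
  proof (rule integral_dominated_convergence[where w = ?g])
    \<comment> \<open>The balls shrink to their centre, so pointwise convergence to 0 can fail only
      there.\<close>
    have "AE x in lebesgue. x \<noteq> a"
      using AE_completion[OF AE_lborel_singleton[of a]] .
    then show "AE x in lebesgue. (\<lambda>k. ?h k x) \<longlonglongrightarrow> 0"
    proof eventually_elim
      case (elim x)
      have "(\<lambda>k. \<rho> * (1 / real (Suc k))) \<longlonglongrightarrow> \<rho> * 0"
        by (intro tendsto_mult tendsto_const LIMSEQ_Suc[OF lim_1_over_n])
      then have "eventually (\<lambda>k. \<rho> * (1 / real (Suc k)) < dist a x) sequentially"
        by (rule order_tendstoD(2)) (use elim in auto)
      then have "eventually (\<lambda>k. ?h k x = 0) sequentially"
      proof (rule eventually_mono)
        fix k assume "\<rho> * (1 / real (Suc k)) < dist a x"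
        moreover have "2 * ?R k = \<rho> * (1 / real (Suc k))" by (simp add: field_simps)
        ultimately have "x \<notin> ball a (2 * ?R k)" by (simp only: mem_ball)
        then show "?h k x = 0" by simp
      qed
      then show ?case by (rule tendsto_eventually)
    qed
    show ig: "integrable lebesgue ?g" using iV by (rule integrable_norm)
    show "(\<lambda>x. ?h k x) \<in> borel_measurable lebesgue" for k
      by (intro borel_measurable_times borel_measurable_indicator borel_measurable_integrable[OF ig]) auto
    show "AE x in lebesgue. norm (?h k x) \<le> ?g x" for k
      by (intro AE_I2) (auto simp: indicator_def)
  qed simp
  then have "(\<lambda>k. 2 * ?R k + 16 * (\<integral>x. ?h k x \<partial>lebesgue) / v) \<longlonglongrightarrow> 2 * (\<rho> / 2 * 0) + 16 * 0 / v"
    by (intro tendsto_intros LIMSEQ_Suc[OF lim_1_over_n]) (use v in auto)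
  then have "eventually (\<lambda>k. 2 * ?R k + 16 * (\<integral>x. ?h k x \<partial>lebesgue) / v < \<epsilon>) sequentially"
    by (rule order_tendstoD(2)) (use o in simp)
  then obtain k where k: "2 * ?R k + 16 * (\<integral>x. ?h k x \<partial>lebesgue) / v < \<epsilon>"
    using eventually_happens trivial_limit_sequentially by blast
  define R where "R = ?R k"
  define e where "e = (\<integral>x. indicator (ball a (2 * R)) x * ?g x \<partial>lebesgue)"
  have R: "R > 0" "2 * R \<le> \<rho>" using \<rho> by (auto simp: R_def field_simps)
  have e: "e \<ge> 0" unfolding e_def by (intro Bochner_Integration.integral_nonneg) auto
  have sub2: "ball a (2 * R) \<subseteq> cball a \<rho>" "cball a (2 * R) \<subseteq> \<Omega>" using R sub by auto
  have ex: "excess CARD('n) (\<lambda>s. 1) g \<le> ennreal g" for g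
  proof -
    have "excess CARD('n) (\<lambda>s. 1) g \<le> (\<integral>\<^sup>+s. ennreal g * indicator {0<..<1::real} s \<partial>lborel)"
      unfolding excess_def n by (intro nn_integral_mono) (auto simp: indicator_def intro: ennreal_leI)
    then show ?thesis by (simp add: nn_integral_cmult_indicator)
  qed
  have ie: "integrable lebesgue (\<lambda>x. indicator (ball a (2 * R)) x * ?g x)"
    using integrable_mult_indicator[OF _ integrable_norm[OF iV], of "ball a (2 * R)"] by simp
  have E: "(\<integral>\<^sup>+z. indicator (ball a (2 * R)) z * excess CARD('n) (\<lambda>s. 1) (norm (V z)) \<partial>lebesgue) \<le> ennreal e"
  proof -
    have "(\<integral>\<^sup>+z. indicator (ball a (2 * R)) z * excess CARD('n) (\<lambda>s. 1) (norm (V z)) \<partial>lebesgue) \<le>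
      (\<integral>\<^sup>+z. ennreal (indicator (ball a (2 * R)) z * ?g z) \<partial>lebesgue)"
    proof (intro nn_integral_mono)
      fix z
      show "indicator (ball a (2 * R)) z * excess CARD('n) (\<lambda>s. 1) (norm (V z)) \<le> ennreal (indicator (ball a (2 * R)) z * ?g z)"
        using ex[of "norm (V z)"] sub2(1) by (cases "z \<in> ball a (2 * R)") auto
    qed
    also have "\<dots> = ennreal e" unfolding e_def using ie by (intro nn_integral_eq_integral) auto
    finally show ?thesis .
  qed
  have "\<exists>b. AE x in lebesgue. x \<in> ball a (R / 2) \<longrightarrow> \<bar>u x - b\<bar> \<le> \<epsilon>"
  proof (rule weakly_monotone_oscillation[OF wm wg sub2(2) R(1) _ _ _ _ E e])
    show "(\<integral>\<^sup>+s. indicator {0<..<1::real} s * ennreal 1 \<partial>lborel) \<le> ennreal 1" by simp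
    have "16 * R * e / measure lborel (ball a R) = 16 * e / v"
      using R(1) by (simp add: measure_ball_scale n v_def)
    then show "2 * R * 1 + 16 * R * e / measure lborel (ball a R) < \<epsilon>"
      using k unfolding R_def[symmetric] e_def[symmetric] by simp
  qed auto
  then show ?thesis using R(1) by (intro exI[of _ "R / 2"]) auto
qed

text \<open>Contrapositive of \<open>weakly_monotone_oscillation\<close> with T = \<kappa>/R. The
  value of \<kappa> makes the first term there, 2 \<kappa>/(1 - \<beta>), equal to \<epsilon>/2. The
  second is \<epsilon>/2 times the right hand side of the claim, so if that were below 1 the
  oscillation bound would hold. The constant 128 is 2 times 16 times the 4 of
  \<open>excess_powr_bound\<close>.\<close>

lemma dyadic_energy_lower_bound:
  fixes u :: "real^'n::finite \<Rightarrow> real"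
  assumes wm: "weakly_monotone \<Omega> u" and wg: "weak_gradient \<Omega> u V"
    and sub: "cball a (2 * R) \<subseteq> \<Omega>" and R: "R > 0" and n: "CARD('n) \<ge> 2" and o: "\<epsilon> > 0"
    and no: "\<not> (\<exists>b. AE x in lebesgue. x \<in> ball a (R / 2) \<longrightarrow> \<bar>u x - b\<bar> \<le> \<epsilon>)"
  defines "\<kappa> \<equiv> \<epsilon> * (1 - (real CARD('n) - 7 / 4) / (real CARD('n) - 3 / 2)) / 4"
  shows "1 \<le> ennreal (128 * \<kappa> powr (3 / 2 - real CARD('n)) / (unit_ball_vol (real CARD('n)) * \<epsilon>) * R powr (- 1 / 2)) *
    (\<integral>\<^sup>+z. indicator (ball a (2 * R)) z * (indicator {\<kappa> / R<..} (norm (V z)) * ennreal (norm (V z) powr (real CARD('n) - 1 / 2))) \<partial>lebesgue)"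
    (is "1 \<le> ennreal ?C * ?I")
proof (rule ccontr)
  let ?n = "real CARD('n)"
  define \<beta> where "\<beta> = (?n - 7 / 4) / (?n - 3 / 2)"
  define v where "v = unit_ball_vol ?n"
  assume "\<not> 1 \<le> ennreal ?C * ?I"
  then have lt: "ennreal ?C * ?I < 1" by (simp add: not_le)
  have n2: "?n \<ge> 2" using n by simp
  have \<beta>: "\<beta> \<ge> 0" "\<beta> < 1" using n2 by (auto simp: \<beta>_def)
  have \<kappa>: "\<kappa> > 0" "\<kappa> = \<epsilon> * (1 - \<beta>) / 4" using o \<beta> by (auto simp: \<kappa>_def \<beta>_def[symmetric])
  have v: "v > 0" by (simp add: v_def)
  have C: "?C > 0" using \<kappa>(1) o v R unfolding v_def by simp
  have "?I \<noteq> top"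
  proof
    assume "?I = top"
    moreover have "ennreal c * top = top" if "c > 0" for c
      using that by (simp add: ennreal_mult_top)
    ultimately show False using lt C by (simp only: not_top_less)
  qed
  then obtain i where i: "i \<ge> 0" "?I = ennreal i" by (cases ?I) auto
  have Ci: "?C * i < 1"
  proof -
    have "c * i < 1" if "c > 0" "ennreal c * ennreal i < 1" for c
    proof -
      have "ennreal (c * i) < ennreal 1" using that i(1) by (simp add: ennreal_mult)
      then show ?thesis using that i(1) by (subst (asm) ennreal_less_iff) auto
    qed
    from this[OF C] show ?thesis using lt unfolding i(2) .
  qed
  define T where "T = \<kappa> / R"
  have T: "T > 0" using \<kappa>(1) R by (simp add: T_def)
  define e where "e = 4 * T powr (3 / 2 - ?n) * i"
  have e: "e \<ge> 0" using i by (simp add: e_def)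
  let ?\<tau> = "\<lambda>s. T * s powr (- \<beta>)"
  have E: "(\<integral>\<^sup>+z. indicator (ball a (2 * R)) z * excess CARD('n) ?\<tau> (norm (V z)) \<partial>lebesgue) \<le> ennreal e"
  proof -
    have "V absolutely_integrable_on ball a (2 * R)"
      using wg sub unfolding weak_gradient_def loc_integrable_def
      by (meson ball_subset_cball compact_cball lmeasurable_ball fmeasurableD set_integrable_subset)
    then have m: "(\<lambda>z. indicator (ball a (2 * R)) z *\<^sub>R V z) \<in> borel_measurable lebesgue"
      by (simp add: set_integrable_def borel_measurable_integrable)
    let ?h = "\<lambda>g. indicator {T<..} g * ennreal (g powr (?n - 1 / 2))"
    have hm: "(\<lambda>z. ?h (norm (indicator (ball a (2 * R)) z *\<^sub>R V z))) \<in> borel_measurable lebesgue"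
      by (rule measurable_compose[OF measurable_compose[OF m borel_measurable_norm]]) measurable
    \<comment> \<open>Only the product of \<open>V\<close> with the indicator is known to be
      measurable on the whole space, so the indicator is also put inside the argument of
      \<open>?h\<close>.\<close>
    have eq: "indicator (ball a (2 * R)) z * ?h (norm (V z)) = indicator (ball a (2 * R)) z * ?h (norm (indicator (ball a (2 * R)) z *\<^sub>R V z))" for z
      by (simp add: indicator_def)
    have meas: "(\<lambda>z. indicator (ball a (2 * R)) z * ?h (norm (V z))) \<in> borel_measurable lebesgue"
      unfolding eq by (intro borel_measurable_times_ennreal borel_measurable_indicator hm) auto
    have "(\<integral>\<^sup>+z. indicator (ball a (2 * R)) z * excess CARD('n) ?\<tau> (norm (V z)) \<partial>lebesgue) \<le>
      (\<integral>\<^sup>+z. ennreal (4 * T powr (3 / 2 - ?n)) * (indicator (ball a (2 * R)) z * ?h (norm (V z))) \<partial>lebesgue)"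
    proof (intro nn_integral_mono)
      fix z
      show "indicator (ball a (2 * R)) z * excess CARD('n) ?\<tau> (norm (V z)) \<le>
        ennreal (4 * T powr (3 / 2 - ?n)) * (indicator (ball a (2 * R)) z * ?h (norm (V z)))"
        using excess_powr_bound[OF n T, of "norm (V z)"] unfolding \<beta>_def
        by (cases "z \<in> ball a (2 * R)") auto
    qed
    also have "\<dots> = ennreal (4 * T powr (3 / 2 - ?n)) * (\<integral>\<^sup>+z. indicator (ball a (2 * R)) z * ?h (norm (V z)) \<partial>lebesgue)"
      by (rule nn_integral_cmult[OF meas])
    also have "\<dots> = ennreal e" using i by (simp add: T_def e_def ennreal_mult)
    finally show ?thesis .
  qed
  have "\<exists>b. AE x in lebesgue. x \<in> ball a (R / 2) \<longrightarrow> \<bar>u x - b\<bar> \<le> \<epsilon>"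
  proof (rule weakly_monotone_oscillation[OF wm wg sub R _ _ _ _ E e])
    have "(\<integral>\<^sup>+s. indicator {0<..<1} s * ennreal (?\<tau> s) \<partial>lborel) =
      (\<integral>\<^sup>+s. ennreal T * (indicator {0<..<1} s * ennreal (s powr (- \<beta>))) \<partial>lborel)"
      using T by (intro nn_integral_cong) (simp add: ennreal_mult mult_ac)
    also have "\<dots> = ennreal T * ennreal (1 / (- \<beta> + 1))"
      using \<beta> by (simp add: nn_integral_cmult nn_integral_powr_01)
    also have "\<dots> = ennreal (T / (1 - \<beta>))" using T \<beta> by (simp flip: ennreal_mult)
    finally show "(\<integral>\<^sup>+s. indicator {0<..<1} s * ennreal (?\<tau> s) \<partial>lborel) \<le> ennreal (T / (1 - \<beta>))" by simp
    show "T / (1 - \<beta>) \<ge> 0" using T \<beta> by simp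
    have 1: "2 * R * (T / (1 - \<beta>)) = \<epsilon> / 2"
      using R \<beta> by (simp add: T_def \<kappa>(2) field_simps)
    have 2: "16 * R * e / measure lborel (ball a R) = \<epsilon> / 2 * (?C * i)"
    proof -
      have "R powr ?n = R ^ CARD('n)" using R by (rule powr_realpow)
      moreover have "R powr ?n * R powr (- 1 / 2) = R * R powr (?n - 3 / 2)"
        using R by (simp add: powr_mult_base flip: powr_add)
      moreover have "T powr (3 / 2 - ?n) = \<kappa> powr (3 / 2 - ?n) * R powr (?n - 3 / 2)"
        using R \<kappa>(1) by (simp add: T_def powr_divide powr_diff)
      ultimately have "16 * R * e = 64 * \<kappa> powr (3 / 2 - ?n) * (R ^ CARD('n) * R powr (- 1 / 2)) * i"
        by (simp add: e_def)
      then show ?thesis using R v o by (simp add: measure_ball_scale v_def[symmetric] field_simps)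
    qed
    have "\<epsilon> / 2 * (?C * i) < \<epsilon> / 2 * 1" by (rule mult_strict_left_mono[OF Ci]) (use o in simp)
    then show "2 * R * (T / (1 - \<beta>)) + 16 * R * e / measure lborel (ball a R) < \<epsilon>"
      unfolding 1 2 by simp
  qed (use T in auto)
  then show False using no by simp
qed

text \<open>If the oscillation bound fails at every radius, the energy bound holds at all small
  dyadic scales. The balls in it are enlarged to \<open>cball a \<rho>\<close>, so that at each
  point the sum over the scales is the one in \<open>dyadic_sum_bound\<close> and the total stays
  bounded in \<open>N\<close>.\<close>

lemma vanishing_oscillation:
  fixes u :: "real^'n::finite \<Rightarrow> real"
  assumes wm: "weakly_monotone \<Omega> u" and wg: "weak_gradient \<Omega> u V"
    and sub: "cball a \<rho> \<subseteq> \<Omega>" and \<rho>: "\<rho> > 0" and n: "CARD('n) \<ge> 2" and \<epsilon>: "\<epsilon> > 0"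
    and lam: "lam > 0" and c: "c > 0"
    and dist: "AE x in lebesgue. x \<in> cball a \<rho> \<longrightarrow> k x \<ge> 1 \<and> c * norm (V x) ^ CARD('n) \<le> k x * J x"
    and J: "J absolutely_integrable_on cball a \<rho>"
    and k: "(\<lambda>x. exp (lam * k x)) absolutely_integrable_on cball a \<rho>"
  shows "\<exists>r>0. \<exists>b. AE x in lebesgue. x \<in> ball a r \<longrightarrow> \<bar>u x - b\<bar> \<le> \<epsilon>"
proof (rule ccontr)
  assume no: "\<not> ?thesis"
  let ?n = "real CARD('n)"
  let ?B = "cball a \<rho>"
  define \<kappa>0 where "\<kappa>0 = \<epsilon> * (1 - (?n - 7 / 4) / (?n - 3 / 2)) / 4"
  \<comment> \<open>\<open>dyadic_sum_bound\<close> asks for a number at most 1; lowering the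
    threshold only enlarges the level sets in \<open>h\<close>.\<close>
  define \<kappa> where "\<kappa> = min \<kappa>0 1"
  have "?n \<ge> 2" using n by simp
  then have \<kappa>0: "\<kappa>0 > 0" using \<epsilon> by (simp add: \<kappa>0_def)
  then have \<kappa>: "\<kappa> > 0" "\<kappa> \<le> 1" "\<kappa> \<le> \<kappa>0" by (auto simp: \<kappa>_def)
  define C where "C = 128 * \<kappa>0 powr (3 / 2 - ?n) / (unit_ball_vol ?n * \<epsilon>)"
  have C: "C > 0" using \<kappa>0 \<epsilon> by (simp add: C_def)
  define D where "D = 40 * \<kappa> powr (- 1 / 2) * (1 + ?n / (c * lam))"
  have D: "D \<ge> 0" using c lam by (simp add: D_def)
  define h where "h j g = indicator {\<kappa> * 2 ^ j<..} g * g powr (?n - 1 / 2)" for j and g :: real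
  define f where "f j z = indicator ?B z * ennreal (h j (norm (V z)))" for j z
  have "V absolutely_integrable_on ?B"
    using wg sub unfolding weak_gradient_def loc_integrable_def by auto
  then have Vm: "(\<lambda>z. indicator ?B z *\<^sub>R V z) \<in> borel_measurable lebesgue"
    by (simp add: set_integrable_def borel_measurable_integrable)
  have hb: "h j \<in> borel_measurable borel" for j unfolding h_def by measurable
  have fm [measurable]: "f j \<in> borel_measurable lebesgue" for j
  proof -
    have eq: "f j = (\<lambda>z. indicator ?B z * ennreal (h j (norm (indicator ?B z *\<^sub>R V z))))"
      by (auto simp: f_def indicator_def)
    have "(\<lambda>z. h j (norm (indicator ?B z *\<^sub>R V z))) \<in> borel_measurable lebesgue"
      by (rule measurable_compose[OF measurable_compose[OF Vm borel_measurable_norm] hb])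
    then show ?thesis unfolding eq
      by (intro borel_measurable_times_ennreal borel_measurable_indicator measurable_compose[OF _ measurable_ennreal]) auto
  qed
  obtain k1 where k1: "(1 / 2) ^ k1 < \<rho> / 2" using real_arch_pow_inv[of "\<rho> / 2" "1 / 2"] \<rho> by auto
  \<comment> \<open>At least 3 for the sum in \<open>dyadic_sum_bound\<close>, and at least
    \<open>k1\<close> so that the balls of radius 2 R stay in \<open>cball a \<rho>\<close>.\<close>
  define k0 where "k0 = max 3 k1"
  have lower: "1 \<le> ennreal (C * sqrt 2 ^ j) * (\<integral>\<^sup>+z. f j z \<partial>lebesgue)" if j: "j \<ge> k0" for j
  proof -
    define R :: real where "R = (1 / 2) ^ j"
    have R: "R > 0" by (simp add: R_def)
    have "R \<le> (1 / 2) ^ k1" unfolding R_def using j by (intro power_decreasing) (auto simp: k0_def)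
    then have R\<rho>: "2 * R \<le> \<rho>" using k1 by simp
    have subR: "cball a (2 * R) \<subseteq> \<Omega>" using sub subset_cball[OF R\<rho>, of a] by blast
    have sq: "R powr (- 1 / 2) = sqrt 2 ^ j"
    proof -
      have "R powr (- 1 / 2) = (2 powr (- real j)) powr (- 1 / 2)"
        by (simp add: R_def powr_minus powr_realpow power_one_over inverse_eq_divide)
      also have "\<dots> = (2 powr (1 / 2)) powr real j" by (simp add: powr_powr)
      also have "\<dots> = sqrt 2 ^ j" by (simp add: powr_half_sqrt powr_realpow)
      finally show ?thesis .
    qed
    have "\<not> (\<exists>b. AE x in lebesgue. x \<in> ball a (R / 2) \<longrightarrow> \<bar>u x - b\<bar> \<le> \<epsilon>)"
    proof
      assume "\<exists>b. AE x in lebesgue. x \<in> ball a (R / 2) \<longrightarrow> \<bar>u x - b\<bar> \<le> \<epsilon>"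
      moreover have "R / 2 > 0" using R by simp
      ultimately show False using no by blast
    qed
    then have "1 \<le> ennreal (C * sqrt 2 ^ j) * (\<integral>\<^sup>+z. indicator (ball a (2 * R)) z *
      (indicator {\<kappa>0 / R<..} (norm (V z)) * ennreal (norm (V z) powr (?n - 1 / 2))) \<partial>lebesgue)"
      using dyadic_energy_lower_bound[OF wm wg subR R n \<epsilon>]
      unfolding C_def \<kappa>0_def sq by blast
    also have "\<dots> \<le> ennreal (C * sqrt 2 ^ j) * (\<integral>\<^sup>+z. f j z \<partial>lebesgue)"
    proof (intro mult_left_mono nn_integral_mono)
      fix z
      have "\<kappa> * 2 ^ j \<le> \<kappa>0 / R" using \<kappa> by (simp add: R_def power_one_over mult_right_mono)
      then show "indicator (ball a (2 * R)) z * (indicator {\<kappa>0 / R<..} (norm (V z)) * ennreal (norm (V z) powr (?n - 1 / 2))) \<le> f j z"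
        using R\<rho> by (auto simp: f_def h_def indicator_def)
    qed auto
    finally show ?thesis .
  qed
  have iJ: "integrable lebesgue (\<lambda>z. indicator ?B z * J z)" and ik: "integrable lebesgue (\<lambda>z. indicator ?B z * exp (lam * k z))"
    using J k by (simp_all add: set_integrable_def)
  define Q where "Q = (\<integral>z. indicator ?B z * J z + indicator ?B z * exp (lam * k z) \<partial>lebesgue)"
  \<comment> \<open>The distortion inequality makes k J nonnegative, and k \<ge> 1 passes this on to
    J.\<close>
  have AE_nn: "AE z in lebesgue. 0 \<le> indicator ?B z * J z + indicator ?B z * exp (lam * k z)"
    using dist
  proof eventually_elim
    case (elim z)
    show ?case
    proof (cases "z \<in> ?B")
      case True
      then have "0 \<le> k z * J z" "k z \<ge> 1" using elim c
        by (auto intro: order_trans[of 0 "c * norm (V z) ^ CARD('n)"])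
      then have "J z \<ge> 0" by (simp add: zero_le_mult_iff)
      then show ?thesis by simp
    qed simp
  qed
  have Q: "(\<integral>\<^sup>+z. ennreal (indicator ?B z * J z + indicator ?B z * exp (lam * k z)) \<partial>lebesgue) = ennreal Q"
    unfolding Q_def using iJ ik AE_nn by (intro nn_integral_eq_integral) auto
  have Q0: "Q \<ge> 0" unfolding Q_def using AE_nn by (rule integral_nonneg_AE)
  have upper: "(\<Sum>j=k0..N. 1 / real j) \<le> C * (D * Q)" for N
  proof -
    have "ennreal (\<Sum>j=k0..N. 1 / real j) = (\<Sum>j=k0..N. ennreal (1 / real j))"
      by (simp add: sum_ennreal)
    also have "\<dots> \<le> (\<Sum>j=k0..N. ennreal (1 / real j) * (ennreal (C * sqrt 2 ^ j) * (\<integral>\<^sup>+z. f j z \<partial>lebesgue)))"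
      using lower by (intro sum_mono) (metis atLeastAtMost_iff mult.right_neutral mult_left_mono zero_le)
    also have "\<dots> = (\<Sum>j=k0..N. ennreal C * (\<integral>\<^sup>+z. ennreal (sqrt 2 ^ j / real j) * f j z \<partial>lebesgue))"
    proof (intro sum.cong refl)
      fix j
      have "ennreal (1 / real j) * ennreal (C * sqrt 2 ^ j) = ennreal C * ennreal (sqrt 2 ^ j / real j)"
        using C by (simp flip: ennreal_mult)
      then show "ennreal (1 / real j) * (ennreal (C * sqrt 2 ^ j) * (\<integral>\<^sup>+z. f j z \<partial>lebesgue)) =
        ennreal C * (\<integral>\<^sup>+z. ennreal (sqrt 2 ^ j / real j) * f j z \<partial>lebesgue)"
        by (simp add: nn_integral_cmult flip: mult.assoc)
    qed
    also have "\<dots> = ennreal C * (\<integral>\<^sup>+z. (\<Sum>j=k0..N. ennreal (sqrt 2 ^ j / real j) * f j z) \<partial>lebesgue)"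
      by (subst nn_integral_sum) (auto simp: sum_distrib_left)
    also have "\<dots> \<le> ennreal C * (\<integral>\<^sup>+z. ennreal D * ennreal (indicator ?B z * J z + indicator ?B z * exp (lam * k z)) \<partial>lebesgue)"
    proof (intro mult_left_mono nn_integral_mono_AE)
      show "AE z in lebesgue. (\<Sum>j=k0..N. ennreal (sqrt 2 ^ j / real j) * f j z) \<le>
        ennreal D * ennreal (indicator ?B z * J z + indicator ?B z * exp (lam * k z))"
        using dist
      proof eventually_elim
        case (elim z)
        show ?case
        proof (cases "z \<in> ?B")
          case True
          let ?g = "norm (V z)"
          have "(\<Sum>j=k0..N. sqrt 2 ^ j / real j * h j ?g) =
             (\<Sum>j\<in>{j\<in>{k0..N}. \<kappa> * 2 ^ j < ?g}. sqrt 2 ^ j / real j * ?g powr (?n - 1 / 2))"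
            unfolding sum.inter_filter[OF finite_atLeastAtMost]
            by (intro sum.cong) (auto simp: h_def indicator_def)
          also have "\<dots> \<le> (\<Sum>j | 3 \<le> j \<and> j \<le> N \<and> \<kappa> * 2 ^ j < ?g. sqrt 2 ^ j / real j * ?g powr (?n - 1 / 2))"
          proof (rule sum_mono2)
            show "finite {j. 3 \<le> j \<and> j \<le> N \<and> \<kappa> * 2 ^ j < ?g}" by (rule finite_subset[of _ "{..N}"]) auto
          qed (auto simp: k0_def)
          also have "\<dots> = (\<Sum>j | 3 \<le> j \<and> j \<le> N \<and> \<kappa> * 2 ^ j < ?g. sqrt 2 ^ j / real j) * ?g powr (?n - 1 / 2)"
            by (simp add: sum_distrib_right)
          also have "\<dots> \<le> D * (J z + exp (lam * k z))"
            unfolding D_def using elim True n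
            by (intro dyadic_sum_bound[OF \<kappa>(1,2) lam c]) auto
          finally have le: "(\<Sum>j=k0..N. sqrt 2 ^ j / real j * h j ?g) \<le> D * (J z + exp (lam * k z))" .
          have "(\<Sum>j=k0..N. ennreal (sqrt 2 ^ j / real j) * f j z) = (\<Sum>j=k0..N. ennreal (sqrt 2 ^ j / real j * h j ?g))"
            using True by (intro sum.cong) (auto simp: f_def h_def simp flip: ennreal_mult)
          also have "\<dots> = ennreal (\<Sum>j=k0..N. sqrt 2 ^ j / real j * h j ?g)"
            by (intro sum_ennreal) (simp add: h_def)
          also have "\<dots> \<le> ennreal (D * (J z + exp (lam * k z)))" using le by (rule ennreal_leI)
          also have "\<dots> = ennreal D * ennreal (J z + exp (lam * k z))" using D by (rule ennreal_mult')
          finally show ?thesis using True by simp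
        qed (simp add: f_def)
      qed
    qed simp
    also have "\<dots> = ennreal C * (ennreal D * ennreal Q)"
      using iJ ik by (subst nn_integral_cmult) (auto simp: Q borel_measurable_integrable)
    also have "\<dots> = ennreal (C * (D * Q))" using C D Q0 by (simp add: ennreal_mult)
    finally show ?thesis using C D Q0 by (subst (asm) ennreal_le_iff) auto
  qed
  have "summable (\<lambda>j. inverse (real j))"
  proof (rule bounded_imp_summable)
    fix N
    have "(\<Sum>j\<le>N. inverse (real j)) \<le> (\<Sum>j\<in>{..<k0} \<union> {k0..N}. inverse (real j))"
      by (intro sum_mono2) auto
    also have "\<dots> = (\<Sum>j<k0. inverse (real j)) + (\<Sum>j=k0..N. 1 / real j)"
      by (subst sum.union_disjoint) (auto simp: inverse_eq_divide)
    also have "\<dots> \<le> (\<Sum>j<k0. inverse (real j)) + C * (D * Q)" using upper[of N] by simp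
    finally show "(\<Sum>j\<le>N. inverse (real j)) \<le> (\<Sum>j<k0. inverse (real j)) + C * (D * Q)" .
  qed auto
  then show False using not_summable_harmonic[where 'a = real] by simp
qed

theorem theorem1p3:
  fixes \<Omega> :: "(real^'n::{finite,wellorder}) set"
    and \<omega> :: "('n, 'm::{finite,wellorder}) form"
    and f :: "real^'n::_ \<Rightarrow> real^'m::_"
    and K\<^sub>f :: "real^'n::_ \<Rightarrow> ereal"
    and lam :: real
  assumes "CARD('n) \<le> CARD('m)"
    and "open \<Omega>" and "connected \<Omega>" and "\<Omega> \<noteq> {}"
    and "volume_form \<omega>" and "bounded_form \<omega>"
    and "finite_distortion_curve \<Omega> \<omega> f K\<^sub>f"
    and "\<And>i. weakly_monotone \<Omega> (\<lambda>x. f x $ i)"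
    and "lam > 0"
    and "loc_integrable \<Omega> (\<lambda>x. exp (lam * real_of_ereal (K\<^sub>f x)))"
  shows "\<exists>g. continuous_on \<Omega> g \<and> (AE x in lebesgue_on \<Omega>. g x = f x)"
proof -
  obtain c where c: "c > 0" "\<And>p. c \<le> comass \<omega> p"
    using bounded_form_comass[OF \<open>bounded_form \<omega>\<close>] by blast
  obtain Df where Df: "weak_differential \<Omega> f Df"
    and intJ: "loc_integrable \<Omega> (star_pullback f Df \<omega>)"
    and K1: "\<forall>x\<in>\<Omega>. K\<^sub>f x \<ge> 1"
    and Kfin: "AE x in lebesgue_on \<Omega>. K\<^sub>f x < \<infinity>"
    and dist: "AE x in lebesgue_on \<Omega>. ereal (comass \<omega> (f x) * onorm ((*v) (Df x)) ^ CARD('n))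
             \<le> K\<^sub>f x * ereal (star_pullback f Df \<omega> x)"
    using \<open>finite_distortion_curve \<Omega> \<omega> f K\<^sub>f\<close> unfolding finite_distortion_curve_def by blast
  let ?J = "star_pullback f Df \<omega>"
  \<comment> \<open>\<open>real_of_ereal\<close> sends infinity to 0; by \<open>Kfin\<close> this
    concerns a null set only.\<close>
  let ?k = "\<lambda>x. real_of_ereal (K\<^sub>f x)"
  have \<Omega>: "\<Omega> \<inter> space lebesgue \<in> sets lebesgue" using \<open>open \<Omega>\<close> by auto
  have "AE x in lebesgue_on \<Omega>. x \<in> \<Omega>" using AE_space[of "lebesgue_on \<Omega>"] by simp
  with Kfin dist have "AE x in lebesgue_on \<Omega>. \<forall>i. ?k x \<ge> 1 \<and> c * norm (Df x $ i) ^ CARD('n) \<le> ?k x * ?J x"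
  proof eventually_elim
    case (elim x)
    have K: "K\<^sub>f x \<ge> 1" using K1 elim by blast
    then obtain k where k: "K\<^sub>f x = ereal k" using elim by (cases "K\<^sub>f x") auto
    \<comment> \<open>Passage from the curve to one coordinate function: the comass is at least
      \<open>c\<close>, and the operator norm dominates each row.\<close>
    have "c * norm (Df x $ i) ^ CARD('n) \<le> comass \<omega> (f x) * onorm ((*v) (Df x)) ^ CARD('n)" for i
      using c by (intro mult_mono power_mono norm_row_le_onorm) (auto intro: order_trans[OF less_imp_le])
    moreover have "comass \<omega> (f x) * onorm ((*v) (Df x)) ^ CARD('n) \<le> k * ?J x"
      using elim unfolding k by simp
    ultimately show ?case using K unfolding k by (auto intro: order_trans)
  qed
  then have key: "AE x in lebesgue. x \<in> \<Omega> \<longrightarrow> (\<forall>i. ?k x \<ge> 1 \<and> c * norm (Df x $ i) ^ CARD('n) \<le> ?k x * ?J x)"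
    by (rule AE_restrict_space_iff[OF \<Omega>, THEN iffD1])
  have "\<exists>g. continuous_on \<Omega> g \<and> (AE x in lebesgue. x \<in> \<Omega> \<longrightarrow> g x = f x $ i)" for i
  proof (rule continuous_representative)
    fix a :: "real^'n::_" and e :: real assume a: "a \<in> \<Omega>" and e: "e > 0"
    obtain \<rho> where \<rho>: "\<rho> > 0" "cball a \<rho> \<subseteq> \<Omega>" using \<open>open \<Omega>\<close> a open_contains_cball by blast
    have wg: "weak_gradient \<Omega> (\<lambda>x. f x $ i) (\<lambda>x. Df x $ i)"
      using Df unfolding weak_differential_def by blast
    show "\<exists>r>0. \<exists>b. AE x in lebesgue. x \<in> ball a r \<longrightarrow> \<bar>f x $ i - b\<bar> \<le> e"
    \<comment> \<open>The exponent \<beta> of \<open>excess_powr_bound\<close> is below 1 for n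
      \<ge> 2, but equals 3/2 for n = 1.\<close>
    proof (cases "CARD('n) = 1")
      case True
      show ?thesis by (rule vanishing_oscillation_1[OF assms(8) wg \<rho>(2,1) True e])
    next
      case False
      have n: "CARD('n) \<ge> 2" using False zero_less_card_finite[where 'a = 'n] by linarith
      show ?thesis
      proof (rule vanishing_oscillation[OF assms(8) wg \<rho>(2,1) n e \<open>lam > 0\<close> c(1)])
        show "AE x in lebesgue. x \<in> cball a \<rho> \<longrightarrow> ?k x \<ge> 1 \<and> c * norm (Df x $ i) ^ CARD('n) \<le> ?k x * ?J x"
          using key by (rule eventually_mono) (use \<rho>(2) in blast)
        show "?J absolutely_integrable_on cball a \<rho>" "(\<lambda>x. exp (lam * ?k x)) absolutely_integrable_on cball a \<rho>"
          using intJ assms(10) \<rho>(2) unfolding loc_integrable_def by auto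
      qed
    qed
  qed
  then have "\<forall>i. \<exists>g. continuous_on \<Omega> g \<and> (AE x in lebesgue. x \<in> \<Omega> \<longrightarrow> g x = f x $ i)" by blast
  from choice[OF this] obtain g where g: "\<And>i. continuous_on \<Omega> (g i)"
    "\<And>i. AE x in lebesgue. x \<in> \<Omega> \<longrightarrow> g i x = f x $ i" by blast
  have "AE x in lebesgue. \<forall>i. x \<in> \<Omega> \<longrightarrow> g i x = f x $ i"
    by (intro AE_all_countable[THEN iffD2] allI g(2))
  then have "AE x in lebesgue. x \<in> \<Omega> \<longrightarrow> (\<chi> i. g i x) = f x"
    by (rule eventually_mono) (simp add: vec_eq_iff)
  then have "AE x in lebesgue_on \<Omega>. (\<chi> i. g i x) = f x"
    by (rule AE_restrict_space_iff[OF \<Omega>, THEN iffD2])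
  moreover have "continuous_on \<Omega> (\<lambda>x. \<chi> i. g i x)"
    using g(1) by (rule continuous_on_vec_lambda)
  ultimately show ?thesis by blast
qed

end
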